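(* Let $\mathcal H$ be a separable complex Hilbert space and let $B\in\mathcal B^1(\mathcal H)$ with $\mathrm{Re}(\mathrm{tr}(B))\neq 0$. Then the map $$\hat\Xi_B:(H,\Phi)\mapsto -i[H,\cdot]+\Phi-\Big\{\tfrac{\Phi^*(\mathbf 1)}{2},\cdot\Big\}\in\mathsf L(\mathsf{CPTP}(\mathcal H))$$ with domain $$\{(H,\Phi)\in i\mathfrak u(\mathcal H)\times\mathsf{CP}_B(\mathcal H):\mathrm{Im}(\mathrm{tr}(\Phi(B)))=2\,\mathrm{Re}(\mathrm{tr}(B^*H))\}$$ is bijective (onto $\mathsf L(\mathsf{CPTP}(\mathcal H))$). In particular, if $B\in\mathcal B^1(\mathcal H)$ is self-adjoint with $\mathrm{tr}(B)\neq0$, then $$\hat\Xi_B:\{H\in i\mathfrak u(\mathcal H):\mathrm{tr}(BH)=0\}\times\mathsf{CP}_B(\mathcal H)\to\mathsf L(\mathsf{CPTP}(\mathcal H)),\qquad (H,\Phi)\mapsto -i[H,\cdot]+\Phi-\Big\{\tfrac{\Phi^*(\mathbf 1)}{2},\cdot\Big\}$$ is bijective.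
   Context: $\mathcal B(\mathcal H)$ denotes the bounded operators on $\mathcal H$; $\mathcal B^1(\mathcal H)$ the trace-class operators with trace norm; $\mathcal B^2(\mathcal H)$ the Hilbert-Schmidt operators, a Hilbert space under $\langle X,Y\rangle_{\mathsf{HS}}=\mathrm{tr}(X^*Y)$, so that trace-class operators on $\mathcal B^2(\mathcal H)$, and their traces, are defined. $i\mathfrak u(\mathcal H)$ is the set of bounded self-adjoint operators on $\mathcal H$ ($\mathfrak u(\mathcal H)$ being the bounded skew-adjoint operators). $[A,X]=AX-XA$ and $\{A,X\}=AX+XA$. $\mathsf{CP}(\mathcal H)$ is the set of completely positive linear maps $\Phi:\mathcal B^1(\mathcal H)\to\mathcal B^1(\mathcal H)$ (i.e. $\mathrm{id}_n\otimes\Phi$, acting entrywise on $n\times n$ block operators in $\mathcal B^1(\mathbb C^n\otimes\mathcal H)$, preserves positive semi-definiteness for every $n\in\mathbb N$); such maps are automatically bounded. $\mathsf{CPTP}(\mathcal H)$ is the set of those $\Phi\in\mathsf{CP}(\mathcal H)$ which are trace-preserving. For bounded $\Phi$ on $\mathcal B^1(\mathcal H)$, the dual map $\Phi^*:\mathcal B(\mathcal H)\to\mathcal B(\mathcal H)$ is the unique bounded map with $\mathrm{tr}(\Phi(A)C)=\mathrm{tr}(A\Phi^*(C))$ for all $A\in\mathcal B^1(\mathcal H)$, $C\in\mathcal B(\mathcal H)$. For $B\in\mathcal B^1(\mathcal H)$, $\Phi(B^*(\cdot)B)$ denotes the map $X\mapsto\Phi(B^*XB)$ on $\mathcal B^2(\mathcal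 H)$, which is a trace-class operator on the Hilbert space $\mathcal B^2(\mathcal H)$, and $$\mathsf{CP}_B(\mathcal H):=\{\Phi\in\mathsf{CP}(\mathcal H):\mathrm{tr}(\Phi(B^*(\cdot)B))=0\}.$$ $\mathsf L(\mathsf{CPTP}(\mathcal H)):=\{L\in\mathcal B(\mathcal B^1(\mathcal H)):e^{tL}\in\mathsf{CPTP}(\mathcal H)\text{ for all }t\ge0\}$, where $\mathcal B(\mathcal B^1(\mathcal H))$ is the space of bounded linear maps on $\mathcal B^1(\mathcal H)$. (It is a known theorem that $\mathsf L(\mathsf{CPTP}(\mathcal H))=\{-i[H,\cdot]+\Phi-\tfrac12\{\Phi^*(\mathbf 1),\cdot\}:H\in i\mathfrak u(\mathcal H),\Phi\in\mathsf{CP}(\mathcal H)\}$.) *)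

theory Defs
  imports "HOL-Analysis.Analysis"
begin

section \<open>Complex Hilbert spaces\<close>

class complex_vector = real_vector +
  fixes scaleC :: "complex \<Rightarrow> 'a \<Rightarrow> 'a" (infixr \<open>*\<^sub>C\<close> 75)
  assumes scaleC_add_right: "a *\<^sub>C (x + y) = a *\<^sub>C x + a *\<^sub>C y"
    and scaleC_add_left: "(a + b) *\<^sub>C x = a *\<^sub>C x + b *\<^sub>C x"
    and scaleC_scaleC: "a *\<^sub>C (b *\<^sub>C x) = (a * b) *\<^sub>C x"
    and scaleR_scaleC: "r *\<^sub>R x = complex_of_real r *\<^sub>C x"

class complex_normed_vector = complex_vector + real_normed_vector +
  assumes norm_scaleC: "norm (a *\<^sub>C x) = cmod a * norm x"

text \<open>The inner product is conjugate-linear in its first and linear in its second argument.\<close>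

class complex_inner = complex_vector + real_inner +
  fixes cinner :: "'a \<Rightarrow> 'a \<Rightarrow> complex"
  assumes cinner_commute: "cinner x y = cnj (cinner y x)"
    and cinner_add_right: "cinner x (y + z) = cinner x y + cinner x z"
    and cinner_scaleC_right: "cinner x (a *\<^sub>C y) = a * cinner x y"
    and inner_eq_Re_cinner: "inner x y = Re (cinner x y)"

class chilbert_space = complex_inner + complete_space

subclass (in chilbert_space) banach ..

lemma scaleC_one [simp]: "1 *\<^sub>C x = (x::'a::complex_vector)"
  by (metis of_real_1 scaleR_one scaleR_scaleC)

lemma scaleC_zero_right [simp]: "a *\<^sub>C 0 = (0::'a::complex_vector)"
  using scaleC_add_right [of a "0::'a" 0] by simp

lemma scaleC_zero_left [simp]: "0 *\<^sub>C x = (0::'a::complex_vector)"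
  using scaleC_add_left [of 0 0 x] by simp

lemma scaleC_minus_right: "a *\<^sub>C (- x) = - (a *\<^sub>C (x::'a::complex_vector))"
  using scaleC_add_right [of a x "- x"] by (simp add: eq_neg_iff_add_eq_0 add.commute)

lemma scaleC_diff_right: "a *\<^sub>C (x - y) = a *\<^sub>C x - a *\<^sub>C (y::'a::complex_vector)"
  using scaleC_add_right [of a x "- y"] by (simp add: scaleC_minus_right)

lemma scaleC_sum_right: "a *\<^sub>C (\<Sum>i\<in>S. f i) = (\<Sum>i\<in>S. a *\<^sub>C (f i :: 'a::complex_vector))"
  by (induction S rule: infinite_finite_induct) (auto simp: scaleC_add_right)

context complex_inner
begin

lemma cinner_add_left: "cinner (x + y) z = cinner x z + cinner y z"
  by (metis cinner_add_right cinner_commute complex_cnj_add)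

lemma cinner_scaleC_left: "cinner (a *\<^sub>C x) y = cnj a * cinner x y"
  by (metis cinner_scaleC_right cinner_commute complex_cnj_mult)

lemma cinner_self: "cinner x x = complex_of_real ((norm x)\<^sup>2)"
proof -
  have "Im (cinner x x) = 0"
    by (metis cinner_commute complex_cnj_cancel_iff cnj.simps(2) equal_neg_zero)
  moreover have "Re (cinner x x) = (norm x)\<^sup>2"
    by (simp flip: inner_eq_Re_cinner power2_norm_eq_inner)
  ultimately show ?thesis by (simp add: complex_eq_iff)
qed

lemma norm_scaleC_aux: "norm (a *\<^sub>C x) = cmod a * norm x"
proof -
  have "complex_of_real ((norm (a *\<^sub>C x))\<^sup>2) = a * cnj a * cinner x x"
    by (simp only: cinner_self [symmetric] cinner_scaleC_left cinner_scaleC_right mult_ac)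
  also have "\<dots> = complex_of_real ((cmod a * norm x)\<^sup>2)"
    by (simp only: cinner_self complex_norm_square [symmetric] of_real_mult of_real_power power_mult_distrib)
  finally have "complex_of_real ((norm (a *\<^sub>C x))\<^sup>2) = complex_of_real ((cmod a * norm x)\<^sup>2)" .
  then have "(norm (a *\<^sub>C x))\<^sup>2 = (cmod a * norm x)\<^sup>2"
    using of_real_eq_iff by blast
  then show ?thesis
    by (simp add: power2_eq_iff_nonneg)
qed

end

subclass (in complex_inner) complex_normed_vector
  by standard (rule norm_scaleC_aux)

lemma cinner_scaleR_right: "cinner (x::'a::complex_inner) (r *\<^sub>R y) = complex_of_real r * cinner x y"
  by (simp add: scaleR_scaleC cinner_scaleC_right)

lemma cinner_scaleR_left: "cinner (r *\<^sub>R (x::'a::complex_inner)) y = complex_of_real r * cinner x y"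
  by (simp add: scaleR_scaleC cinner_scaleC_left)

lemma cinner_eq_inner: "cinner x y = Complex (inner x y) (inner (\<i> *\<^sub>C x) (y::'a::complex_inner))"
  by (simp add: inner_eq_Re_cinner cinner_scaleC_left)

lemma bounded_linear_cinner_right: "bounded_linear (cinner (x::'a::complex_inner))"
proof -
  have "bounded_linear (\<lambda>y. complex_of_real (inner x y) + \<i> * complex_of_real (inner (\<i> *\<^sub>C x) y))"
    by (intro bounded_linear_intros bounded_linear_add bounded_linear_compose [OF bounded_linear_mult_right]
        bounded_linear_compose [OF bounded_linear_of_real])
  then show ?thesis
    by (simp add: cinner_eq_inner Complex_eq [symmetric] flip: cinner_eq_inner)
qed


lemma cinner_zero_right [simp]: "cinner (x::'a::complex_inner) 0 = 0"
  using linear_simps(3) [OF bounded_linear_cinner_right] .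

lemma cinner_zero_left [simp]: "cinner 0 (x::'a::complex_inner) = 0"
  by (metis cinner_commute cinner_zero_right complex_cnj_zero)

lemma cinner_diff_right: "cinner (x::'a::complex_inner) (y - z) = cinner x y - cinner x z"
  using linear_simps(2) [OF bounded_linear_cinner_right] .

lemma cinner_diff_left: "cinner (x - y) (z::'a::complex_inner) = cinner x z - cinner y z"
  by (metis cinner_commute cinner_diff_right complex_cnj_diff)

lemma cinner_sum_right: "cinner (x::'a::complex_inner) (\<Sum>i\<in>S. f i) = (\<Sum>i\<in>S. cinner x (f i))"
  by (induction S rule: infinite_finite_induct) (auto simp: cinner_add_right)

lemma cinner_sum_left: "cinner (\<Sum>i\<in>S. f i) (x::'a::complex_inner) = (\<Sum>i\<in>S. cinner (f i) x)"
  by (induction S rule: infinite_finite_induct) (auto simp: cinner_add_left)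

lemma cmod_cinner_le: "cmod (cinner x y) \<le> norm x * norm (y::'a::complex_inner)"
proof (cases "cinner x y = 0")
  case False
  define c where "c = cnj (cinner x y) / complex_of_real (cmod (cinner x y))"
  have c: "cmod c = 1" using False by (simp add: c_def norm_divide)
  have "cinner x (c *\<^sub>C y) = complex_of_real (cmod (cinner x y))"
    using False by (simp add: c_def cinner_scaleC_right complex_norm_square [symmetric] power2_eq_square mult.commute)
  then have "cmod (cinner x y) = inner x (c *\<^sub>C y)"
    by (simp add: inner_eq_Re_cinner)
  also have "\<dots> \<le> norm x * norm (c *\<^sub>C y)" by (rule norm_cauchy_schwarz)
  finally show ?thesis by (simp add: norm_scaleC c)
qed simp

lemma cinner_ext:
  assumes "\<And>x. cinner x y = cinner x (z::'a::complex_inner)"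
  shows "y = z"
proof -
  have "cinner (y - z) (y - z) = 0" by (simp add: cinner_diff_right assms)
  then show ?thesis by (simp add: cinner_self)
qed


section \<open>Bounded operators\<close>

definition bounded_clinear :: "('a::complex_normed_vector \<Rightarrow> 'b::complex_normed_vector) \<Rightarrow> bool" where
  "bounded_clinear f \<longleftrightarrow> bounded_linear f \<and> (\<forall>c x. f (c *\<^sub>C x) = c *\<^sub>C f x)"

typedef (overloaded) 'a bop = "{f :: 'a::complex_normed_vector \<Rightarrow> 'a. bounded_clinear f}"
  morphisms bop_apply Bop
  by (rule exI [of _ "\<lambda>_. 0"]) (simp add: bounded_clinear_def)

declare [[coercion bop_apply]]

setup_lifting type_definition_bop

lemma bop_eqI: "(\<And>x. A x = B x) \<Longrightarrow> A = B" for A B :: "'a::complex_normed_vector bop"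
  by transfer auto

instantiation bop :: (complex_normed_vector) complex_normed_vector
begin

lift_definition norm_bop :: "'a bop \<Rightarrow> real" is onorm .

lift_definition minus_bop :: "'a bop \<Rightarrow> 'a bop \<Rightarrow> 'a bop" is "\<lambda>f g x. f x - g x"
  by (simp add: bounded_clinear_def bounded_linear_sub scaleC_diff_right)

definition dist_bop :: "'a bop \<Rightarrow> 'a bop \<Rightarrow> real" where
  "dist_bop A B = norm (A - B)"

definition uniformity_bop :: "('a bop \<times> 'a bop) filter" where
  "uniformity_bop = (INF e\<in>{0<..}. principal {(A, B). dist A B < e})"

definition open_bop :: "'a bop set \<Rightarrow> bool" where
  "open_bop S \<longleftrightarrow> (\<forall>A\<in>S. \<forall>\<^sub>F (A', B) in uniformity. A' = A \<longrightarrow> B \<in> S)"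

lift_definition uminus_bop :: "'a bop \<Rightarrow> 'a bop" is "\<lambda>f x. - f x"
  by (simp add: bounded_clinear_def bounded_linear_minus scaleC_minus_right)

lift_definition zero_bop :: "'a bop" is "\<lambda>x. 0"
  by (simp add: bounded_clinear_def)

lift_definition plus_bop :: "'a bop \<Rightarrow> 'a bop \<Rightarrow> 'a bop" is "\<lambda>f g x. f x + g x"
  by (simp add: bounded_clinear_def bounded_linear_add scaleC_add_right)

lift_definition scaleC_bop :: "complex \<Rightarrow> 'a bop \<Rightarrow> 'a bop" is "\<lambda>c f x. c *\<^sub>C f x"
proof -
  fix c :: complex and f :: "'a \<Rightarrow> 'a"
  assume f: "bounded_clinear f"
  have "bounded_linear (\<lambda>x::'a. c *\<^sub>C x)"
    by (rule bounded_linear_intro [where K = "cmod c"])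
       (auto simp: scaleC_add_right norm_scaleC scaleR_scaleC scaleC_scaleC mult.commute)
  then show "bounded_clinear (\<lambda>x. c *\<^sub>C f x)"
    using f by (auto simp: bounded_clinear_def scaleC_scaleC mult.commute intro: bounded_linear_compose)
qed

lift_definition scaleR_bop :: "real \<Rightarrow> 'a bop \<Rightarrow> 'a bop" is "\<lambda>r f x. r *\<^sub>R f x"
proof -
  fix r :: real and f :: "'a \<Rightarrow> 'a"
  assume f: "bounded_clinear f"
  then have "bounded_linear (\<lambda>x. r *\<^sub>R f x)"
    using bounded_linear_compose [OF bounded_linear_scaleR_right, of f r]
    by (simp add: bounded_clinear_def)
  moreover have "r *\<^sub>R f (c *\<^sub>C x) = c *\<^sub>C (r *\<^sub>R f x)" for c x
    using f by (simp add: bounded_clinear_def scaleR_scaleC scaleC_scaleC mult.commute)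
  ultimately show "bounded_clinear (\<lambda>x. r *\<^sub>R f x)"
    by (simp add: bounded_clinear_def)
qed

definition sgn_bop :: "'a bop \<Rightarrow> 'a bop" where
  "sgn_bop A = inverse (norm A) *\<^sub>R A"

instance
proof
  fix a b :: complex and r :: real and A B :: "'a bop"
  show "norm (a *\<^sub>C A) = cmod a * norm A"
  proof transfer
    fix a :: complex and f :: "'a \<Rightarrow> 'a"
    assume f: "bounded_clinear f"
    have "norm (a *\<^sub>C f x) = norm ((cmod a) *\<^sub>R f x)" for x
      by (simp add: norm_scaleC)
    then have "onorm (\<lambda>x. a *\<^sub>C f x) = onorm (\<lambda>x. cmod a *\<^sub>R f x)"
      unfolding onorm_def by simp
    also have "\<dots> = cmod a * onorm f"
      using f onorm_scaleR [of f "cmod a"] by (simp add: bounded_clinear_def)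
    finally show "onorm (\<lambda>x. a *\<^sub>C f x) = cmod a * onorm f" .
  qed
  show "r *\<^sub>R A = complex_of_real r *\<^sub>C A"
    by transfer (simp add: scaleR_scaleC)
qed (unfold dist_bop_def open_bop_def sgn_bop_def uniformity_bop_def,
     (rule refl | (transfer, force simp: bounded_clinear_def onorm_triangle onorm_scaleR onorm_eq_0
        algebra_simps scaleC_add_right scaleC_add_left scaleC_scaleC))+)

end

text \<open>The multiplication of \<^typ>\<open>'a bop\<close> is composition, and \<open>1\<close> is the identity operator.\<close>

instantiation bop :: (complex_normed_vector) "{real_normed_algebra, monoid_mult}"
begin

lift_definition times_bop :: "'a bop \<Rightarrow> 'a bop \<Rightarrow> 'a bop" is "\<lambda>f g x. f (g x)"
  by (auto simp: bounded_clinear_def intro: bounded_linear_compose)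

lift_definition one_bop :: "'a bop" is "\<lambda>x. x"
  by (simp add: bounded_clinear_def)

instance
proof
  fix A B :: "'a bop"
  show "norm (A * B) \<le> norm A * norm B"
    by transfer (auto simp: bounded_clinear_def onorm_compose [unfolded o_def])
qed (transfer, auto simp: bounded_clinear_def linear_simps)+

end

lemma bop_simps [simp]:
  fixes A B :: "'a::complex_normed_vector bop"
  shows "(A + B) x = A x + B x" "(A - B) x = A x - B x" "(- A) x = - A x" "(0 :: 'a bop) x = 0"
    "(r *\<^sub>R A) x = r *\<^sub>R A x" "(c *\<^sub>C A) x = c *\<^sub>C A x" "(A * B) x = A (B x)" "(1 :: 'a bop) x = x"
  by (transfer; simp)+

lemma bop_linear:
  fixes A :: "'a::complex_normed_vector bop"
  shows "A (x + y) = A x + A y" "A (x - y) = A x - A y" "A (- x) = - A x" "A 0 = 0"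
    "A (c *\<^sub>C x) = c *\<^sub>C A x" "A (r *\<^sub>R x) = r *\<^sub>R A x"
  by (transfer; simp add: bounded_clinear_def linear_simps)+

lemma bop_sum: "A (\<Sum>i\<in>S. f i) = (\<Sum>i\<in>S. A (f i))" for A :: "'a::complex_normed_vector bop"
  by (induction S rule: infinite_finite_induct) (auto simp: bop_linear)

lemma bounded_linear_bop_apply: "bounded_linear (bop_apply A)"
  by transfer (simp add: bounded_clinear_def)

lemma norm_bop: "norm (A x) \<le> norm A * norm x" for A :: "'a::complex_normed_vector bop"
  by transfer (simp add: bounded_clinear_def onorm)

lemma norm_bop_bound: "0 \<le> b \<Longrightarrow> (\<And>x. norm (A x) \<le> b * norm x) \<Longrightarrow> norm A \<le> b"
  for A :: "'a::complex_normed_vector bop"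
  by transfer (rule onorm_bound)

lemma norm_one_bop_le: "norm (1 :: 'a::complex_normed_vector bop) \<le> 1"
  by (rule norm_bop_bound) auto

lemma tendsto_bop_apply: "(F \<longlongrightarrow> A) G \<Longrightarrow> ((\<lambda>n. bop_apply (F n) x) \<longlongrightarrow> A x) G"
  for A :: "'a::complex_normed_vector bop"
proof -
  have "bounded_linear (\<lambda>A::'a bop. A x)"
    by (rule bounded_linear_intro [where K = "norm x"]) (auto simp: norm_bop)
  then show "(F \<longlongrightarrow> A) G \<Longrightarrow> ?thesis" by (rule bounded_linear.tendsto)
qed

lemma bop_limit:
  fixes X :: "nat \<Rightarrow> 'a::chilbert_space bop"
  assumes "Cauchy X"
  shows "convergent X"
proof -
  have XC: "\<exists>N. \<forall>m\<ge>N. \<forall>n\<ge>N. norm (X m - X n) < e" if "e > 0" for e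
    using assms that by (auto simp: Cauchy_def dist_norm)
  have pt: "convergent (\<lambda>n. X n x)" for x
  proof -
    have "Cauchy (\<lambda>n. X n x)"
    proof (rule CauchyI)
      fix e :: real assume "e > 0"
      then obtain N where N: "\<forall>m\<ge>N. \<forall>n\<ge>N. norm (X m - X n) < e / (norm x + 1)"
        using XC [of "e / (norm x + 1)"] by (auto simp: add_nonneg_pos)
      have "norm (X m x - X n x) < e" if "m \<ge> N" "n \<ge> N" for m n
      proof -
        have "norm (X m x - X n x) \<le> norm (X m - X n) * norm x"
          using norm_bop [of "X m - X n" x] by simp
        also have "\<dots> \<le> norm (X m - X n) * (norm x + 1)" by (simp add: mult_left_mono)
        also have "\<dots> < e" using N that by (simp add: pos_less_divide_eq add_nonneg_pos)
        finally show ?thesis .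
      qed
      then show "\<exists>M. \<forall>m\<ge>M. \<forall>n\<ge>M. norm (X m x - X n x) < e" by blast
    qed
    then show ?thesis by (rule Cauchy_convergent)
  qed
  define f where "f = (\<lambda>x. lim (\<lambda>n. X n x))"
  have f: "(\<lambda>n. X n x) \<longlonglongrightarrow> f x" for x
    using pt by (simp add: f_def convergent_LIMSEQ_iff)
  obtain K where K: "norm (X n) \<le> K" for n
    using Cauchy_Bseq [OF assms] by (auto simp: Bseq_def)
  have fc: "f (c *\<^sub>C x) = c *\<^sub>C f x" for c x
  proof -
    have "(\<lambda>n. c *\<^sub>C X n x) \<longlonglongrightarrow> c *\<^sub>C f x"
      using f bounded_linear.tendsto [OF bounded_linear_bop_apply [of "c *\<^sub>C 1"], of "\<lambda>n. X n x"]
      by simp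
    then show ?thesis using f [of "c *\<^sub>C x"] by (simp add: bop_linear LIMSEQ_unique)
  qed
  have "bounded_linear f"
  proof (rule bounded_linear_intro)
    show "f (x + y) = f x + f y" for x y
      using f [of "x + y"] tendsto_add [OF f f] by (simp add: bop_linear LIMSEQ_unique)
    show "f (r *\<^sub>R x) = r *\<^sub>R f x" for r x by (simp add: scaleR_scaleC fc)
    show "norm (f x) \<le> norm x * K" for x
    proof (rule LIMSEQ_le_const2 [OF tendsto_norm [OF f]])
      show "\<exists>N. \<forall>n\<ge>N. norm (X n x) \<le> norm x * K"
        by (metis K norm_bop mult.commute mult_right_mono norm_ge_zero order_trans)
    qed
  qed
  then have A: "bop_apply (Bop f) = f"
    by (simp add: Bop_inverse bounded_clinear_def fc)
  have "X \<longlonglongrightarrow> Bop f"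
  proof (rule LIMSEQ_I)
    fix e :: real assume "e > 0"
    then obtain N where N: "\<forall>m\<ge>N. \<forall>n\<ge>N. norm (X m - X n) < e / 2"
      using XC [of "e / 2"] by auto
    have "norm (X n - Bop f) \<le> e / 2" if n: "n \<ge> N" for n
    proof (rule norm_bop_bound)
      fix x
      have "(\<lambda>m. norm ((X n - X m) x)) \<longlonglongrightarrow> norm ((X n - Bop f) x)"
        by (auto simp: A intro!: tendsto_intros f)
      moreover have "\<exists>M. \<forall>m\<ge>M. norm ((X n - X m) x) \<le> e / 2 * norm x"
        using N n by (meson less_imp_le mult_right_mono norm_bop norm_ge_zero order_trans)
      ultimately show "norm ((X n - Bop f) x) \<le> e / 2 * norm x"
        by (rule LIMSEQ_le_const2)
    qed (use \<open>e > 0\<close> in simp)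
    then show "\<exists>N. \<forall>n\<ge>N. norm (X n - Bop f) < e"
      using \<open>e > 0\<close> by (intro exI [of _ N]) fastforce
  qed
  then show ?thesis by (rule convergentI)
qed

instance bop :: (chilbert_space) banach
  by standard (rule bop_limit)


section \<open>Orthonormal bases and adjoints\<close>

definition orthonormal :: "'a::complex_inner set \<Rightarrow> bool" where
  "orthonormal E \<longleftrightarrow> (\<forall>e\<in>E. \<forall>f\<in>E. cinner e f = (if e = f then 1 else 0))"

definition is_onb :: "'a::complex_inner set \<Rightarrow> bool" where
  "is_onb E \<longleftrightarrow> orthonormal E \<and> (\<forall>E'. orthonormal E' \<and> E \<subseteq> E' \<longrightarrow> E' = E)"

definition adj :: "'a::complex_inner bop \<Rightarrow> 'a bop" where
  "adj A = (THE A' :: 'a bop. \<forall>x y. cinner (A x) y = cinner x (A' y))"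

lemma orthonormal_norm: "orthonormal E \<Longrightarrow> e \<in> E \<Longrightarrow> norm e = 1"
  by (metis cinner_self norm_ge_zero of_real_eq_1_iff orthonormal_def power2_eq_1_iff
      neg_0_le_iff_le not_one_le_zero)

lemma onb_exists: "\<exists>E :: 'a::complex_inner set. is_onb E"
proof -
  have "\<exists>M\<in>{E :: 'a set. orthonormal E}. \<forall>X\<in>{E. orthonormal E}. M \<subseteq> X \<longrightarrow> X = M"
  proof (rule subset_Zorn')
    fix C :: "'a set set"
    assume C: "subset.chain {E. orthonormal E} C"
    have "cinner e f = (if e = f then 1 else 0)" if "e \<in> \<Union>C" "f \<in> \<Union>C" for e f
    proof -
      obtain X where "X \<in> C" "e \<in> X" "f \<in> X"
        using \<open>e \<in> \<Union>C\<close> \<open>f \<in> \<Union>C\<close> C unfolding subset_chain_def by (metis UnionE subsetD)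
      then show ?thesis using C by (auto simp: subset_chain_def orthonormal_def)
    qed
    then show "\<Union>C \<in> {E. orthonormal E}" by (simp add: orthonormal_def)
  qed
  then show ?thesis by (auto simp: is_onb_def)
qed

lemma onb_total:
  fixes x :: "'a::complex_inner"
  assumes E: "is_onb E" and x: "\<And>e. e \<in> E \<Longrightarrow> cinner e x = 0"
  shows "x = 0"
proof (rule ccontr)
  assume "x \<noteq> 0"
  define u where "u = (1 / norm x) *\<^sub>R x"
  have u1: "cinner u u = 1" using \<open>x \<noteq> 0\<close> by (simp add: u_def cinner_self)
  have u0: "cinner e u = 0" "cinner u e = 0" if "e \<in> E" for e
    using x [OF that] cinner_commute [of u e] by (auto simp: u_def cinner_scaleR_right)
  have "orthonormal (insert u E)"
    using E u1 u0 by (auto simp: is_onb_def orthonormal_def)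
  then have "u \<in> E" using E by (auto simp: is_onb_def)
  then show False using u0 u1 by force
qed

lemma norm_orthonormal_sum:
  assumes "orthonormal E" "finite F" "F \<subseteq> E"
  shows "(norm (\<Sum>e\<in>F. c e *\<^sub>C e))\<^sup>2 = (\<Sum>e\<in>F. (cmod (c e))\<^sup>2)"
proof -
  have "cinner e (\<Sum>f\<in>F. c f *\<^sub>C f) = c e" if "e \<in> F" for e
  proof -
    have "cinner e (\<Sum>f\<in>F. c f *\<^sub>C f) = (\<Sum>f\<in>F. if f = e then c f else 0)"
      unfolding cinner_sum_right cinner_scaleC_right
      using assms that by (intro sum.cong) (auto simp: orthonormal_def subset_iff)
    then show ?thesis using assms that by simp
  qed
  then have "cinner (\<Sum>e\<in>F. c e *\<^sub>C e) (\<Sum>f\<in>F. c f *\<^sub>C f) = (\<Sum>e\<in>F. cnj (c e) * c e)"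
    by (subst cinner_sum_left) (simp add: cinner_scaleC_left)
  also have "\<dots> = complex_of_real (\<Sum>e\<in>F. (cmod (c e))\<^sup>2)"
    by (simp only: mult.commute of_real_sum complex_norm_square)
  finally show ?thesis
    unfolding cinner_self using of_real_eq_iff by blast
qed

lemma self_bound:
  fixes s t :: real
  assumes "s \<le> sqrt s * t" "0 \<le> s" "0 \<le> t"
  shows "s \<le> t\<^sup>2"
proof (cases "s = 0")
  case False
  then have "0 < sqrt s" using assms by simp
  moreover have "sqrt s * sqrt s \<le> sqrt s * t" using assms by simp
  ultimately have "sqrt s \<le> t" by (simp only: mult_le_cancel_left_pos)
  then show ?thesis by (simp add: sqrt_le_D)
qed simp

lemma bop_bessel:
  fixes A :: "'a::complex_inner bop"
  assumes "orthonormal E" "finite F" "F \<subseteq> E"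
  shows "(\<Sum>e\<in>F. (cmod (cinner (A e) y))\<^sup>2) \<le> (norm A * norm y)\<^sup>2"
proof -
  define s where "s = (\<Sum>e\<in>F. (cmod (cinner (A e) y))\<^sup>2)"
  define z where "z = (\<Sum>e\<in>F. cinner (A e) y *\<^sub>C e)"
  have s: "0 \<le> s" by (simp add: s_def sum_nonneg)
  have z: "norm z = sqrt s"
    using norm_orthonormal_sum [OF assms, of "\<lambda>e. cinner (A e) y"]
    by (metis norm_ge_zero real_sqrt_unique s_def z_def)
  have "cinner (A z) y = (\<Sum>e\<in>F. cnj (cinner (A e) y) * cinner (A e) y)"
    by (simp add: z_def bop_sum bop_linear cinner_sum_left cinner_scaleC_left)
  also have "\<dots> = complex_of_real s"
    by (simp only: s_def mult.commute of_real_sum complex_norm_square)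
  finally have "s = cmod (cinner (A z) y)" using s by simp
  also have "\<dots> \<le> norm (A z) * norm y" by (rule cmod_cinner_le)
  also have "\<dots> \<le> sqrt s * (norm A * norm y)"
    using mult_right_mono [OF norm_bop [of A z], of "norm y"] by (simp add: z mult_ac)
  finally show ?thesis
    unfolding s_def [symmetric] using s by (intro self_bound) auto
qed

lemma orthonormal_summable:
  fixes c :: "'a::chilbert_space \<Rightarrow> complex"
  assumes E: "orthonormal E" and c: "(\<lambda>e. (cmod (c e))\<^sup>2) summable_on E"
  shows "(\<lambda>e. c e *\<^sub>C e) summable_on E"
proof -
  define L where "L = infsum (\<lambda>e. (cmod (c e))\<^sup>2) E"
  define g where "g = (\<lambda>e. c e *\<^sub>C e)"
  have "\<exists>P. eventually P (finite_subsets_at_top E) \<and>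
      (\<forall>F F'. P F \<and> P F' \<longrightarrow> dist (sum g F) (sum g F') < d)" if "d > 0" for d
  proof -
    obtain F0 where F0: "finite F0" "F0 \<subseteq> E" "dist (\<Sum>e\<in>F0. (cmod (c e))\<^sup>2) L \<le> (d/3)\<^sup>2"
      using infsum_finite_approximation [OF c, of "(d/3)\<^sup>2"] \<open>d > 0\<close> by (auto simp: L_def)
    have *: "dist (sum g F) (sum g F0) \<le> d / 3" if F: "finite F" "F \<subseteq> E" "F0 \<subseteq> F" for F
    proof -
      have "(dist (sum g F) (sum g F0))\<^sup>2 = (norm (sum g (F - F0)))\<^sup>2"
        using F by (simp add: dist_norm sum_diff)
      also have "\<dots> = (\<Sum>e\<in>F - F0. (cmod (c e))\<^sup>2)"
        unfolding g_def using F by (intro norm_orthonormal_sum [OF E]) auto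
      also have "\<dots> = (\<Sum>e\<in>F. (cmod (c e))\<^sup>2) - (\<Sum>e\<in>F0. (cmod (c e))\<^sup>2)"
        using F by (simp add: sum_diff)
      also have "\<dots> \<le> L - (\<Sum>e\<in>F0. (cmod (c e))\<^sup>2)"
        unfolding L_def using F by (simp add: finite_sum_le_infsum [OF c])
      also have "\<dots> \<le> (d/3)\<^sup>2" using F0 by (simp add: dist_real_def)
      finally show ?thesis by (rule power2_le_imp_le) (use \<open>d > 0\<close> in simp)
    qed
    show ?thesis
    proof (intro exI [of _ "\<lambda>F. finite F \<and> F \<subseteq> E \<and> F0 \<subseteq> F"] conjI allI impI)
      show "\<forall>\<^sub>F F in finite_subsets_at_top E. finite F \<and> F \<subseteq> E \<and> F0 \<subseteq> F"
        using F0 by (auto simp: eventually_finite_subsets_at_top)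
      fix F F' assume "(finite F \<and> F \<subseteq> E \<and> F0 \<subseteq> F) \<and> finite F' \<and> F' \<subseteq> E \<and> F0 \<subseteq> F'"
      then have "dist (sum g F) (sum g F0) \<le> d / 3" "dist (sum g F') (sum g F0) \<le> d / 3"
        using * by auto
      moreover have "dist (sum g F) (sum g F') \<le> dist (sum g F) (sum g F0) + dist (sum g F') (sum g F0)"
        by (rule dist_triangle2)
      ultimately show "dist (sum g F) (sum g F') < d" using \<open>d > 0\<close> by linarith
    qed
  qed
  then have "cauchy_filter (filtermap (sum g) (finite_subsets_at_top E))"
    by (simp add: cauchy_filter_metric_filtermap)
  moreover have "complete (UNIV :: 'a set)"
    by (meson Cauchy_convergent UNIV_I complete_def convergent_def)
  ultimately obtain l where "(sum g \<longlongrightarrow> l) (finite_subsets_at_top E)"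
    using complete_uniform [where S = UNIV] by (force simp add: filterlim_def)
  then show ?thesis
    unfolding g_def using summable_on_def has_sum_def by blast
qed

lemma bop_bessel_summable:
  fixes A :: "'a::complex_inner bop"
  assumes "orthonormal E"
  shows "(\<lambda>e. (cmod (cinner (A e) y))\<^sup>2) summable_on E"
  by (rule nonneg_bdd_above_summable_on)
     (auto intro!: bdd_aboveI2 bop_bessel [OF assms])

lemma orthonormal_coeff:
  fixes c :: "'a::chilbert_space \<Rightarrow> complex"
  assumes E: "orthonormal E" and c: "(\<lambda>e. c e *\<^sub>C e) summable_on E" and e: "e \<in> E"
  shows "cinner e (infsum (\<lambda>e. c e *\<^sub>C e) E) = c e"
proof -
  have "((\<lambda>f. cinner e (c f *\<^sub>C f)) has_sum cinner e (infsum (\<lambda>e. c e *\<^sub>C e) E)) E"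
    using has_sum_bounded_linear [OF bounded_linear_cinner_right has_sum_infsum [OF c]] .
  moreover have "((\<lambda>f. cinner e (c f *\<^sub>C f)) has_sum c e) E"
  proof (rule has_sum_finite_neutralI [where B = "{e}"])
    show "cinner e (c f *\<^sub>C f) = 0" if "f \<in> E - {e}" for f
      using E e that by (auto simp: orthonormal_def cinner_scaleC_right)
    show "c e = (\<Sum>f\<in>{e}. cinner e (c f *\<^sub>C f))"
      using E e by (auto simp: orthonormal_def cinner_scaleC_right)
  qed (use e in auto)
  ultimately show ?thesis by (rule has_sum_unique)
qed

lemma onb_expand:
  fixes x :: "'a::chilbert_space"
  assumes E: "is_onb E"
  shows "((\<lambda>e. cinner e x *\<^sub>C e) has_sum x) E"
proof -
  have o: "orthonormal E" using E by (simp add: is_onb_def)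
  have s: "(\<lambda>e. cinner e x *\<^sub>C e) summable_on E"
    using orthonormal_summable [OF o] bop_bessel_summable [OF o, of 1 x] by simp
  define z where "z = infsum (\<lambda>e. cinner e x *\<^sub>C e) E"
  have "x - z = 0"
    by (rule onb_total [OF E]) (simp add: cinner_diff_right z_def orthonormal_coeff [OF o s])
  then show ?thesis using has_sum_infsum [OF s] by (simp add: z_def)
qed

lemma onb_has_sum_linear:
  fixes x :: "'a::chilbert_space"
  assumes E: "is_onb E" and f: "bounded_linear f" "\<And>c x. f (c *\<^sub>C x) = c * f x"
  shows "((\<lambda>e. cinner e x * f e) has_sum f x) E"
  using has_sum_bounded_linear [OF f(1) onb_expand [OF E]] by (simp add: f(2))

lemma parseval:
  fixes x :: "'a::chilbert_space"
  assumes E: "is_onb E"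
  shows "((\<lambda>e. (cmod (cinner e x))\<^sup>2) has_sum (norm x)\<^sup>2) E"
proof -
  have "((\<lambda>e. cinner e x * cinner x e) has_sum cinner x x) E"
    by (rule onb_has_sum_linear [OF E bounded_linear_cinner_right cinner_scaleC_right])
  moreover have "cinner e x * cinner x e = complex_of_real ((cmod (cinner e x))\<^sup>2)" for e
    by (metis cinner_commute complex_norm_square)
  ultimately have "((\<lambda>e. complex_of_real ((cmod (cinner e x))\<^sup>2)) has_sum complex_of_real ((norm x)\<^sup>2)) E"
    by (simp only: cinner_self)
  then show ?thesis by (simp only: has_sum_of_real_iff)
qed

lemma bop_cinner_eqI:
  fixes A B :: "'a::complex_inner bop"
  assumes "\<And>x y. cinner x (A y) = cinner x (B y)"
  shows "A = B"
  using assms by (intro bop_eqI cinner_ext) auto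

lemma adj_exists:
  fixes A :: "'a::chilbert_space bop"
  shows "\<exists>A'::'a bop. \<forall>x y. cinner (A x) y = cinner x (A' y)"
proof -
  obtain E :: "'a set" where E: "is_onb E" using onb_exists by blast
  then have o: "orthonormal E" by (simp add: is_onb_def)
  define g where "g y = infsum (\<lambda>e. cinner (A e) y *\<^sub>C e) E" for y
  have ge: "cinner e (g y) = cinner (A e) y" if "e \<in> E" for e y
    unfolding g_def by (rule orthonormal_coeff [OF o orthonormal_summable [OF o bop_bessel_summable [OF o]] that])
  have "cinner y (A x) = cinner (g y) x" for x y
  proof (rule has_sum_unique)
    show "((\<lambda>e. cinner e x * cinner y (A e)) has_sum cinner y (A x)) E"
      by (rule onb_has_sum_linear [OF E bounded_linear_compose [OF bounded_linear_cinner_right bounded_linear_bop_apply]])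
         (simp add: bop_linear cinner_scaleC_right)
    have "((\<lambda>e. cinner e x * cinner (g y) e) has_sum cinner (g y) x) E"
      by (rule onb_has_sum_linear [OF E bounded_linear_cinner_right cinner_scaleC_right])
    moreover have "cinner e x * cinner (g y) e = cinner e x * cinner y (A e)" if "e \<in> E" for e
      using ge [OF that, of y] by (metis cinner_commute)
    ultimately show "((\<lambda>e. cinner e x * cinner y (A e)) has_sum cinner (g y) x) E"
      by (simp cong: has_sum_cong)
  qed
  then have g: "cinner (A x) y = cinner x (g y)" for x y
    by (metis cinner_commute)
  have "bounded_clinear g"
    unfolding bounded_clinear_def
  proof (intro conjI allI)
    show gc: "g (c *\<^sub>C x) = c *\<^sub>C g x" for c x
      by (rule cinner_ext) (simp add: cinner_scaleC_right flip: g)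
    show "bounded_linear g"
    proof (rule bounded_linear_intro)
      show "g (x + y) = g x + g y" for x y
        by (rule cinner_ext) (simp add: cinner_add_right flip: g)
      show "g (r *\<^sub>R x) = r *\<^sub>R g x" for r x by (simp add: scaleR_scaleC gc)
      show "norm (g y) \<le> norm y * norm A" for y
      proof (cases "g y = 0")
        case False
        have "(norm (g y))\<^sup>2 = cmod (cinner (g y) (g y))" by (simp add: cinner_self norm_power)
        also have "\<dots> \<le> norm (A (g y)) * norm y" by (simp add: cmod_cinner_le flip: g)
        also have "\<dots> \<le> norm A * norm (g y) * norm y" by (simp add: mult_right_mono norm_bop)
        finally have "norm (g y) * norm (g y) \<le> norm (g y) * (norm y * norm A)"
          by (simp add: power2_eq_square mult_ac)
        then show ?thesis using False by simp
      qed simp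
    qed
  qed
  then have "bop_apply (Bop g) = g" by (simp add: Bop_inverse)
  then show ?thesis using g by (intro exI [of _ "Bop g"]) simp
qed

lemma cinner_adj:
  fixes A :: "'a::chilbert_space bop"
  shows "cinner (A x) y = cinner x (adj A y)" "cinner (adj A x) y = cinner x (A y)"
proof -
  have "\<exists>!A'::'a bop. \<forall>x y. cinner (A x) y = cinner x (A' y)"
    using adj_exists [of A] by (metis bop_cinner_eqI)
  then have *: "\<forall>x y. cinner (A x) y = cinner x (adj A y)"
    unfolding adj_def by (rule theI')
  show "cinner (A x) y = cinner x (adj A y)" using * by simp
  show "cinner (adj A x) y = cinner x (A y)" using * by (metis cinner_commute)
qed

lemma adj_adj [simp]: "adj (adj A) = (A :: 'a::chilbert_space bop)"
  by (rule bop_cinner_eqI) (metis cinner_adj)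

lemma adj_mult: "adj (A * B) = adj B * adj (A :: 'a::chilbert_space bop)"
  by (rule bop_cinner_eqI) (simp flip: cinner_adj(1))

lemma adj_add: "adj (A + B) = adj A + adj (B :: 'a::chilbert_space bop)"
  by (rule bop_cinner_eqI) (simp add: cinner_add_left cinner_add_right flip: cinner_adj(1))

lemma adj_diff: "adj (A - B) = adj A - adj (B :: 'a::chilbert_space bop)"
  by (rule bop_cinner_eqI) (simp add: cinner_diff_left cinner_diff_right flip: cinner_adj(1))

lemma adj_scaleC: "adj (c *\<^sub>C A) = cnj c *\<^sub>C adj (A :: 'a::chilbert_space bop)"
  by (rule bop_cinner_eqI) (simp add: cinner_scaleC_left cinner_scaleC_right flip: cinner_adj(1))

lemma adj_scaleR: "adj (r *\<^sub>R A) = r *\<^sub>R adj (A :: 'a::chilbert_space bop)"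
  by (rule bop_cinner_eqI) (simp add: cinner_scaleR_left cinner_scaleR_right flip: cinner_adj(1))

lemma adj_one [simp]: "adj 1 = (1 :: 'a::chilbert_space bop)"
  by (rule bop_cinner_eqI) (simp flip: cinner_adj(1))

lemma adj_zero [simp]: "adj 0 = (0 :: 'a::chilbert_space bop)"
  by (rule bop_cinner_eqI) (simp flip: cinner_adj(1))

lemma norm_adj_le: "norm (adj A) \<le> norm (A :: 'a::chilbert_space bop)"
proof (rule norm_bop_bound)
  fix y
  have "(norm (adj A y))\<^sup>2 = cmod (cinner (adj A y) (adj A y))" by (simp add: cinner_self norm_power)
  also have "\<dots> \<le> norm (A (adj A y)) * norm y" by (simp add: cmod_cinner_le flip: cinner_adj(1))
  also have "\<dots> \<le> norm A * norm (adj A y) * norm y" by (simp add: mult_right_mono norm_bop)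
  finally have "norm (adj A y) * norm (adj A y) \<le> norm (adj A y) * (norm A * norm y)"
    by (simp add: power2_eq_square mult_ac)
  then show "norm (adj A y) \<le> norm A * norm y"
    by (cases "adj A y = 0") simp_all
qed simp

lemma norm_adj [simp]: "norm (adj A) = norm (A :: 'a::chilbert_space bop)"
  using norm_adj_le [of A] norm_adj_le [of "adj A"] by simp


section \<open>Positive operators and the absolute value\<close>

definition positive_op :: "'a::complex_inner bop \<Rightarrow> bool" where
  "positive_op P \<longleftrightarrow> (\<forall>x. cinner x (P x) \<in> \<real>\<^sub>\<ge>\<^sub>0)"

definition abs_op :: "'a::complex_inner bop \<Rightarrow> 'a bop" where
  "abs_op A = (THE P. positive_op P \<and> P * P = adj A * A)"

lemma quadratic_form_zero:
  fixes D :: "'a::complex_inner bop"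
  assumes D: "\<And>x. cinner x (D x) = 0"
  shows "D = 0"
proof (rule bop_cinner_eqI)
  fix x y
  have 1: "cinner x (D y) + cinner y (D x) = 0"
    using D [of "x + y"] D [of x] D [of y]
    by (simp add: bop_linear cinner_add_left cinner_add_right add.commute)
  have "\<i> * (cinner x (D y) - cinner y (D x)) = 0"
    using D [of "x + \<i> *\<^sub>C y"] D [of x] D [of y]
    by (simp add: bop_linear cinner_add_left cinner_add_right cinner_scaleC_left cinner_scaleC_right
        algebra_simps)
  then have "cinner x (D y) = cinner y (D x)" by simp
  then show "cinner x (D y) = cinner x ((0::'a bop) y)" using 1 by simp
qed

lemma positive_op_self_adj:
  fixes P :: "'a::chilbert_space bop"
  assumes "positive_op P"
  shows "adj P = P"
proof -
  have "cinner x ((adj P - P) x) = 0" for x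
  proof -
    have "cinner x (P x) \<in> \<real>" using assms by (auto simp: positive_op_def)
    then have "cnj (cinner x (P x)) = cinner x (P x)" by (simp add: Reals_cnj_iff)
    then show ?thesis
      by (metis bop_simps(2) cinner_adj(1) cinner_commute cinner_diff_right diff_self)
  qed
  then show ?thesis using quadratic_form_zero [of "adj P - P"] by simp
qed

lemma positive_op_iff:
  fixes P :: "'a::chilbert_space bop"
  shows "positive_op P \<longleftrightarrow> adj P = P \<and> (\<forall>x. 0 \<le> inner x (P x))"
proof safe
  assume P: "positive_op P"
  then show "adj P = P" by (rule positive_op_self_adj)
  show "0 \<le> inner x (P x)" for x
    using P by (auto simp: positive_op_def inner_eq_Re_cinner complex_nonneg_Reals_iff)
next
  assume P: "adj P = P" "\<forall>x. 0 \<le> inner x (P x)"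
  have "Im (cinner x (P x)) = 0" for x
    by (metis P(1) cinner_adj(1) cinner_commute cnj.simps(2) equal_neg_zero)
  then show "positive_op P"
    using P by (simp add: positive_op_def inner_eq_Re_cinner complex_nonneg_Reals_iff)
qed

lemma self_adj_inner: "adj P = P \<Longrightarrow> inner (P x) y = inner x (P y)"
  for P :: "'a::chilbert_space bop"
  by (metis cinner_adj(1) inner_eq_Re_cinner)

lemma positive_norm_bound:
  fixes P :: "'a::chilbert_space bop"
  assumes P: "positive_op P" and k: "k > 0" and b: "\<And>x. inner x (P x) \<le> k * (norm x)\<^sup>2"
  shows "norm P \<le> k"
proof (rule norm_bop_bound)
  fix x
  have sa: "inner (P u) v = inner u (P v)" for u v
    using P by (simp add: positive_op_iff self_adj_inner)
  define y where "y = x - (1/k) *\<^sub>R P x"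
  have n2: "(norm (P x))\<^sup>2 = inner x (P (P x))" by (simp add: power2_norm_eq_inner sa)
  have "0 \<le> inner y (P y)" using P by (simp add: positive_op_iff)
  also have "inner y (P y) = inner x (P x) - (2/k) * (norm (P x))\<^sup>2 + (1/k)\<^sup>2 * inner (P x) (P (P x))"
    unfolding n2
    by (simp add: y_def bop_linear inner_diff_left inner_diff_right sa power2_eq_square algebra_simps)
  also have "\<dots> \<le> k * (norm x)\<^sup>2 - (2/k) * (norm (P x))\<^sup>2 + (1/k)\<^sup>2 * (k * (norm (P x))\<^sup>2)"
    using b [of x] b [of "P x"] k by (intro add_mono diff_mono mult_left_mono) auto
  also have "\<dots> = (k\<^sup>2 * (norm x)\<^sup>2 - (norm (P x))\<^sup>2) / k"
    using k by (simp add: field_simps power2_eq_square)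
  finally have "(norm (P x))\<^sup>2 \<le> (k * norm x)\<^sup>2"
    using k by (simp add: zero_le_divide_iff power_mult_distrib)
  then show "norm (P x) \<le> k * norm x"
    by (rule power2_le_imp_le) (use k in simp)
qed (use k in simp)

lemma tendsto_adj:
  fixes A :: "'a::chilbert_space bop"
  assumes "X \<longlonglongrightarrow> A"
  shows "(\<lambda>n. adj (X n)) \<longlonglongrightarrow> adj A"
proof -
  have "(\<lambda>n. norm (X n - A)) \<longlonglongrightarrow> 0"
    using assms by (simp add: LIM_zero tendsto_norm_zero)
  then have "(\<lambda>n. norm (adj (X n) - adj A)) \<longlonglongrightarrow> 0"
    by (simp flip: adj_diff)
  then show ?thesis by (simp add: LIM_zero_iff tendsto_norm_zero_iff)
qed

lemma positive_sqrt_exists: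
  fixes T :: "'a::chilbert_space bop"
  assumes T: "positive_op T"
  shows "\<exists>Q. positive_op Q \<and> Q * Q = T \<and> (\<forall>S. S * T = T * S \<longrightarrow> S * Q = Q * S)"
proof -
  define c where "c = norm T + 1"
  have c: "c > 0" by (simp add: c_def add_nonneg_pos)
  define X where "X = 1 - (1/c) *\<^sub>R T"
  have Ta: "adj T = T" using T by (rule positive_op_self_adj)
  have Xa: "adj X = X" by (simp add: X_def adj_diff adj_scaleR Ta)
  have Tx: "inner x (T x) \<le> c * (norm x)\<^sup>2" for x
  proof -
    have "inner x (T x) \<le> norm x * norm (T x)" by (rule norm_cauchy_schwarz)
    also have "\<dots> \<le> norm x * (norm T * norm x)" by (intro mult_left_mono norm_bop) auto
    also have "\<dots> \<le> c * (norm x)\<^sup>2" by (simp add: c_def power2_eq_square algebra_simps)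
    finally show ?thesis .
  qed
  have Xx: "inner x (X x) = (norm x)\<^sup>2 - inner x (T x) / c" for x
    by (simp add: X_def inner_diff_right power2_norm_eq_inner)
  have Xp: "positive_op X"
    using Tx c by (simp add: positive_op_iff Xa Xx field_simps)
  have X1: "norm X \<le> 1"
    by (rule positive_norm_bound [OF Xp]) (use T c in \<open>auto simp: Xx positive_op_iff\<close>)
  define y where "y = rec_nat (0::real) (\<lambda>_ t. (1 + t\<^sup>2) / 2)"
  define Y where "Y = rec_nat (0::'a bop) (\<lambda>_ Z. (1/2) *\<^sub>R (X + Z * Z))"
  have y: "y 0 = 0" "\<And>n. y (Suc n) = (1 + (y n)\<^sup>2) / 2" by (auto simp: y_def)
  have Y: "Y 0 = 0" "\<And>n. Y (Suc n) = (1/2) *\<^sub>R (X + Y n * Y n)" by (auto simp: Y_def)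
  have y01: "0 \<le> y n \<and> y n \<le> 1" for n
    by (induction n) (auto simp: y power_le_one)
  have Yy: "norm (Y n) \<le> y n" for n
  proof (induction n)
    case (Suc n)
    have "norm (Y n * Y n) \<le> (y n)\<^sup>2"
      unfolding power2_eq_square using Suc y01 [of n]
      by (intro order_trans [OF norm_mult_ineq] mult_mono) auto
    then have "norm (X + Y n * Y n) \<le> 1 + (y n)\<^sup>2"
      using X1 by (intro order_trans [OF norm_triangle_ineq] add_mono)
    then show ?case by (simp add: Y y)
  qed (simp add: Y y)
  have Yd: "norm (Y (Suc n) - Y n) \<le> y (Suc n) - y n" for n
  proof (induction n)
    case 0
    show ?case using X1 by (simp add: Y y)
  next
    case (Suc n)
    define D where "D = Y (Suc n) - Y n"
    have "Y (Suc (Suc n)) - Y (Suc n) = (1/2) *\<^sub>R (Y (Suc n) * Y (Suc n) - Y n * Y n)"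
      unfolding Y(2) [of "Suc n"] by (simp add: Y(2) [of n] algebra_simps)
    also have "Y (Suc n) * Y (Suc n) - Y n * Y n = Y (Suc n) * D + D * Y n"
      by (simp add: D_def algebra_simps)
    also have "norm ((1/2) *\<^sub>R (Y (Suc n) * D + D * Y n)) \<le> (1/2) * (y (Suc n) * (y (Suc n) - y n) + (y (Suc n) - y n) * y n)"
    proof -
      have "norm (Y (Suc n) * D) \<le> y (Suc n) * (y (Suc n) - y n)"
        using Suc Yy [of "Suc n"] y01 [of "Suc n"] unfolding D_def
        by (intro order_trans [OF norm_mult_ineq] mult_mono) auto
      moreover have "norm (D * Y n) \<le> (y (Suc n) - y n) * y n"
        using Suc Yy [of n] order_trans [OF norm_ge_zero Suc] unfolding D_def
        by (intro order_trans [OF norm_mult_ineq] mult_mono) auto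
      ultimately show ?thesis
        by (simp add: order_trans [OF norm_triangle_ineq] add_mono)
    qed
    also have "\<dots> = y (Suc (Suc n)) - y (Suc n)"
      unfolding y(2) [of "Suc n"] by (simp add: y(2) [of n] field_simps power2_eq_square)
    finally show ?case .
  qed
  have Ymn: "norm (Y (n + k) - Y n) \<le> y (n + k) - y n" for n k
  proof (induction k)
    case (Suc k)
    have "norm (Y (n + Suc k) - Y n) \<le> norm (Y (Suc (n + k)) - Y (n + k)) + norm (Y (n + k) - Y n)"
      using norm_triangle_ineq [of "Y (Suc (n + k)) - Y (n + k)" "Y (n + k) - Y n"] by simp
    then show ?case using Suc Yd [of "n + k"] by simp
  qed simp
  have "incseq y"
    by (rule incseq_SucI) (use Yd norm_ge_zero in \<open>smt (verit)\<close>)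
  then have "convergent y"
    using y01 by (intro Bseq_monoseq_convergent)
      (auto simp: Bseq_def incseq_imp_monoseq intro!: exI [of _ 1])
  then have "Cauchy y" by (rule convergent_Cauchy)
  have "Cauchy Y"
  proof (rule CauchyI')
    fix e :: real assume "e > 0"
    then obtain N where N: "\<And>m n. m \<ge> N \<Longrightarrow> n \<ge> N \<Longrightarrow> norm (y m - y n) < e"
      using CauchyD [OF \<open>Cauchy y\<close>] by blast
    have "norm (Y m - Y n) < e" if "m \<ge> N" "n > m" for m n
      using Ymn [of m "n - m"] N [of n m] that by (simp add: norm_minus_commute)
    then show "\<exists>M. \<forall>m\<ge>M. \<forall>n>m. dist (Y m) (Y n) < e" unfolding dist_norm by blast
  qed
  then obtain Z where Z: "Y \<longlonglongrightarrow> Z"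
    using Cauchy_convergent convergent_def by blast
  have ZX: "Z = (1/2) *\<^sub>R (X + Z * Z)"
  proof (rule LIMSEQ_unique)
    show "(\<lambda>n. Y (Suc n)) \<longlonglongrightarrow> Z" using Z by (rule LIMSEQ_Suc)
    show "(\<lambda>n. Y (Suc n)) \<longlonglongrightarrow> (1/2) *\<^sub>R (X + Z * Z)"
      unfolding Y by (intro tendsto_intros Z)
  qed
  have Ya: "adj (Y n) = Y n" for n
    by (induction n) (auto simp: Y adj_scaleR adj_add adj_mult Xa)
  have Za: "adj Z = Z"
    using LIMSEQ_unique [OF tendsto_adj [OF Z]] Z by (simp add: Ya)
  have Z1: "norm Z \<le> 1"
    by (rule LIMSEQ_le_const2 [OF tendsto_norm [OF Z]]) (use Yy y01 order_trans in blast)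
  define Q where "Q = sqrt c *\<^sub>R (1 - Z)"
  have "positive_op Q"
  proof -
    have "inner x (Z x) \<le> (norm x)\<^sup>2" for x
    proof -
      have "inner x (Z x) \<le> norm x * norm (Z x)" by (rule norm_cauchy_schwarz)
      also have "\<dots> \<le> norm x * (1 * norm x)"
        using Z1 by (intro mult_left_mono order_trans [OF norm_bop] mult_right_mono) auto
      finally show ?thesis by (simp add: power2_eq_square)
    qed
    then show ?thesis
      using c by (simp add: positive_op_iff Q_def adj_scaleR adj_diff Za inner_diff_right power2_norm_eq_inner)
  qed
  moreover have "Q * Q = T"
  proof -
    have "2 *\<^sub>R Z = X + Z * Z" by (subst ZX) simp
    then have "(1 - Z) * (1 - Z) = 1 - X"
      by (simp add: algebra_simps scaleR_2)
    then show ?thesis using c by (simp add: Q_def X_def)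
  qed
  moreover have "S * Q = Q * S" if S: "S * T = T * S" for S
  proof -
    have SX: "S * X = X * S" by (simp add: X_def algebra_simps S)
    have "S * Y n = Y n * S" for n
    proof (induction n)
      case (Suc n)
      have "S * (Y n * Y n) = Y n * Y n * S" by (metis Suc mult.assoc)
      then show ?case by (simp add: Y distrib_left distrib_right SX)
    qed (simp add: Y)
    then have "(\<lambda>n. S * Y n) \<longlonglongrightarrow> Z * S"
      using tendsto_mult_right [OF Z] by simp
    then have "S * Z = Z * S"
      using LIMSEQ_unique tendsto_mult_left [OF Z] by blast
    then show ?thesis by (simp add: Q_def algebra_simps)
  qed
  ultimately show ?thesis by blast
qed

lemma positive_quadratic_zero:
  fixes P :: "'a::chilbert_space bop"
  assumes P: "positive_op P" and x: "inner x (P x) = 0"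
  shows "P x = 0"
proof -
  obtain Q where Q: "positive_op Q" "Q * Q = P" using positive_sqrt_exists [OF P] by blast
  have "inner (Q x) (Q x) = inner x (P x)"
    unfolding Q(2) [symmetric] bop_simps(7) using Q(1) by (simp add: positive_op_iff self_adj_inner)
  then have "Q x = 0" using x by simp
  then show ?thesis using Q bop_simps(7) [of Q Q x] by (simp add: bop_linear)
qed

lemma positive_sqrt_unique:
  fixes P Q :: "'a::chilbert_space bop"
  assumes P: "positive_op P" and Q: "positive_op Q" and PQ: "P * P = Q * Q"
  shows "P = Q"
proof -
  have T: "positive_op (R * R)" if "positive_op R" for R :: "'a bop"
    using that unfolding positive_op_iff adj_mult bop_simps(7) by (metis inner_ge_zero self_adj_inner)
  obtain R where R: "positive_op R" "R * R = Q * Q" "\<And>S. S * (Q * Q) = Q * Q * S \<Longrightarrow> S * R = R * S"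
    using positive_sqrt_exists [OF T [OF Q]] by blast
  have *: "S = R" if S: "positive_op S" "S * S = Q * Q" for S
  proof -
    define D where "D = S - R"
    have "S * (Q * Q) = Q * Q * S" unfolding S(2) [symmetric] by (simp add: mult.assoc)
    then have SR: "S * R = R * S" by (rule R(3))
    have "(S + R) * D = S * S - R * R + (R * S - S * R)" by (simp add: D_def algebra_simps)
    then have SRD: "(S + R) * D = 0" by (simp add: S(2) R(2) SR)
    have Da: "adj D = D" using S(1) R(1) by (simp add: D_def adj_diff positive_op_iff)
    have "D x = 0" for x
    proof -
      have "inner (D x) (S (D x)) + inner (D x) (R (D x)) = inner (D x) (((S + R) * D) x)"
        by (simp add: inner_add_right)
      also have "\<dots> = 0" unfolding SRD by simp
      finally have "inner (D x) (S (D x)) + inner (D x) (R (D x)) = 0" .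
      moreover have "0 \<le> inner (D x) (S (D x))" "0 \<le> inner (D x) (R (D x))"
        using S(1) R(1) by (auto simp: positive_op_iff)
      ultimately have "inner (D x) (S (D x)) = 0" "inner (D x) (R (D x)) = 0" by linarith+
      then have "S (D x) = 0" "R (D x) = 0"
        using positive_quadratic_zero [OF S(1)] positive_quadratic_zero [OF R(1)] by blast+
      then have "D (D x) = 0" by (simp add: D_def)
      then have "inner (D x) (D x) = 0" using self_adj_inner [OF Da, of x "D x"] by simp
      then show ?thesis by simp
    qed
    then show "S = R" by (intro bop_eqI) (simp add: D_def)
  qed
  show ?thesis using * [OF P PQ] * [OF Q refl] by simp
qed

lemma positive_adj_mult: "positive_op (adj A * A)" for A :: "'a::chilbert_space bop"
  by (simp add: positive_op_def cinner_self flip: cinner_adj(1))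

lemma abs_op_eqI: "positive_op P \<Longrightarrow> P * P = adj A * A \<Longrightarrow> abs_op A = P"
  for A :: "'a::chilbert_space bop"
  unfolding abs_op_def by (rule the_equality) (auto intro: positive_sqrt_unique)

lemma abs_op:
  fixes A :: "'a::chilbert_space bop"
  shows positive_abs_op: "positive_op (abs_op A)" and abs_op_square: "abs_op A * abs_op A = adj A * A"
  using positive_sqrt_exists [OF positive_adj_mult [of A]] abs_op_eqI [of _ A] by auto

lemma norm_abs_op_apply: "norm (abs_op A x) = norm (A x)" for A :: "'a::chilbert_space bop"
proof -
  have "inner (abs_op A x) (abs_op A x) = inner x ((abs_op A * abs_op A) x)"
    using positive_abs_op [of A] by (simp add: positive_op_iff self_adj_inner)
  also have "\<dots> = inner (A x) (A x)"
    by (simp add: abs_op_square inner_eq_Re_cinner flip: cinner_adj(1))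
  finally show ?thesis by (simp add: norm_eq_sqrt_inner)
qed

lemma abs_op_positive: "positive_op P \<Longrightarrow> abs_op P = P" for P :: "'a::chilbert_space bop"
  by (rule abs_op_eqI) (auto simp: positive_op_iff)

lemma abs_op_scaleC: "abs_op (c *\<^sub>C A) = cmod c *\<^sub>R abs_op A" for A :: "'a::chilbert_space bop"
proof (rule abs_op_eqI)
  show "positive_op (cmod c *\<^sub>R abs_op A)"
    using positive_abs_op [of A] by (simp add: positive_op_iff adj_scaleR)
  have "(cmod c *\<^sub>R abs_op A) * (cmod c *\<^sub>R abs_op A) = (cmod c)\<^sup>2 *\<^sub>R (adj A * A)"
    by (simp add: power2_eq_square flip: abs_op_square)
  also have "\<dots> = adj (c *\<^sub>C A) * (c *\<^sub>C A)"
    by (rule bop_eqI) (simp only: adj_scaleC bop_simps bop_linear scaleC_scaleC scaleR_scaleC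
        complex_norm_square mult.commute)
  finally show "(cmod c *\<^sub>R abs_op A) * (cmod c *\<^sub>R abs_op A) = adj (c *\<^sub>C A) * (c *\<^sub>C A)" .
qed

text \<open>An approximate polar decomposition, which is all that is needed for the trace norm.\<close>

lemma approx_polar:
  fixes A :: "'a::chilbert_space bop"
  assumes "\<epsilon> > 0"
  obtains V W where "norm V \<le> 1" "norm W \<le> 1" "norm (abs_op A - V * A) \<le> \<epsilon>" "norm (A - W * abs_op A) \<le> \<epsilon>"
proof -
  define P where "P = abs_op A"
  have P: "positive_op P" "P * P = adj A * A" "\<And>x. norm (P x) = norm (A x)"
    by (simp_all add: P_def positive_abs_op abs_op_square norm_abs_op_apply)
  have Pa: "adj P = P" using P by (simp add: positive_op_iff)
  define S where "S = P + \<epsilon> *\<^sub>R 1"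
  have Sa: "adj S = S" by (simp add: S_def adj_add adj_scaleR Pa)
  define c where "c = norm P + \<epsilon> + 1"
  have c: "c > 0" "\<epsilon> < c" using assms by (simp_all add: c_def add_nonneg_pos)
  define X where "X = 1 - (1/c) *\<^sub>R S"
  define k where "k = 1 - \<epsilon> / c"
  have k: "0 < k" "k < 1" using c assms by (simp_all add: k_def)
  have Xx: "inner x (X x) = k * (norm x)\<^sup>2 - inner x (P x) / c" for x
    by (simp add: X_def S_def k_def inner_diff_right inner_add_right power2_norm_eq_inner
        add_divide_distrib algebra_simps)
  have Xp: "positive_op X"
    unfolding positive_op_iff
  proof (intro conjI allI)
    show "adj X = X" by (simp add: X_def adj_diff adj_scaleR Sa)
    fix x
    have "inner x (P x) \<le> norm x * norm (P x)" by (rule norm_cauchy_schwarz)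
    also have "\<dots> \<le> norm x * (norm P * norm x)" by (intro mult_left_mono norm_bop) auto
    also have "\<dots> = (norm P) * (norm x)\<^sup>2" by (simp add: power2_eq_square)
    also have "\<dots> \<le> (c - \<epsilon>) * (norm x)\<^sup>2" by (intro mult_right_mono) (auto simp: c_def)
    also have "\<dots> = k * c * (norm x)\<^sup>2" using c by (simp add: k_def field_simps)
    finally show "0 \<le> inner x (X x)" using c by (simp add: Xx pos_divide_le_eq mult_ac)
  qed
  have X: "norm X \<le> k"
    by (rule positive_norm_bound [OF Xp k(1)]) (use P c in \<open>auto simp: Xx positive_op_iff\<close>)
  have "\<exists>!G. (1/c) *\<^sub>R 1 + X * G = G"
  proof (rule banach_fix_type)
    show "\<forall>G H. dist ((1/c) *\<^sub>R 1 + X * G) ((1/c) *\<^sub>R 1 + X * H) \<le> k * dist G H"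
    proof (intro allI)
      fix G H
      have "norm (X * (G - H)) \<le> k * norm (G - H)"
        by (rule order_trans [OF norm_mult_ineq mult_right_mono [OF X]]) simp
      then show "dist ((1/c) *\<^sub>R 1 + X * G) ((1/c) *\<^sub>R 1 + X * H) \<le> k * dist G H"
        by (simp add: dist_norm right_diff_distrib)
    qed
  qed (use k in auto)
  then obtain G where "(1/c) *\<^sub>R 1 + X * G = G" by blast
  then have "(1/c) *\<^sub>R (S * G) = (1/c) *\<^sub>R 1"
    by (simp add: X_def left_diff_distrib)
  then have SG: "S * G = 1" using c by simp
  then have "adj G * S = 1" by (metis Sa adj_mult adj_one)
  then have Ga: "adj G = G" by (metis SG mult.assoc mult_1_left mult_1_right)
  then have GS: "G * S = 1" using \<open>adj G * S = 1\<close> by simp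
  have PG: "norm (P * G) \<le> 1" and AG: "norm (A * G) \<le> 1"
  proof -
    have "norm (P y) \<le> norm (S y)" for y
    proof (rule power2_le_imp_le)
      have "(norm (S y))\<^sup>2 = (norm (P y))\<^sup>2 + 2 * \<epsilon> * inner y (P y) + \<epsilon>\<^sup>2 * (norm y)\<^sup>2"
        unfolding power2_norm_eq_inner
        by (simp add: S_def inner_add_left inner_add_right inner_commute power2_eq_square algebra_simps)
      moreover have "0 \<le> inner y (P y)" using P by (simp add: positive_op_iff)
      ultimately show "(norm (P y))\<^sup>2 \<le> (norm (S y))\<^sup>2" using assms by simp
    qed simp
    then have *: "norm (P (G x)) \<le> norm x" for x
      by (metis SG bop_simps(7,8))
    show "norm (P * G) \<le> 1" "norm (A * G) \<le> 1"
      using * P(3) by (auto intro!: norm_bop_bound)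
  qed
  show ?thesis
  proof (rule that [of "adj (A * G)" "A * G"])
    show "norm (adj (A * G)) \<le> 1" "norm (A * G) \<le> 1" using AG by simp_all
    have GP: "norm (G * P) \<le> 1" using PG norm_adj [of "P * G"] by (simp only: adj_mult Ga Pa)
    have "adj (A * G) * A = G * (P * P)"
      by (simp add: adj_mult Ga P(2) mult.assoc)
    moreover have "P = G * (S * P)" by (simp add: GS flip: mult.assoc)
    ultimately have "P - adj (A * G) * A = G * (S * P) - G * (P * P)" by simp
    also have "\<dots> = \<epsilon> *\<^sub>R (G * P)"
      by (simp add: S_def algebra_simps)
    finally have e1: "P - adj (A * G) * A = \<epsilon> *\<^sub>R (G * P)" .
    show "norm (abs_op A - adj (A * G) * A) \<le> \<epsilon>"
      unfolding P_def [symmetric] e1 using GP assms mult_left_mono [of "norm (G * P)" 1 \<epsilon>] by simp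
    have "A = A * (G * S)" by (simp add: GS)
    then have "A - A * G * P = A * (G * S) - A * G * P" by simp
    also have "\<dots> = \<epsilon> *\<^sub>R (A * G)"
      by (simp add: S_def algebra_simps)
    finally have e2: "A - A * G * P = \<epsilon> *\<^sub>R (A * G)" .
    show "norm (A - A * G * abs_op A) \<le> \<epsilon>"
      unfolding P_def [symmetric] e2 using AG assms mult_left_mono [of "norm (A * G)" 1 \<epsilon>] by simp
  qed
qed


section \<open>Hilbert-Schmidt and trace-class operators\<close>

text \<open>All series below are unconditional sums over an orthonormal basis of arbitrary cardinality.
  On trace-class operators the value of \<open>op_trace\<close> does not depend on the chosen basis, and the
  two summability conditions hold for one basis if and only if they hold for all.\<close>

definition op_trace :: "'a::complex_inner bop \<Rightarrow> complex" where
  "op_trace A = (\<Sum>\<^sub>\<infinity>e\<in>(SOME E. is_onb E). cinner e (A e))"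

definition trace_class :: "'a::complex_inner bop \<Rightarrow> bool" where
  "trace_class A \<longleftrightarrow> (\<exists>E. is_onb E \<and> (\<lambda>e. cinner e (abs_op A e)) summable_on E)"

definition hilbert_schmidt :: "'a::complex_inner bop \<Rightarrow> bool" where
  "hilbert_schmidt A \<longleftrightarrow> (\<exists>E. is_onb E \<and> (\<lambda>e. (norm (A e))\<^sup>2) summable_on E)"

definition some_onb :: "'a::complex_inner set" where
  "some_onb = (SOME E. is_onb E)"

lemma some_onb: "is_onb (some_onb :: 'a::complex_inner set)"
  unfolding some_onb_def using onb_exists by (rule someI_ex)

lemma trace_some_onb: "op_trace A = (\<Sum>\<^sub>\<infinity>e\<in>some_onb. cinner e (A e))"
  by (simp add: op_trace_def some_onb_def)

lemma sum_of_has_sums: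
  fixes h :: "'b \<Rightarrow> 'c \<Rightarrow> 'd::topological_comm_monoid_add"
  assumes "finite F" "\<And>f. f \<in> F \<Longrightarrow> (h f has_sum s f) E"
  shows "((\<lambda>e. \<Sum>f\<in>F. h f e) has_sum (\<Sum>f\<in>F. s f)) E"
  using assms by (induction F) (auto intro!: has_sum_add)

lemma hs_swap:
  fixes A :: "'a::chilbert_space bop"
  assumes E: "is_onb E" and F: "is_onb F" and s: "(\<lambda>e. (norm (A e))\<^sup>2) summable_on E"
  shows "(\<lambda>f. (norm (adj A f))\<^sup>2) summable_on F"
    "infsum (\<lambda>f. (norm (adj A f))\<^sup>2) F \<le> infsum (\<lambda>e. (norm (A e))\<^sup>2) E"
proof -
  have fin: "(\<Sum>f\<in>F0. (norm (adj A f))\<^sup>2) \<le> infsum (\<lambda>e. (norm (A e))\<^sup>2) E"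
    if "finite F0" "F0 \<subseteq> F" for F0
  proof (rule has_sum_mono)
    show "((\<lambda>e. \<Sum>f\<in>F0. (cmod (cinner e (adj A f)))\<^sup>2) has_sum (\<Sum>f\<in>F0. (norm (adj A f))\<^sup>2)) E"
      using that by (intro sum_of_has_sums parseval [OF E])
    show "((\<lambda>e. (norm (A e))\<^sup>2) has_sum infsum (\<lambda>e. (norm (A e))\<^sup>2) E) E"
      using s by simp
    fix e
    have eq: "cmod (cinner e (adj A f)) = cmod (cinner ((1::'a bop) f) (A e))" for f
      by (metis bop_simps(8) cinner_adj(1) cinner_commute complex_mod_cnj)
    have "(\<Sum>f\<in>F0. (cmod (cinner e (adj A f)))\<^sup>2) \<le> (norm (1::'a bop) * norm (A e))\<^sup>2"
      unfolding eq using F that by (intro bop_bessel) (auto simp: is_onb_def)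
    also have "\<dots> \<le> (1 * norm (A e))\<^sup>2"
      by (intro power_mono mult_right_mono norm_one_bop_le) auto
    finally show "(\<Sum>f\<in>F0. (cmod (cinner e (adj A f)))\<^sup>2) \<le> (norm (A e))\<^sup>2" by simp
  qed
  show sF: "(\<lambda>f. (norm (adj A f))\<^sup>2) summable_on F"
    by (rule nonneg_bdd_above_summable_on) (auto intro!: bdd_aboveI2 fin)
  show "infsum (\<lambda>f. (norm (adj A f))\<^sup>2) F \<le> infsum (\<lambda>e. (norm (A e))\<^sup>2) E"
    by (rule infsum_le_finite_sums [OF sF]) (rule fin)
qed

lemma hs_basis:
  fixes A :: "'a::chilbert_space bop"
  assumes E: "is_onb E" and F: "is_onb F" and s: "(\<lambda>e. (norm (A e))\<^sup>2) summable_on E"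
  shows "(\<lambda>f. (norm (A f))\<^sup>2) summable_on F"
    "infsum (\<lambda>f. (norm (A f))\<^sup>2) F = infsum (\<lambda>e. (norm (A e))\<^sup>2) E"
proof -
  have *: "(\<lambda>f. (norm (A f))\<^sup>2) summable_on Y \<and>
      infsum (\<lambda>f. (norm (A f))\<^sup>2) Y \<le> infsum (\<lambda>e. (norm (A e))\<^sup>2) X"
    if "is_onb X" "is_onb Y" "(\<lambda>e. (norm (A e))\<^sup>2) summable_on X" for X Y
    using hs_swap [OF that(1) that(1) that(3)] hs_swap [of X Y "adj A"] that by auto
  show "(\<lambda>f. (norm (A f))\<^sup>2) summable_on F" using * [OF E F s] by simp
  then show "infsum (\<lambda>f. (norm (A f))\<^sup>2) F = infsum (\<lambda>e. (norm (A e))\<^sup>2) E"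
    using * [OF E F s] * [OF F E] by simp
qed

lemma hilbert_schmidt_iff:
  fixes A :: "'a::chilbert_space bop"
  assumes "is_onb E"
  shows "hilbert_schmidt A \<longleftrightarrow> (\<lambda>e. (norm (A e))\<^sup>2) summable_on E"
  using assms hs_basis(1) by (auto simp: hilbert_schmidt_def)

lemma positive_form_norm:
  fixes Q :: "'a::chilbert_space bop"
  assumes Q: "positive_op Q"
  shows "cinner x ((Q * Q) y) = cinner (Q x) (Q y)"
    "cinner x ((Q * Q) x) = complex_of_real ((norm (Q x))\<^sup>2)"
proof -
  show *: "cinner x ((Q * Q) y) = cinner (Q x) (Q y)" for y
    using cinner_adj(1) [of Q x "Q y"] by (simp add: positive_op_self_adj [OF Q])
  show "cinner x ((Q * Q) x) = complex_of_real ((norm (Q x))\<^sup>2)"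
    unfolding * cinner_self ..
qed

lemma trace_class_sqrt:
  fixes A Q :: "'a::chilbert_space bop"
  assumes Q: "positive_op Q" "Q * Q = abs_op A"
  shows "trace_class A \<longleftrightarrow> hilbert_schmidt Q"
proof -
  have "(\<lambda>e. cinner e (abs_op A e)) summable_on E \<longleftrightarrow> (\<lambda>e. (norm (Q e))\<^sup>2) summable_on E" for E
    unfolding Q(2) [symmetric] positive_form_norm(2) [OF Q(1)]
    using summable_on_of_real [of "\<lambda>e. (norm (Q e))\<^sup>2" E]
      summable_on_Re [of "\<lambda>e. complex_of_real ((norm (Q e))\<^sup>2)" E] by auto
  then show ?thesis by (simp add: trace_class_def hilbert_schmidt_def)
qed

definition trace_norm :: "'a::complex_inner bop \<Rightarrow> real" where
  "trace_norm A = Re (op_trace (abs_op A))"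

lemma trace_norm_sqrt:
  fixes A Q :: "'a::chilbert_space bop"
  assumes Q: "positive_op Q" "Q * Q = abs_op A" and A: "trace_class A" and E: "is_onb E"
  shows "((\<lambda>e. (norm (Q e))\<^sup>2) has_sum trace_norm A) E"
proof -
  have s: "(\<lambda>e. (norm (Q e))\<^sup>2) summable_on E"
    using A E by (simp add: trace_class_sqrt [OF Q] hilbert_schmidt_iff)
  have "((\<lambda>e. complex_of_real ((norm (Q e))\<^sup>2)) has_sum
      complex_of_real (infsum (\<lambda>e. (norm (Q e))\<^sup>2) some_onb)) some_onb"
    using hs_basis(1) [OF E some_onb s] by (simp only: has_sum_of_real_iff has_sum_infsum)
  then have "op_trace (abs_op A) = complex_of_real (infsum (\<lambda>e. (norm (Q e))\<^sup>2) some_onb)"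
    unfolding trace_some_onb Q(2) [symmetric] positive_form_norm(2) [OF Q(1)] by (rule infsumI)
  then have "trace_norm A = infsum (\<lambda>e. (norm (Q e))\<^sup>2) E"
    using hs_basis(2) [OF E some_onb s] by (simp add: trace_norm_def)
  then show ?thesis using s by simp
qed

lemma trace_norm_bound_aux:
  fixes A :: "'a::chilbert_space bop"
  assumes A: "trace_class A" and C: "norm C \<le> 1" and E: "is_onb E" and F: "finite F" "F \<subseteq> E"
  shows "(\<Sum>e\<in>F. cmod (cinner e ((C * abs_op A) e))) \<le> trace_norm A"
proof -
  obtain Q where Q: "positive_op Q" "Q * Q = abs_op A"
    using positive_sqrt_exists [OF positive_abs_op] by blast
  have Qa: "adj Q = Q" using Q by (simp add: positive_op_iff)
  note hQ = trace_norm_sqrt [OF Q A E]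
  have CQ: "(norm ((C * Q) e))\<^sup>2 \<le> (norm (Q e))\<^sup>2" for e
  proof (rule power_mono)
    show "norm ((C * Q) e) \<le> norm (Q e)"
      using norm_bop [of C "Q e"] C mult_right_mono [OF C, of "norm (Q e)"] by simp
  qed simp
  have sCQ: "(\<lambda>e. (norm ((C * Q) e))\<^sup>2) summable_on E"
    by (rule summable_on_comparison_test [OF has_sum_imp_summable [OF hQ]]) (use CQ in auto)
  have "infsum (\<lambda>e. (norm ((C * Q) e))\<^sup>2) E \<le> trace_norm A"
    by (rule has_sum_mono [OF has_sum_infsum [OF sCQ] hQ]) (rule CQ)
  then have 1: "infsum (\<lambda>e. (norm (adj (C * Q) e))\<^sup>2) E \<le> trace_norm A"
    using hs_swap(2) [OF E E sCQ] by linarith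
  have "(\<Sum>e\<in>F. (norm (adj (C * Q) e))\<^sup>2) \<le> infsum (\<lambda>e. (norm (adj (C * Q) e))\<^sup>2) E"
    by (rule finite_sum_le_infsum [OF hs_swap(1) [OF E E sCQ] F]) simp
  with 1 have 2: "(\<Sum>e\<in>F. (norm (adj (C * Q) e))\<^sup>2) \<le> trace_norm A" by linarith
  have 3: "(\<Sum>e\<in>F. (norm (Q e))\<^sup>2) \<le> trace_norm A"
    by (rule finite_sum_le_has_sum [OF hQ F]) simp
  have "cmod (cinner e ((C * abs_op A) e)) \<le> ((norm (adj (C * Q) e))\<^sup>2 + (norm (Q e))\<^sup>2) / 2" for e
  proof -
    have "cinner e ((C * abs_op A) e) = cinner (adj (C * Q) e) (Q e)"
      by (simp add: cinner_adj flip: Q(2))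
    then have "cmod (cinner e ((C * abs_op A) e)) \<le> norm (adj (C * Q) e) * norm (Q e)"
      by (simp add: cmod_cinner_le)
    also have "\<dots> \<le> ((norm (adj (C * Q) e))\<^sup>2 + (norm (Q e))\<^sup>2) / 2"
      using sum_squares_bound [of "norm (adj (C * Q) e)" "norm (Q e)"] by simp
    finally show ?thesis .
  qed
  then have "(\<Sum>e\<in>F. cmod (cinner e ((C * abs_op A) e)))
      \<le> (\<Sum>e\<in>F. ((norm (adj (C * Q) e))\<^sup>2 + (norm (Q e))\<^sup>2) / 2)"
    by (rule sum_mono)
  also have "\<dots> = ((\<Sum>e\<in>F. (norm (adj (C * Q) e))\<^sup>2) + (\<Sum>e\<in>F. (norm (Q e))\<^sup>2)) / 2"
    by (simp only: sum.distrib flip: sum_divide_distrib)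
  also have "\<dots> \<le> trace_norm A" using 2 3 by simp
  finally show ?thesis .
qed

lemma small_diagonal:
  fixes D :: "'a::complex_inner bop"
  assumes "norm D \<le> \<epsilon>" "orthonormal E" "F \<subseteq> E"
  shows "(\<Sum>e\<in>F. cmod (cinner e (D e))) \<le> real (card F) * \<epsilon>"
proof -
  have "cmod (cinner e (D e)) \<le> \<epsilon>" if "e \<in> F" for e
  proof -
    have "norm e = 1" using assms that orthonormal_norm by blast
    then show ?thesis
      using cmod_cinner_le [of e "D e"] norm_bop [of D e] assms(1) by simp
  qed
  then show ?thesis using sum_bounded_above [of F "\<lambda>e. cmod (cinner e (D e))" \<epsilon>] by simp
qed

lemma real_le_epsilon_mult:
  fixes a b :: real
  assumes "\<And>\<epsilon>. \<epsilon> > 0 \<Longrightarrow> a \<le> b + real n * \<epsilon>"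
  shows "a \<le> b"
proof (rule field_le_epsilon)
  fix d :: real assume "d > 0"
  have "a \<le> b + real n * (d / (real n + 1))" by (rule assms) (use \<open>d > 0\<close> in simp)
  also have "\<dots> \<le> b + d" using \<open>d > 0\<close> by (simp add: field_simps)
  finally show "a \<le> b + d" .
qed

lemma trace_norm_bound:
  fixes A :: "'a::chilbert_space bop"
  assumes A: "trace_class A" and C: "norm C \<le> 1" and E: "is_onb E" and F: "finite F" "F \<subseteq> E"
  shows "(\<Sum>e\<in>F. cmod (cinner e ((C * A) e))) \<le> trace_norm A"
proof (rule real_le_epsilon_mult)
  fix \<epsilon> :: real assume "\<epsilon> > 0"
  then obtain V W where W: "norm W \<le> 1" "norm (A - W * abs_op A) \<le> \<epsilon>"
    by (rule approx_polar [of \<epsilon> A])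
  have D: "norm (C * (A - W * abs_op A)) \<le> \<epsilon>"
    using order_trans [OF norm_mult_ineq mult_mono [OF C W(2)]] by simp
  have CW: "norm (C * W) \<le> 1"
    using order_trans [OF norm_mult_ineq mult_mono [OF C W(1)]] by simp
  have "cmod (cinner e ((C * A) e)) \<le> cmod (cinner e ((C * W * abs_op A) e))
      + cmod (cinner e ((C * (A - W * abs_op A)) e))" for e
  proof -
    have "cinner e ((C * A) e) = cinner e ((C * W * abs_op A) e) + cinner e ((C * (A - W * abs_op A)) e)"
      by (simp add: cinner_diff_right bop_linear)
    then show ?thesis by (simp only: norm_triangle_ineq)
  qed
  then have "(\<Sum>e\<in>F. cmod (cinner e ((C * A) e))) \<le> (\<Sum>e\<in>F. cmod (cinner e ((C * W * abs_op A) e)))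
      + (\<Sum>e\<in>F. cmod (cinner e ((C * (A - W * abs_op A)) e)))"
    unfolding sum.distrib [symmetric] by (rule sum_mono)
  also have "\<dots> \<le> trace_norm A + real (card F) * \<epsilon>"
    using trace_norm_bound_aux [OF A CW E F] small_diagonal [OF D, of E F] E F
    by (intro add_mono) (auto simp: is_onb_def)
  finally show "(\<Sum>e\<in>F. cmod (cinner e ((C * A) e))) \<le> trace_norm A + real (card F) * \<epsilon>" .
qed

lemma trace_class_criterion:
  fixes A :: "'a::chilbert_space bop"
  assumes E: "is_onb E"
    and K: "\<And>V F. norm V \<le> 1 \<Longrightarrow> finite F \<Longrightarrow> F \<subseteq> E \<Longrightarrow> (\<Sum>e\<in>F. cmod (cinner e ((V * A) e))) \<le> K"
  shows "trace_class A" "trace_norm A \<le> K"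
proof -
  obtain Q where Q: "positive_op Q" "Q * Q = abs_op A"
    using positive_sqrt_exists [OF positive_abs_op] by blast
  have fin: "(\<Sum>e\<in>F. (norm (Q e))\<^sup>2) \<le> K" if F: "finite F" "F \<subseteq> E" for F
  proof (rule real_le_epsilon_mult)
    fix \<epsilon> :: real assume "\<epsilon> > 0"
    then obtain V where V: "norm V \<le> 1" "norm (abs_op A - V * A) \<le> \<epsilon>"
      by (rule approx_polar [of \<epsilon> A])
    have "(norm (Q e))\<^sup>2 \<le> cmod (cinner e ((V * A) e)) + cmod (cinner e ((abs_op A - V * A) e))" for e
    proof -
      have "(norm (Q e))\<^sup>2 = cmod (complex_of_real ((norm (Q e))\<^sup>2))" by (simp add: norm_power)
      also have "\<dots> = cmod (cinner e (abs_op A e))"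
        unfolding Q(2) [symmetric] positive_form_norm(2) [OF Q(1)] ..
      also have "cinner e (abs_op A e) = cinner e ((V * A) e) + cinner e ((abs_op A - V * A) e)"
        by (simp add: cinner_diff_right)
      finally show ?thesis by (simp only: norm_triangle_ineq)
    qed
    then have "(\<Sum>e\<in>F. (norm (Q e))\<^sup>2) \<le> (\<Sum>e\<in>F. cmod (cinner e ((V * A) e)))
        + (\<Sum>e\<in>F. cmod (cinner e ((abs_op A - V * A) e)))"
      unfolding sum.distrib [symmetric] by (rule sum_mono)
    also have "\<dots> \<le> K + real (card F) * \<epsilon>"
      using K [OF V(1) F] small_diagonal [OF V(2), of E F] E F
      by (intro add_mono) (auto simp: is_onb_def)
    finally show "(\<Sum>e\<in>F. (norm (Q e))\<^sup>2) \<le> K + real (card F) * \<epsilon>" .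
  qed
  have s: "(\<lambda>e. (norm (Q e))\<^sup>2) summable_on E"
    by (rule nonneg_bdd_above_summable_on) (auto intro!: bdd_aboveI2 fin)
  then show A: "trace_class A"
    using E by (simp add: trace_class_sqrt [OF Q] hilbert_schmidt_iff)
  have "infsum (\<lambda>e. (norm (Q e))\<^sup>2) E \<le> K"
    by (rule infsum_le_finite_sums [OF s]) (rule fin)
  then show "trace_norm A \<le> K"
    using infsumI [OF trace_norm_sqrt [OF Q A E]] by simp
qed

lemma trace_class_add:
  fixes A B :: "'a::chilbert_space bop"
  assumes A: "trace_class A" and B: "trace_class B"
  shows "trace_class (A + B)" "trace_norm (A + B) \<le> trace_norm A + trace_norm B"
proof -
  have *: "(\<Sum>e\<in>F. cmod (cinner e ((V * (A + B)) e))) \<le> trace_norm A + trace_norm B"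
    if V: "norm V \<le> 1" and F: "finite F" "F \<subseteq> some_onb" for V F
  proof -
    have "(\<Sum>e\<in>F. cmod (cinner e ((V * (A + B)) e)))
        \<le> (\<Sum>e\<in>F. cmod (cinner e ((V * A) e)) + cmod (cinner e ((V * B) e)))"
      by (rule sum_mono) (simp add: bop_linear cinner_add_right norm_triangle_ineq)
    also have "\<dots> \<le> trace_norm A + trace_norm B"
      unfolding sum.distrib
      using trace_norm_bound [OF A V some_onb F] trace_norm_bound [OF B V some_onb F] by simp
    finally show ?thesis .
  qed
  show "trace_class (A + B)" "trace_norm (A + B) \<le> trace_norm A + trace_norm B"
    using trace_class_criterion [OF some_onb, of "A + B" "trace_norm A + trace_norm B"] * by auto
qed

lemma trace_class_scaleC:
  fixes A :: "'a::chilbert_space bop"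
  assumes A: "trace_class A"
  shows "trace_class (c *\<^sub>C A)" "trace_norm (c *\<^sub>C A) = cmod c * trace_norm A"
proof -
  obtain Q where Q: "positive_op Q" "Q * Q = abs_op A"
    using positive_sqrt_exists [OF positive_abs_op] by blast
  define R where "R = sqrt (cmod c) *\<^sub>R Q"
  have R: "positive_op R" "R * R = abs_op (c *\<^sub>C A)"
    using Q by (simp_all add: R_def positive_op_iff adj_scaleR abs_op_scaleC)
  have "((\<lambda>e. cmod c * (norm (Q e))\<^sup>2) has_sum cmod c * trace_norm A) some_onb"
    by (rule has_sum_cmult_right [OF trace_norm_sqrt [OF Q A some_onb]])
  then have h: "((\<lambda>e. (norm (R e))\<^sup>2) has_sum cmod c * trace_norm A) some_onb"
    by (simp add: R_def power_mult_distrib)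
  then show tc: "trace_class (c *\<^sub>C A)"
    using hilbert_schmidt_iff [OF some_onb, of R] has_sum_imp_summable by (simp add: trace_class_sqrt [OF R])
  show "trace_norm (c *\<^sub>C A) = cmod c * trace_norm A"
    by (rule has_sum_unique [OF trace_norm_sqrt [OF R tc some_onb] h])
qed

lemma trace_norm_eq_0:
  fixes A :: "'a::chilbert_space bop"
  assumes A: "trace_class A" and 0: "trace_norm A = 0"
  shows "A = 0"
proof -
  obtain Q where Q: "positive_op Q" "Q * Q = abs_op A"
    using positive_sqrt_exists [OF positive_abs_op] by blast
  have Qa: "adj Q = Q" using Q by (simp add: positive_op_iff)
  have "Q e = 0" if "e \<in> some_onb" for e
    using nonneg_has_sum_le_0D [OF trace_norm_sqrt [OF Q A some_onb]] 0 that by simp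
  then have "Q x = 0" for x
    by (intro onb_total [OF some_onb]) (metis Qa cinner_adj(1) cinner_zero_left)
  then have "abs_op A x = 0" for x by (simp flip: Q(2))
  then have "norm (A x) = 0" for x using norm_abs_op_apply [of A x] by simp
  then show ?thesis by (intro bop_eqI) simp
qed

lemma trace_class_zero: "trace_class (0 :: 'a::chilbert_space bop)"
  and trace_norm_zero: "trace_norm (0 :: 'a::chilbert_space bop) = 0"
proof -
  have "abs_op (0 :: 'a bop) = 0" by (rule abs_op_eqI) (simp_all add: positive_op_def)
  then show "trace_class (0 :: 'a bop)" "trace_norm (0 :: 'a bop) = 0"
    using onb_exists by (simp_all add: trace_class_def trace_norm_def op_trace_def)
qed

lemma trace_class_scaleR: "trace_class A \<Longrightarrow> trace_class (r *\<^sub>R A)" for A :: "'a::chilbert_space bop"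
proof -
  have "r *\<^sub>R A = complex_of_real r *\<^sub>C A" by (rule scaleR_scaleC)
  then show "trace_class A \<Longrightarrow> ?thesis" by (simp add: trace_class_scaleC)
qed

lemma trace_class_minus: "trace_class A \<Longrightarrow> trace_class (- A)" for A :: "'a::chilbert_space bop"
  using trace_class_scaleR [of A "- 1"] by simp

lemma trace_class_diff: "trace_class A \<Longrightarrow> trace_class B \<Longrightarrow> trace_class (A - B)"
  for A B :: "'a::chilbert_space bop"
  using trace_class_add(1) [of A "- B"] by (simp add: trace_class_minus)

typedef (overloaded) 'a tc = "{A :: 'a::chilbert_space bop. trace_class A}"
  morphisms of_tc Tc
  by (rule exI [of _ 0]) (simp add: trace_class_zero)

setup_lifting type_definition_tc

instantiation tc :: (chilbert_space) complex_normed_vector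
begin

lift_definition norm_tc :: "'a tc \<Rightarrow> real" is trace_norm .
lift_definition plus_tc :: "'a tc \<Rightarrow> 'a tc \<Rightarrow> 'a tc" is "(+)" by (rule trace_class_add)
lift_definition minus_tc :: "'a tc \<Rightarrow> 'a tc \<Rightarrow> 'a tc" is "(-)" by (rule trace_class_diff)
lift_definition uminus_tc :: "'a tc \<Rightarrow> 'a tc" is uminus by (rule trace_class_minus)
lift_definition zero_tc :: "'a tc" is 0 by (rule trace_class_zero)
lift_definition scaleC_tc :: "complex \<Rightarrow> 'a tc \<Rightarrow> 'a tc" is scaleC by (rule trace_class_scaleC)
lift_definition scaleR_tc :: "real \<Rightarrow> 'a tc \<Rightarrow> 'a tc" is scaleR by (rule trace_class_scaleR)

definition dist_tc :: "'a tc \<Rightarrow> 'a tc \<Rightarrow> real" where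
  "dist_tc A B = norm (A - B)"

definition uniformity_tc :: "('a tc \<times> 'a tc) filter" where
  "uniformity_tc = (INF e\<in>{0<..}. principal {(A, B). dist A B < e})"

definition open_tc :: "'a tc set \<Rightarrow> bool" where
  "open_tc S \<longleftrightarrow> (\<forall>A\<in>S. \<forall>\<^sub>F (A', B) in uniformity. A' = A \<longrightarrow> B \<in> S)"

definition sgn_tc :: "'a tc \<Rightarrow> 'a tc" where
  "sgn_tc A = inverse (norm A) *\<^sub>R A"

instance
proof
  fix A B :: "'a tc" and a :: complex and r :: real
  show "norm A = 0 \<longleftrightarrow> A = 0" by transfer (auto simp: trace_norm_eq_0 trace_norm_zero)
  show "norm (A + B) \<le> norm A + norm B" by transfer (rule trace_class_add)
  show n: "norm (a *\<^sub>C A) = cmod a * norm A" for a and A :: "'a tc" by transfer (rule trace_class_scaleC)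
  show sc: "r *\<^sub>R A = complex_of_real r *\<^sub>C A" for r and A :: "'a tc" by transfer (rule scaleR_scaleC)
  show "norm (r *\<^sub>R A) = \<bar>r\<bar> * norm A" by (simp add: n sc)
qed (unfold dist_tc_def open_tc_def sgn_tc_def uniformity_tc_def,
     (rule refl | (transfer, simp add: algebra_simps scaleC_add_right scaleC_add_left scaleC_scaleC))+)

end


lemma hs_op_norm:
  fixes A :: "'a::chilbert_space bop"
  assumes E: "is_onb E" and s: "((\<lambda>e. (norm (A e))\<^sup>2) has_sum r\<^sup>2) E" and r: "0 \<le> r"
  shows "norm A \<le> r"
proof -
  have "norm (adj A) \<le> r"
  proof (rule norm_bop_bound [OF r])
    fix x
    have "(norm (adj A x))\<^sup>2 \<le> r\<^sup>2 * (norm x)\<^sup>2"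
    proof (rule has_sum_mono [OF parseval [OF E] has_sum_cmult_left [OF s]])
      fix e
      have "cmod (cinner e (adj A x)) \<le> norm (A e) * norm x"
        by (simp add: cmod_cinner_le flip: cinner_adj(1))
      then show "(cmod (cinner e (adj A x)))\<^sup>2 \<le> (norm (A e))\<^sup>2 * (norm x)\<^sup>2"
        by (simp flip: power_mult_distrib)
    qed
    then show "norm (adj A x) \<le> r * norm x"
      using power2_le_imp_le [of "norm (adj A x)" "r * norm x"] r by (simp add: power_mult_distrib)
  qed
  then show ?thesis by simp
qed

lemma norm_le_trace_norm:
  fixes A :: "'a::chilbert_space bop"
  assumes A: "trace_class A"
  shows "norm A \<le> trace_norm A"
proof -
  obtain Q where Q: "positive_op Q" "Q * Q = abs_op A"
    using positive_sqrt_exists [OF positive_abs_op] by blast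
  note h = trace_norm_sqrt [OF Q A some_onb]
  have t: "0 \<le> trace_norm A" by (rule has_sum_nonneg [OF h]) simp
  have "norm Q \<le> sqrt (trace_norm A)"
    by (rule hs_op_norm [OF some_onb]) (use h t in simp_all)
  then have "norm Q * norm Q \<le> sqrt (trace_norm A) * sqrt (trace_norm A)"
    using t by (intro mult_mono) auto
  then have "norm (abs_op A) \<le> trace_norm A"
    using norm_mult_ineq [of Q Q] t by (simp add: Q(2))
  moreover have "norm A \<le> norm (abs_op A)"
    using norm_bop [of "abs_op A"] by (intro norm_bop_bound) (simp_all add: norm_abs_op_apply)
  ultimately show ?thesis by linarith
qed

instance tc :: (chilbert_space) banach
proof
  fix X :: "nat \<Rightarrow> 'a tc"
  assume X: "Cauchy X"
  have le: "norm (of_tc A) \<le> norm A" for A :: "'a tc"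
    by transfer (rule norm_le_trace_norm)
  have "Cauchy (\<lambda>n. of_tc (X n))"
  proof (rule CauchyI)
    fix e :: real assume "e > 0"
    then obtain N where "\<forall>m\<ge>N. \<forall>n\<ge>N. norm (X m - X n) < e" using CauchyD [OF X] by blast
    then show "\<exists>M. \<forall>m\<ge>M. \<forall>n\<ge>M. norm (of_tc (X m) - of_tc (X n)) < e"
      using le order_le_less_trans by (metis minus_tc.rep_eq)
  qed
  then obtain A where A: "(\<lambda>n. of_tc (X n)) \<longlonglongrightarrow> A"
    using Cauchy_convergent convergent_def by blast
  have lim: "trace_class (of_tc (X n) - A) \<and> trace_norm (of_tc (X n) - A) \<le> e"
    if n: "\<And>m. m \<ge> N \<Longrightarrow> norm (X n - X m) \<le> e" for n N e
  proof -
    have "(\<Sum>f\<in>F. cmod (cinner f ((V * (of_tc (X n) - A)) f))) \<le> e"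
      if V: "norm V \<le> 1" and F: "finite F" "F \<subseteq> some_onb" for V F
    proof (rule LIMSEQ_le_const2)
      have "(\<lambda>m. cinner f ((V * (of_tc (X n) - of_tc (X m))) f)) \<longlonglongrightarrow> cinner f ((V * (of_tc (X n) - A)) f)" for f
        by (intro bounded_linear.tendsto [OF bounded_linear_cinner_right] tendsto_bop_apply tendsto_intros A)
      then show "(\<lambda>m. \<Sum>f\<in>F. cmod (cinner f ((V * (of_tc (X n) - of_tc (X m))) f)))
          \<longlonglongrightarrow> (\<Sum>f\<in>F. cmod (cinner f ((V * (of_tc (X n) - A)) f)))"
        by (intro tendsto_sum tendsto_norm)
      have "(\<Sum>f\<in>F. cmod (cinner f ((V * (of_tc (X n) - of_tc (X m))) f))) \<le> e" if "m \<ge> N" for m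
        using trace_norm_bound [OF _ V some_onb F, of "of_tc (X n - X m)"] n [OF that] of_tc [of "X n - X m"]
        by (simp add: norm_tc.rep_eq minus_tc.rep_eq)
      then show "\<exists>M. \<forall>m\<ge>M. (\<Sum>f\<in>F. cmod (cinner f ((V * (of_tc (X n) - of_tc (X m))) f))) \<le> e"
        by blast
    qed
    then show ?thesis using trace_class_criterion [OF some_onb, of "of_tc (X n) - A" e] by blast
  qed
  have ev: "\<exists>N. \<forall>n\<ge>N. trace_class (of_tc (X n) - A) \<and> trace_norm (of_tc (X n) - A) \<le> e" if "e > 0" for e
  proof -
    obtain N where "\<forall>m\<ge>N. \<forall>n\<ge>N. norm (X m - X n) < e" using CauchyD [OF X \<open>e > 0\<close>] by blast
    then show ?thesis using lim [of N _ e] by (metis less_imp_le)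
  qed
  obtain N where "trace_class (of_tc (X N) - A)" using ev [of 1] by auto
  then have "trace_class (of_tc (X N) - (of_tc (X N) - A))"
    using of_tc [of "X N"] trace_class_diff by blast
  then have A': "of_tc (Tc A) = A" by (simp add: Tc_inverse)
  have "X \<longlonglongrightarrow> Tc A"
  proof (rule LIMSEQ_I)
    fix e :: real assume "e > 0"
    then obtain N where "\<forall>n\<ge>N. trace_norm (of_tc (X n) - A) \<le> e / 2" using ev [of "e/2"] by auto
    then show "\<exists>N. \<forall>n\<ge>N. norm (X n - Tc A) < e"
      using \<open>e > 0\<close> by (intro exI [of _ N]) (fastforce simp: norm_tc.rep_eq minus_tc.rep_eq A')
  qed
  then show "convergent X" by (rule convergentI)
qed


section \<open>The Hilbert space of Hilbert-Schmidt operators\<close>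

lemma hs_add:
  fixes A B :: "'a::chilbert_space bop"
  assumes "hilbert_schmidt A" "hilbert_schmidt B"
  shows "hilbert_schmidt (A + B)"
  unfolding hilbert_schmidt_iff [OF some_onb]
proof (rule summable_on_comparison_test)
  show "(\<lambda>e. 2 * (norm (A e))\<^sup>2 + 2 * (norm (B e))\<^sup>2) summable_on some_onb"
    using assms unfolding hilbert_schmidt_iff [OF some_onb]
    by (rule summable_on_add [OF summable_on_cmult_right summable_on_cmult_right])
  fix e
  have "(norm ((A + B) e))\<^sup>2 \<le> (norm (A e) + norm (B e))\<^sup>2"
    by (simp add: norm_triangle_ineq power_mono)
  also have "\<dots> \<le> 2 * (norm (A e))\<^sup>2 + 2 * (norm (B e))\<^sup>2"
    using sum_squares_bound [of "norm (A e)" "norm (B e)"] by (simp add: power2_sum)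
  finally show "(norm ((A + B) e))\<^sup>2 \<le> 2 * (norm (A e))\<^sup>2 + 2 * (norm (B e))\<^sup>2" .
qed simp

lemma hs_scaleC: "hilbert_schmidt A \<Longrightarrow> hilbert_schmidt (c *\<^sub>C A)" for A :: "'a::chilbert_space bop"
  using summable_on_cmult_right [of "\<lambda>e. (norm (A e))\<^sup>2" some_onb "(cmod c)\<^sup>2"]
  by (simp add: hilbert_schmidt_iff [OF some_onb] norm_scaleC power_mult_distrib)

lemma hs_zero: "hilbert_schmidt (0 :: 'a::chilbert_space bop)"
  by (simp add: hilbert_schmidt_iff [OF some_onb])

lemma hs_scaleR: "hilbert_schmidt A \<Longrightarrow> hilbert_schmidt (r *\<^sub>R A)" for A :: "'a::chilbert_space bop"
  using hs_scaleC [of A "complex_of_real r"] by (simp add: scaleR_scaleC [of r A])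

lemma hs_minus: "hilbert_schmidt A \<Longrightarrow> hilbert_schmidt (- A)" for A :: "'a::chilbert_space bop"
  using hs_scaleR [of A "- 1"] by simp

lemma hs_diff: "hilbert_schmidt A \<Longrightarrow> hilbert_schmidt B \<Longrightarrow> hilbert_schmidt (A - B)"
  for A B :: "'a::chilbert_space bop"
  using hs_add [of A "- B"] by (simp add: hs_minus)

lemma hs_trace_has_sum:
  fixes A B :: "'a::chilbert_space bop"
  assumes A: "hilbert_schmidt A" and B: "hilbert_schmidt B"
  shows "((\<lambda>e. cinner (A e) (B e)) has_sum op_trace (adj A * B)) some_onb"
proof -
  have "(\<lambda>e. cinner (A e) (B e)) summable_on some_onb"
  proof (rule abs_summable_summable, rule summable_on_comparison_test)
    show "(\<lambda>e. (norm (A e))\<^sup>2 + (norm (B e))\<^sup>2) summable_on some_onb"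
      using assms unfolding hilbert_schmidt_iff [OF some_onb] by (rule summable_on_add)
    fix e
    have "cmod (cinner (A e) (B e)) \<le> norm (A e) * norm (B e)" by (rule cmod_cinner_le)
    also have "\<dots> \<le> (norm (A e))\<^sup>2 + (norm (B e))\<^sup>2"
      using sum_squares_bound [of "norm (A e)" "norm (B e)"] mult_nonneg_nonneg [of "norm (A e)" "norm (B e)"]
      by (simp del: mult_nonneg_nonneg)
    finally show "cmod (cinner (A e) (B e)) \<le> (norm (A e))\<^sup>2 + (norm (B e))\<^sup>2" .
  qed simp
  moreover have "op_trace (adj A * B) = infsum (\<lambda>e. cinner (A e) (B e)) some_onb"
    by (simp add: trace_some_onb cinner_adj(1))
  ultimately show ?thesis by simp
qed

lemma hs_norm_has_sum:
  fixes A :: "'a::chilbert_space bop"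
  assumes A: "hilbert_schmidt A"
  shows "((\<lambda>e. (norm (A e))\<^sup>2) has_sum Re (op_trace (adj A * A))) some_onb"
  using has_sum_Re [OF hs_trace_has_sum [OF A A]] by (simp add: cinner_self)

typedef (overloaded) 'a hs = "{A :: 'a::chilbert_space bop. hilbert_schmidt A}"
  morphisms of_hs Hs
  by (rule exI [of _ 0]) (simp add: hs_zero)

setup_lifting type_definition_hs

instantiation hs :: (chilbert_space) complex_inner
begin

lift_definition cinner_hs :: "'a hs \<Rightarrow> 'a hs \<Rightarrow> complex" is "\<lambda>A B. op_trace (adj A * B)" .
lift_definition plus_hs :: "'a hs \<Rightarrow> 'a hs \<Rightarrow> 'a hs" is "(+)" by (rule hs_add)
lift_definition minus_hs :: "'a hs \<Rightarrow> 'a hs \<Rightarrow> 'a hs" is "(-)" by (rule hs_diff)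
lift_definition uminus_hs :: "'a hs \<Rightarrow> 'a hs" is uminus by (rule hs_minus)
lift_definition zero_hs :: "'a hs" is 0 by (rule hs_zero)
lift_definition scaleC_hs :: "complex \<Rightarrow> 'a hs \<Rightarrow> 'a hs" is scaleC by (rule hs_scaleC)
lift_definition scaleR_hs :: "real \<Rightarrow> 'a hs \<Rightarrow> 'a hs" is scaleR by (rule hs_scaleR)

definition inner_hs :: "'a hs \<Rightarrow> 'a hs \<Rightarrow> real" where
  "inner_hs A B = Re (cinner A B)"

definition norm_hs :: "'a hs \<Rightarrow> real" where
  "norm_hs A = sqrt (inner A A)"

definition dist_hs :: "'a hs \<Rightarrow> 'a hs \<Rightarrow> real" where
  "dist_hs A B = norm (A - B)"

definition uniformity_hs :: "('a hs \<times> 'a hs) filter" where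
  "uniformity_hs = (INF e\<in>{0<..}. principal {(A, B). dist A B < e})"

definition open_hs :: "'a hs set \<Rightarrow> bool" where
  "open_hs S \<longleftrightarrow> (\<forall>A\<in>S. \<forall>\<^sub>F (A', B) in uniformity. A' = A \<longrightarrow> B \<in> S)"

definition sgn_hs :: "'a hs \<Rightarrow> 'a hs" where
  "sgn_hs A = inverse (norm A) *\<^sub>R A"

instance
proof
  fix A B C :: "'a hs" and a :: complex and r :: real
  show comm: "cinner A B = cnj (cinner B A)" for A B :: "'a hs"
  proof transfer
    fix A B :: "'a bop" assume *: "hilbert_schmidt A" "hilbert_schmidt B"
    have "((\<lambda>e. cnj (cinner (B e) (A e))) has_sum cnj (op_trace (adj B * A))) some_onb"
      using hs_trace_has_sum [OF *(2,1)] by simp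
    then have "((\<lambda>e. cinner (A e) (B e)) has_sum cnj (op_trace (adj B * A))) some_onb"
      unfolding cinner_commute [symmetric] .
    then show "op_trace (adj A * B) = cnj (op_trace (adj B * A))"
      by (rule has_sum_unique [OF hs_trace_has_sum [OF *]])
  qed
  show add: "cinner A (B + C) = cinner A B + cinner A C" for A B C :: "'a hs"
  proof transfer
    fix A B C :: "'a bop" assume *: "hilbert_schmidt A" "hilbert_schmidt B" "hilbert_schmidt C"
    have "((\<lambda>e. cinner (A e) ((B + C) e)) has_sum op_trace (adj A * B) + op_trace (adj A * C)) some_onb"
      using has_sum_add [OF hs_trace_has_sum [OF *(1,2)] hs_trace_has_sum [OF *(1,3)]]
      by (simp add: cinner_add_right)
    then show "op_trace (adj A * (B + C)) = op_trace (adj A * B) + op_trace (adj A * C)"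
      by (rule has_sum_unique [OF hs_trace_has_sum [OF *(1) hs_add [OF *(2,3)]]])
  qed
  show scale: "cinner A (a *\<^sub>C B) = a * cinner A B" for A B :: "'a hs" and a
  proof transfer
    fix A B :: "'a bop" and a assume *: "hilbert_schmidt A" "hilbert_schmidt B"
    have "((\<lambda>e. cinner (A e) ((a *\<^sub>C B) e)) has_sum a * op_trace (adj A * B)) some_onb"
      using has_sum_cmult_right [OF hs_trace_has_sum [OF *], of a] by (simp add: cinner_scaleC_right)
    then show "op_trace (adj A * (a *\<^sub>C B)) = a * op_trace (adj A * B)"
      by (rule has_sum_unique [OF hs_trace_has_sum [OF *(1) hs_scaleC [OF *(2)]]])
  qed
  show sR: "r *\<^sub>R A = complex_of_real r *\<^sub>C A" for r and A :: "'a hs" by transfer (rule scaleR_scaleC)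
  show comm': "inner A B = inner B A" for A B :: "'a hs"
    unfolding inner_hs_def by (metis comm cnj.simps(1))
  show "inner (A + B) C = inner A C + inner B C"
    unfolding comm' [of _ C] by (simp add: inner_hs_def add)
  show "inner (r *\<^sub>R A) B = r * inner A B"
    unfolding comm' [of _ B] by (simp add: inner_hs_def sR scale)
  show "0 \<le> inner A A"
    unfolding inner_hs_def by transfer (rule has_sum_nonneg [OF hs_norm_has_sum], auto)
  show "inner A A = 0 \<longleftrightarrow> A = 0"
    unfolding inner_hs_def
  proof transfer
    fix A :: "'a bop" assume A: "hilbert_schmidt A"
    have "A = 0" if 0: "Re (op_trace (adj A * A)) = 0"
    proof -
      have "norm A \<le> 0"
        by (rule hs_op_norm [OF some_onb]) (use hs_norm_has_sum [OF A] 0 in simp_all)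
      then show ?thesis by simp
    qed
    then show "Re (op_trace (adj A * A)) = 0 \<longleftrightarrow> A = 0" by (auto simp: op_trace_def)
  qed
  show "norm A = sqrt (inner A A)" by (simp add: norm_hs_def)
  show "inner A B = Re (cinner A B)" by (simp add: inner_hs_def)
qed (unfold dist_hs_def open_hs_def sgn_hs_def uniformity_hs_def,
     (rule refl | (transfer, simp add: algebra_simps scaleC_add_right scaleC_add_left scaleC_scaleC))+)

end

lemma norm_hs_has_sum: "((\<lambda>e. (norm (of_hs A e))\<^sup>2) has_sum (norm A)\<^sup>2) some_onb"
proof -
  have "(norm A)\<^sup>2 = Re (op_trace (adj (of_hs A) * of_hs A))"
    by (simp add: power2_norm_eq_inner inner_hs_def cinner_hs.rep_eq)
  then show ?thesis using hs_norm_has_sum [of "of_hs A"] of_hs [of A] by simp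
qed

instance hs :: (chilbert_space) chilbert_space
proof
  fix X :: "nat \<Rightarrow> 'a hs"
  assume X: "Cauchy X"
  have le: "norm (of_hs A) \<le> norm A" for A :: "'a hs"
    by (rule hs_op_norm [OF some_onb norm_hs_has_sum norm_ge_zero])
  have "Cauchy (\<lambda>n. of_hs (X n))"
  proof (rule CauchyI)
    fix e :: real assume "e > 0"
    then obtain N where "\<forall>m\<ge>N. \<forall>n\<ge>N. norm (X m - X n) < e" using CauchyD [OF X] by blast
    then show "\<exists>M. \<forall>m\<ge>M. \<forall>n\<ge>M. norm (of_hs (X m) - of_hs (X n)) < e"
      using le order_le_less_trans by (metis minus_hs.rep_eq)
  qed
  then obtain A where A: "(\<lambda>n. of_hs (X n)) \<longlonglongrightarrow> A"
    using Cauchy_convergent convergent_def by blast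
  have fin: "(\<Sum>f\<in>F. (norm ((of_hs (X n) - A) f))\<^sup>2) \<le> e\<^sup>2"
    if n: "\<And>m. m \<ge> N \<Longrightarrow> norm (X n - X m) \<le> e" and F: "finite F" "F \<subseteq> some_onb" for n N e F
  proof (rule LIMSEQ_le_const2)
    show "(\<lambda>m. \<Sum>f\<in>F. (norm ((of_hs (X n) - of_hs (X m)) f))\<^sup>2)
        \<longlonglongrightarrow> (\<Sum>f\<in>F. (norm ((of_hs (X n) - A) f))\<^sup>2)"
      by (intro tendsto_sum tendsto_power tendsto_norm tendsto_bop_apply tendsto_intros A)
    have "(\<Sum>f\<in>F. (norm ((of_hs (X n) - of_hs (X m)) f))\<^sup>2) \<le> e\<^sup>2" if "m \<ge> N" for m
    proof -
      have "(\<Sum>f\<in>F. (norm (of_hs (X n - X m) f))\<^sup>2) \<le> (norm (X n - X m))\<^sup>2"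
        by (rule finite_sum_le_has_sum [OF norm_hs_has_sum F]) simp
      also have "\<dots> \<le> e\<^sup>2" using n [OF that] by (intro power_mono) auto
      finally show ?thesis by (simp add: minus_hs.rep_eq)
    qed
    then show "\<exists>M. \<forall>m\<ge>M. (\<Sum>f\<in>F. (norm ((of_hs (X n) - of_hs (X m)) f))\<^sup>2) \<le> e\<^sup>2"
      by blast
  qed
  have lim: "hilbert_schmidt (of_hs (X n) - A)"
    "infsum (\<lambda>f. (norm ((of_hs (X n) - A) f))\<^sup>2) some_onb \<le> e\<^sup>2"
    if n: "\<And>m. m \<ge> N \<Longrightarrow> norm (X n - X m) \<le> e" for n N e
  proof -
    have s: "(\<lambda>f. (norm ((of_hs (X n) - A) f))\<^sup>2) summable_on some_onb"
      by (rule nonneg_bdd_above_summable_on) (auto intro!: bdd_aboveI2 fin [OF n] simp del: bop_simps)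
    show "infsum (\<lambda>f. (norm ((of_hs (X n) - A) f))\<^sup>2) some_onb \<le> e\<^sup>2"
      by (rule infsum_le_finite_sums [OF s]) (rule fin [OF n])
    show "hilbert_schmidt (of_hs (X n) - A)" using s by (simp only: hilbert_schmidt_iff [OF some_onb])
  qed
  obtain N where "\<forall>m\<ge>N. \<forall>n\<ge>N. norm (X m - X n) < 1" using CauchyD [OF X, of 1] by auto
  then have "hilbert_schmidt (of_hs (X N) - A)" by (intro lim(1) [of N N 1]) (auto intro: less_imp_le)
  then have "hilbert_schmidt (of_hs (X N) - (of_hs (X N) - A))"
    using of_hs [of "X N"] hs_diff by blast
  then have A': "of_hs (Hs A) = A" by (simp add: Hs_inverse)
  have "X \<longlonglongrightarrow> Hs A"
  proof (rule LIMSEQ_I)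
    fix e :: real assume "e > 0"
    then obtain N where N: "\<forall>m\<ge>N. \<forall>n\<ge>N. norm (X m - X n) < e / 2" using CauchyD [OF X, of "e/2"] by auto
    have "norm (X n - Hs A) < e" if "n \<ge> N" for n
    proof -
      have "(norm (X n - Hs A))\<^sup>2 = infsum (\<lambda>f. (norm (of_hs (X n - Hs A) f))\<^sup>2) some_onb"
        using norm_hs_has_sum by (rule infsumI [symmetric])
      also have "\<dots> \<le> (e / 2)\<^sup>2"
        unfolding minus_hs.rep_eq A' by (rule lim(2) [of N]) (use N that less_imp_le in blast)
      finally have "norm (X n - Hs A) \<le> e / 2" by (rule power2_le_imp_le) (use \<open>e > 0\<close> in simp)
      then show ?thesis using \<open>e > 0\<close> by simp
    qed
    then show "\<exists>N. \<forall>n\<ge>N. norm (X n - Hs A) < e" by blast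
  qed
  then show "convergent X" by (rule convergentI)
qed


section \<open>Completely positive maps and generators\<close>

definition self_adjoint_ops :: "'a::complex_inner bop set" where
  "self_adjoint_ops = {H. adj H = H}"

definition commutator :: "'a::complex_normed_vector bop \<Rightarrow> 'a bop \<Rightarrow> 'a bop" where
  "commutator A X = A * X - X * A"

definition anticommutator :: "'a::complex_normed_vector bop \<Rightarrow> 'a bop \<Rightarrow> 'a bop" where
  "anticommutator A X = A * X + X * A"

definition clinear :: "('a::complex_vector \<Rightarrow> 'b::complex_vector) \<Rightarrow> bool" where
  "clinear f \<longleftrightarrow> (\<forall>x y. f (x + y) = f x + f y) \<and> (\<forall>c x. f (c *\<^sub>C x) = c *\<^sub>C f x)"

text \<open>A trace-class operator on the \<open>n\<close>-fold direct sum of the Hilbert space with itself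
  (that is, on its tensor product with the \<open>n\<close>-dimensional space) is an \<open>n\<close> by \<open>n\<close> array of
  trace-class blocks; only the entries with indices below \<open>n\<close> matter.\<close>

definition block_positive :: "nat \<Rightarrow> (nat \<Rightarrow> nat \<Rightarrow> 'a::chilbert_space tc) \<Rightarrow> bool" where
  "block_positive n X \<longleftrightarrow>
    (\<forall>v :: nat \<Rightarrow> 'a. (\<Sum>i<n. \<Sum>j<n. cinner (v i) (of_tc (X i j) (v j))) \<in> \<real>\<^sub>\<ge>\<^sub>0)"

definition CP :: "('a::chilbert_space tc \<Rightarrow> 'a tc) set" where
  "CP = {\<Phi>. clinear \<Phi> \<and>
    (\<forall>n X. block_positive n X \<longrightarrow> block_positive n (\<lambda>i j. \<Phi> (X i j)))}"

definition CPTP :: "('a::chilbert_space tc \<Rightarrow> 'a tc) set" where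
  "CPTP = {\<Phi> \<in> CP. \<forall>X. op_trace (of_tc (\<Phi> X)) = op_trace (of_tc X)}"

definition dual_map :: "('a::chilbert_space tc \<Rightarrow> 'a tc) \<Rightarrow> 'a bop \<Rightarrow> 'a bop" where
  "dual_map \<Phi> = (THE \<Psi>. bounded_clinear \<Psi> \<and>
    (\<forall>A C. op_trace (of_tc (\<Phi> A) * C) = op_trace (of_tc A * \<Psi> C)))"

text \<open>In the remaining definitions the abstraction functions \<open>Tc\<close>, \<open>Hs\<close> and \<open>Bop\<close> are only
  applied to arguments in their proper domain: the trace-class operators form an ideal contained
  in the Hilbert-Schmidt operators, and completely positive maps are bounded.
  In \<open>CP_restricted\<close> the outer trace is the one of operators on the Hilbert space
  \<^typ>\<open>'a hs\<close>.\<close>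

definition CP_restricted :: "'a::chilbert_space tc \<Rightarrow> ('a tc \<Rightarrow> 'a tc) set" where
  "CP_restricted B = {\<Phi> \<in> CP.
    op_trace (Bop (\<lambda>X :: 'a hs. Hs (of_tc (\<Phi> (Tc (adj (of_tc B) * of_hs X * of_tc B)))))) = 0}"

definition blinfun_exp :: "('a::banach \<Rightarrow>\<^sub>L 'a) \<Rightarrow> ('a \<Rightarrow>\<^sub>L 'a)" where
  "blinfun_exp L = (\<Sum>n. (1 / fact n) *\<^sub>R (((o\<^sub>L) L) ^^ n) id_blinfun)"

text \<open>The elements of the space of bounded complex-linear maps on \<^typ>\<open>'a tc\<close> are kept as
  functions; \<open>Blinfun\<close> is used to form the exponential in the operator norm.\<close>

definition CPTP_generators :: "('a::chilbert_space tc \<Rightarrow> 'a tc) set" where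
  "CPTP_generators = {L. bounded_clinear L \<and>
    (\<forall>t\<ge>0. blinfun_apply (blinfun_exp (t *\<^sub>R Blinfun L)) \<in> CPTP)}"

definition Xi :: "'a::chilbert_space bop \<Rightarrow> ('a tc \<Rightarrow> 'a tc) \<Rightarrow> 'a tc \<Rightarrow> 'a tc" where
  "Xi H \<Phi> = (\<lambda>X. Tc (- \<i> *\<^sub>C commutator H (of_tc X)) + \<Phi> X
    - Tc (anticommutator ((1/2) *\<^sub>C dual_map \<Phi> 1) (of_tc X)))"

end

theory Submission
  imports Defs
begin

text \<open>A bounded map \<open>\<Psi>\<close> on trace-class operators determines a sesquilinear form on trace-class operators:
  \<open>choi_form \<Psi> S T\<close> is the trace of the operator \<open>X \<mapsto> \<Psi>(S X T\<^sup>*)\<close> on the Hilbert-Schmidt operators, so that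
  its value at \<open>\<bar>x\<rangle>\<langle>v\<bar>\<close> and \<open>\<bar>y\<rangle>\<langle>w\<bar>\<close> is \<open>\<langle>v, \<Psi>(\<bar>x\<rangle>\<langle>y\<bar>) w\<rangle>\<close>. A bounded map is completely positive
  iff its form is positive semidefinite, and \<open>CP\<^sub>B\<close> requires that \<open>B\<^sup>*\<close> is a null vector of this form.

  The form \<open>q\<close> of a generator \<open>L\<close> is Hermitian, and nonnegative on traceless operators: differentiate
  \<open>exp (tL)\<close> at \<open>0\<close>. If \<open>L(X) = K X + X K\<^sup>* + \<Phi>(X)\<close> with \<open>\<Phi>\<close> in \<open>CP\<^sub>B\<close>, then by Cauchy-Schwarz the form of
  \<open>\<Phi>\<close> at \<open>(S, T)\<close> is the value of \<open>q\<close> at \<open>S - (tr S / tr B\<^sup>*) B\<^sup>*\<close> and \<open>T - (tr T / tr B\<^sup>*) B\<^sup>*\<close>, so \<open>\<Phi>\<close> is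
  unique. Conversely, that value equals \<open>q(S, T) - tr (K S) cnj (tr T) - tr S cnj (tr (K T))\<close> for a bounded
  \<open>K\<close> found by duality, so \<open>X \<mapsto> L(X) - K X - X K\<^sup>*\<close> is in \<open>CP\<^sub>B\<close>. The Hamiltonian is then determined up to
  a real multiple of the identity, which the trace condition fixes.\<close>

section \<open>Factorization of trace-class operators\<close>

text \<open>Working with forms avoids Kraus operators, but \<open>choi_form\<close> must first make
  sense: the operator behind it has to be trace class, with norm at most
  \<open>onorm \<Psi> * norm S * norm T\<close>. It is assembled from expansions of S and T into
  rank-one operators, whose summability rests on writing a trace-class operator as a product of two
  Hilbert-Schmidt operators. The way back from a positive semidefinite form to complete positivity
  is the Schur product theorem for finite compressions, followed by a limit.

  The trace condition in the domain has a plain meaning. For K = -iH - (1/2)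
  \<open>dual_map \<Phi> 1\<close> the imaginary part of tr (K adj B) is (1/2) Im tr \<Phi>(B) - Re
  tr (adj B H), so the condition says that tr (K adj B) is real. Replacing H by H + r adds -ir to K
  and changes this imaginary part by -r Re tr B; hence Re tr B \<noteq> 0 is what makes the
  condition single out one r.\<close>

lemma bounded_linear_scaleC_right: "bounded_linear (\<lambda>x::'a::complex_normed_vector. c *\<^sub>C x)"
  by (rule bounded_linear_intro [where K = "cmod c"])
    (auto simp: scaleC_add_right norm_scaleC scaleR_scaleC scaleC_scaleC mult.commute)

lemma norm_of_hs_le: "norm (of_hs A) \<le> norm A"
  by (rule hs_op_norm [OF some_onb norm_hs_has_sum norm_ge_zero])

lemma hs_mult_left:
  fixes A V :: "'a::chilbert_space bop"
  assumes A: "hilbert_schmidt A"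
  shows "hilbert_schmidt (V * A)" "norm (Hs (V * A)) \<le> norm V * norm (Hs A)"
proof -
  have A': "of_hs (Hs A) = A" using A by (simp add: Hs_inverse)
  have h: "((\<lambda>e. (norm V)\<^sup>2 * (norm (A e))\<^sup>2) has_sum (norm V)\<^sup>2 * (norm (Hs A))\<^sup>2) some_onb"
    using norm_hs_has_sum [of "Hs A"] by (intro has_sum_cmult_right) (simp add: A')
  have le: "(norm ((V * A) e))\<^sup>2 \<le> (norm V)\<^sup>2 * (norm (A e))\<^sup>2" for e
    using norm_bop [of V "A e"] by (simp flip: power_mult_distrib)
  show VA: "hilbert_schmidt (V * A)"
    unfolding hilbert_schmidt_iff [OF some_onb]
    by (rule summable_on_comparison_test [OF has_sum_imp_summable [OF h]]) (use le in auto)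
  have "(norm (Hs (V * A)))\<^sup>2 \<le> (norm V)\<^sup>2 * (norm (Hs A))\<^sup>2"
    using norm_hs_has_sum [of "Hs (V * A)"] VA le
    by (intro has_sum_mono [OF _ h]) (auto simp: Hs_inverse)
  then show "norm (Hs (V * A)) \<le> norm V * norm (Hs A)"
    by (simp flip: power_mult_distrib)
qed

lemma hs_adj:
  fixes A :: "'a::chilbert_space bop"
  assumes A: "hilbert_schmidt A"
  shows "hilbert_schmidt (adj A)" "norm (Hs (adj A)) = norm (Hs A)"
proof -
  have s: "(\<lambda>e. (norm (B e))\<^sup>2) summable_on some_onb" if "hilbert_schmidt B" for B :: "'a bop"
    using that by (simp add: hilbert_schmidt_iff [OF some_onb])
  have a: "hilbert_schmidt (adj B)" if "hilbert_schmidt B" for B :: "'a bop"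
    using hs_swap(1) [OF some_onb some_onb s [OF that]] by (simp add: hilbert_schmidt_iff [OF some_onb])
  show "hilbert_schmidt (adj A)" using a [OF A] .
  have n: "(norm (Hs B))\<^sup>2 = infsum (\<lambda>e. (norm (B e))\<^sup>2) some_onb" if "hilbert_schmidt B" for B :: "'a bop"
    using infsumI [OF norm_hs_has_sum [of "Hs B"]] that by (simp add: Hs_inverse)
  have le: "norm (Hs (adj B)) \<le> norm (Hs B)" if "hilbert_schmidt B" for B :: "'a bop"
    using hs_swap(2) [OF some_onb some_onb s [OF that]] that a [OF that]
    by (intro power2_le_imp_le [OF _ norm_ge_zero]) (simp add: n)
  show "norm (Hs (adj A)) = norm (Hs A)"
    using le [OF A] le [OF a [OF A]] by simp
qed

lemma hs_mult_right:
  fixes A V :: "'a::chilbert_space bop"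
  assumes A: "hilbert_schmidt A"
  shows "hilbert_schmidt (A * V)" "norm (Hs (A * V)) \<le> norm (Hs A) * norm V"
proof -
  note * = hs_mult_left [OF hs_adj(1) [OF A], of "adj V"]
  show "hilbert_schmidt (A * V)" using hs_adj(1) [OF *(1)] by (simp add: adj_mult)
  show "norm (Hs (A * V)) \<le> norm (Hs A) * norm V"
    using *(2) hs_adj(2) [OF *(1)] hs_adj(2) [OF A] by (simp add: adj_mult mult.commute)
qed

text \<open>Taking adjoints is an antilinear isometry \<open>J\<close> of the Hilbert-Schmidt space.
  By polarization it reverses the inner product, and the reversed product, written out, is the
  cyclic exchange.\<close>

lemma hs_trace_cyclic:
  fixes A B :: "'a::chilbert_space bop"
  assumes A: "hilbert_schmidt A" and B: "hilbert_schmidt B"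
  shows "op_trace (adj A * B) = op_trace (B * adj A)"
proof -
  define J where "J X = Hs (adj (of_hs X))" for X :: "'a hs"
  have J: "of_hs (J X) = adj (of_hs X)" for X
    unfolding J_def by (rule Hs_inverse) (use of_hs hs_adj(1) in auto)
  have Jn: "norm (J X) = norm X" for X
    unfolding J_def using hs_adj(2) [of "of_hs X"] of_hs [of X] by (simp add: of_hs_inverse)
  have Ja: "J (X + Y) = J X + J Y" and Jm: "J (X - Y) = J X - J Y" and Jc: "J (c *\<^sub>C X) = cnj c *\<^sub>C J X" for X Y c
    by (simp_all add: of_hs_inject [symmetric] J plus_hs.rep_eq minus_hs.rep_eq scaleC_hs.rep_eq adj_add adj_diff adj_scaleC)
  have Ji: "inner (J X) (J Y) = inner X Y" for X Y
    using Jn [of "X + Y"] Jn [of "X - Y"]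
    by (simp add: Ja Jm norm_eq_sqrt_inner algebra_simps inner_commute)
  have Jci: "cinner (J X) (J Y) = cinner Y X" for X Y
  proof -
    have "inner (\<i> *\<^sub>C J X) (J Y) = - inner (J (\<i> *\<^sub>C X)) (J Y)"
      by (simp add: Jc inner_eq_Re_cinner cinner_scaleC_left)
    then have "cinner (J X) (J Y) = cnj (cinner X Y)"
      by (simp add: cinner_eq_inner [of "J X"] cinner_eq_inner [of X] Ji complex_eq_iff)
    then show ?thesis using cinner_commute by metis
  qed
  have h: "of_hs (Hs A) = A" "of_hs (Hs B) = B" using A B by (simp_all add: Hs_inverse)
  have "op_trace (adj A * B) = cinner (Hs A) (Hs B)" by (simp add: cinner_hs.rep_eq h)
  also have "\<dots> = cinner (J (Hs B)) (J (Hs A))" by (simp add: Jci)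
  also have "\<dots> = op_trace (B * adj A)" by (simp add: cinner_hs.rep_eq h J)
  finally show ?thesis .
qed

lemma cinner_Hs:
  fixes A B :: "'a::chilbert_space bop"
  shows "hilbert_schmidt A \<Longrightarrow> hilbert_schmidt B \<Longrightarrow> cinner (Hs A) (Hs B) = op_trace (adj A * B)"
  by (simp add: cinner_hs.rep_eq Hs_inverse)

lemma trace_class_hs_mult:
  fixes A B :: "'a::chilbert_space bop"
  assumes A: "hilbert_schmidt A" and B: "hilbert_schmidt B"
  shows "trace_class (adj A * B)" "trace_norm (adj A * B) \<le> norm (Hs A) * norm (Hs B)"
proof -
  have *: "(\<Sum>e\<in>F. cmod (cinner e ((V * (adj A * B)) e))) \<le> norm (Hs A) * norm (Hs B)"
    if V: "norm V \<le> 1" and F: "finite F" "F \<subseteq> some_onb" for V F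
  proof -
    \<comment> \<open>The test operator V of \<open>trace_class_criterion\<close> is moved onto the
      left factor, where it does not increase the Hilbert-Schmidt norm; Cauchy-Schwarz then applies
      to the diagonal entries.\<close>
    define D where "D = A * adj V"
    have D: "hilbert_schmidt D" "norm (Hs D) \<le> norm (Hs A)"
      using hs_mult_right [OF A, of "adj V"] V mult_left_mono [OF V, of "norm (Hs A)"] by (auto simp: D_def)
    have "(\<Sum>e\<in>F. cmod (cinner e ((V * (adj A * B)) e))) \<le> (\<Sum>e\<in>F. norm (D e) * norm (B e))"
    proof (rule sum_mono)
      fix e
      have "cinner e ((V * (adj A * B)) e) = cinner (D e) (B e)"
        by (simp add: D_def cinner_adj)
      then show "cmod (cinner e ((V * (adj A * B)) e)) \<le> norm (D e) * norm (B e)"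
        by (simp add: cmod_cinner_le)
    qed
    also have "\<dots> \<le> L2_set (\<lambda>e. norm (D e)) F * L2_set (\<lambda>e. norm (B e)) F"
      using L2_set_mult_ineq [of "\<lambda>e. norm (D e)" "\<lambda>e. norm (B e)" F] by simp
    also have "\<dots> \<le> norm (Hs D) * norm (Hs B)"
    proof (rule mult_mono)
      have "L2_set (\<lambda>e. norm (X e)) F \<le> norm (Hs X)" if "hilbert_schmidt X" for X
      proof -
        have "(\<Sum>e\<in>F. (norm (X e))\<^sup>2) \<le> (norm (Hs X))\<^sup>2"
          using norm_hs_has_sum [of "Hs X"] that F by (intro finite_sum_le_has_sum) (auto simp: Hs_inverse)
        then show ?thesis unfolding L2_set_def by (intro real_le_lsqrt) auto
      qed
      then show "L2_set (\<lambda>e. norm (D e)) F \<le> norm (Hs D)" "L2_set (\<lambda>e. norm (B e)) F \<le> norm (Hs B)"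
        using D B by auto
    qed (auto simp: L2_set_nonneg)
    also have "\<dots> \<le> norm (Hs A) * norm (Hs B)" using D by (intro mult_right_mono) auto
    finally show ?thesis .
  qed
  show "trace_class (adj A * B)" "trace_norm (adj A * B) \<le> norm (Hs A) * norm (Hs B)"
    using trace_class_criterion [OF some_onb, of "adj A * B"] * by blast+
qed

text \<open>One half of the C*-identity. It turns control of U times |T| into control of U times the
  square root of |T|, at the price of a square root in the rate.\<close>

lemma norm_mult_adj: "(norm X)\<^sup>2 \<le> norm (X * adj X)" for X :: "'a::chilbert_space bop"
proof -
  have "norm (adj X) \<le> sqrt (norm (X * adj X))"
  proof (rule norm_bop_bound)
    fix y
    have "(norm (adj X y))\<^sup>2 = cmod (cinner y ((X * adj X) y))"
      unfolding bop_simps(7) cinner_adj(2) [of X y "adj X y", symmetric] cinner_self by (simp add: norm_power)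
    also have "\<dots> \<le> norm y * norm ((X * adj X) y)" by (rule cmod_cinner_le)
    also have "\<dots> \<le> norm y * (norm (X * adj X) * norm y)" by (intro mult_left_mono norm_bop) auto
    also have "\<dots> = (sqrt (norm (X * adj X)) * norm y)\<^sup>2" by (simp add: power_mult_distrib power2_eq_square)
    finally show "norm (adj X y) \<le> sqrt (norm (X * adj X)) * norm y" by (rule power2_le_imp_le) simp
  qed simp
  then have "(norm X)\<^sup>2 \<le> (sqrt (norm (X * adj X)))\<^sup>2" by (intro power_mono) auto
  then show ?thesis by simp
qed

text \<open>If \<open>W\<^sub>n \<bar>T\<bar>\<close> tends to \<open>T\<close> and \<open>Q\<close> is the square root of \<open>\<bar>T\<bar>\<close>, then \<open>W\<^sub>n Q\<close> is a Cauchy sequence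
  because \<open>\<parallel>X\<parallel>\<^sup>2 = \<parallel>X X\<^sup>*\<parallel>\<close>; so the exact polar decomposition is not needed.\<close>

lemma trace_class_factor:
  fixes T :: "'a::chilbert_space bop"
  assumes T: "trace_class T"
  obtains C D where "hilbert_schmidt C" "hilbert_schmidt D" "T = adj C * D"
    "(norm (Hs C))\<^sup>2 \<le> trace_norm T" "(norm (Hs D))\<^sup>2 \<le> trace_norm T"
proof -
  obtain Q where Q: "positive_op Q" "Q * Q = abs_op T"
    using positive_sqrt_exists [OF positive_abs_op] by blast
  have Qa: "adj Q = Q" using Q by (simp add: positive_op_iff)
  have Qh: "hilbert_schmidt Q" using T by (simp add: trace_class_sqrt [OF Q])
  have Qn: "(norm (Hs Q))\<^sup>2 = trace_norm T"
    using has_sum_unique [OF trace_norm_sqrt [OF Q T some_onb]] norm_hs_has_sum [of "Hs Q"] Qh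
    by (simp add: Hs_inverse)
  have "\<exists>W. norm W \<le> 1 \<and> norm (T - W * abs_op T) \<le> inverse (real (Suc n))" for n
    using approx_polar [of "inverse (real (Suc n))" T] by (metis inverse_positive_iff_positive of_nat_0_less_iff zero_less_Suc)
  then obtain W where W: "\<And>n. norm (W n) \<le> 1" "\<And>n. norm (T - W n * abs_op T) \<le> inverse (real (Suc n))"
    by metis
  define X where "X n = W n * Q" for n
  have XX: "(norm (X m - X n))\<^sup>2 \<le> 2 * (inverse (real (Suc m)) + inverse (real (Suc n)))" for m n
  proof -
    define U where "U = W m - W n"
    have U2: "norm U \<le> 2" using norm_triangle_ineq4 [of "W m" "W n"] W(1) [of m] W(1) [of n] by (simp add: U_def)
    have Ue: "X m - X n = U * Q" by (simp add: X_def U_def left_diff_distrib)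
    have "U * abs_op T = (T - W n * abs_op T) - (T - W m * abs_op T)" by (simp add: U_def left_diff_distrib)
    then have UT: "norm (U * abs_op T) \<le> inverse (real (Suc m)) + inverse (real (Suc n))"
      using norm_triangle_ineq4 [of "T - W n * abs_op T" "T - W m * abs_op T"] W(2) [of n] W(2) [of m] by simp
    have "(norm (U * Q))\<^sup>2 \<le> norm (U * Q * adj (U * Q))" by (rule norm_mult_adj)
    also have "U * Q * adj (U * Q) = (U * abs_op T) * adj U"
      by (simp add: adj_mult Qa mult.assoc flip: Q(2))
    also have "norm \<dots> \<le> norm (U * abs_op T) * 2"
      using U2 by (intro order_trans [OF norm_mult_ineq] mult_left_mono) auto
    finally show ?thesis using UT by (simp add: Ue)
  qed
  have "Cauchy X"
  proof (rule CauchyI)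
    fix e :: real assume e: "e > 0"
    obtain N where N: "inverse (real (Suc N)) < e\<^sup>2 / 4"
      using reals_Archimedean [of "e\<^sup>2 / 4"] e by auto
    have "norm (X m - X n) < e" if "m \<ge> N" "n \<ge> N" for m n
    proof -
      have "inverse (real (Suc m)) \<le> inverse (real (Suc N))" "inverse (real (Suc n)) \<le> inverse (real (Suc N))"
        using that by (auto intro!: le_imp_inverse_le)
      moreover have "2 * (a + b) < d" if "a \<le> c" "b \<le> c" "c < d / 4" for a b c d :: real
        using that by simp
      ultimately have "(norm (X m - X n))\<^sup>2 < e\<^sup>2" using N XX [of m n] by (meson le_less_trans)
      then show ?thesis by (rule power2_less_imp_less) (use e in simp)
    qed
    then show "\<exists>M. \<forall>m\<ge>M. \<forall>n\<ge>M. norm (X m - X n) < e" by blast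
  qed
  then obtain C where C: "X \<longlonglongrightarrow> C" using Cauchy_convergent convergent_def by blast
  have "(\<lambda>n. T - X n * Q) \<longlonglongrightarrow> 0"
  proof (rule Lim_null_comparison)
    show "\<forall>\<^sub>F n in sequentially. norm (T - X n * Q) \<le> inverse (real (Suc n))"
      using W(2) by (simp add: X_def mult.assoc Q(2))
  qed (rule LIMSEQ_inverse_real_of_nat)
  moreover have "(\<lambda>n. T - X n * Q) \<longlonglongrightarrow> T - C * Q" by (intro tendsto_intros C)
  ultimately have TCQ: "T = C * Q" using LIMSEQ_unique by fastforce
  have Cx: "norm (C x) \<le> norm (Q x)" for x
  proof (rule LIMSEQ_le_const2 [OF tendsto_norm [OF tendsto_bop_apply [OF C]]])
    have "norm (X n x) \<le> norm (Q x)" for n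
      using norm_bop [of "W n" "Q x"] mult_right_mono [OF W(1) [of n], of "norm (Q x)"] by (simp add: X_def)
    then show "\<exists>N. \<forall>n\<ge>N. norm (X n x) \<le> norm (Q x)" by blast
  qed
  have "of_hs (Hs Q) = Q" using Qh by (simp add: Hs_inverse)
  note hQ = norm_hs_has_sum [of "Hs Q", unfolded this Qn]
  have Ch: "hilbert_schmidt C"
    unfolding hilbert_schmidt_iff [OF some_onb]
    by (rule summable_on_comparison_test [OF has_sum_imp_summable [OF hQ]]) (use Cx in auto)
  have Cn: "(norm (Hs C))\<^sup>2 \<le> trace_norm T"
    using norm_hs_has_sum [of "Hs C"] Ch Cx by (intro has_sum_mono [OF _ hQ]) (auto simp: Hs_inverse)
  show ?thesis
    by (rule that [of "adj C" Q]) (use Ch Cn Qh Qn TCQ hs_adj [OF Ch] in auto)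
qed


section \<open>Trace, rank-one operators and duality\<close>

lemma norm_mult_le_square:
  fixes c d t :: real
  assumes "c\<^sup>2 \<le> t" "d\<^sup>2 \<le> t"
  shows "c * d \<le> t"
  using assms sum_squares_bound [of c d] by simp

text \<open>Everything is pushed to the factors of T = adj C * D. The operator A is absorbed into C,
  and cyclicity for Hilbert-Schmidt pairs is used twice: once to bring D to the front, once to put
  adj C back in front of D with A now attached on the right.\<close>

lemma trace_class_mult_left:
  fixes A T :: "'a::chilbert_space bop"
  assumes "trace_class T"
  shows "trace_class (A * T)" "trace_norm (A * T) \<le> norm A * trace_norm T"
    "op_trace (A * T) = op_trace (T * A)"
proof -
  obtain C D where CD: "hilbert_schmidt C" "hilbert_schmidt D" "T = adj C * D"
    "(norm (Hs C))\<^sup>2 \<le> trace_norm T" "(norm (Hs D))\<^sup>2 \<le> trace_norm T"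
    using trace_class_factor [OF assms] .
  have eq: "A * T = adj (C * adj A) * D" by (simp add: CD adj_mult mult.assoc)
  have CA: "hilbert_schmidt (C * adj A)" "norm (Hs (C * adj A)) \<le> norm (Hs C) * norm A"
    using hs_mult_right [OF CD(1), of "adj A"] by simp_all
  show "trace_class (A * T)" unfolding eq by (rule trace_class_hs_mult [OF CA(1) CD(2)])
  have "trace_norm (A * T) \<le> norm (Hs (C * adj A)) * norm (Hs D)"
    unfolding eq by (rule trace_class_hs_mult [OF CA(1) CD(2)])
  also have "\<dots> \<le> (norm (Hs C) * norm A) * norm (Hs D)" using CA by (intro mult_right_mono) auto
  also have "\<dots> = norm A * (norm (Hs C) * norm (Hs D))" by simp
  also have "\<dots> \<le> norm A * trace_norm T" using CD by (intro mult_left_mono norm_mult_le_square) auto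
  finally show "trace_norm (A * T) \<le> norm A * trace_norm T" .
  have "op_trace (A * T) = op_trace (D * adj (C * adj A))"
    unfolding eq by (rule hs_trace_cyclic [OF CA(1) CD(2)])
  also have "\<dots> = op_trace (adj (adj (D * A)) * adj C)" by (simp add: adj_mult mult.assoc)
  also have "\<dots> = op_trace (adj C * adj (adj (D * A)))"
    by (rule hs_trace_cyclic) (intro hs_adj hs_mult_right CD)+
  also have "\<dots> = op_trace (T * A)" by (simp add: CD mult.assoc)
  finally show "op_trace (A * T) = op_trace (T * A)" .
qed

lemma trace_class_adj:
  fixes T :: "'a::chilbert_space bop"
  assumes "trace_class T"
  shows "trace_class (adj T)" "trace_norm (adj T) \<le> trace_norm T"
proof -
  obtain C D where CD: "hilbert_schmidt C" "hilbert_schmidt D" "T = adj C * D"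
    "(norm (Hs C))\<^sup>2 \<le> trace_norm T" "(norm (Hs D))\<^sup>2 \<le> trace_norm T"
    using trace_class_factor [OF assms] .
  have eq: "adj T = adj D * C" by (simp add: CD adj_mult)
  show "trace_class (adj T)" unfolding eq by (rule trace_class_hs_mult [OF CD(2,1)])
  have "trace_norm (adj T) \<le> norm (Hs D) * norm (Hs C)"
    unfolding eq by (rule trace_class_hs_mult [OF CD(2,1)])
  also have "\<dots> \<le> trace_norm T" using CD by (intro norm_mult_le_square)
  finally show "trace_norm (adj T) \<le> trace_norm T" .
qed

lemma trace_class_mult_right:
  fixes A T :: "'a::chilbert_space bop"
  assumes "trace_class T"
  shows "trace_class (T * A)" "trace_norm (T * A) \<le> norm A * trace_norm T"
proof -
  have eq: "T * A = adj (adj A * adj T)" by (simp add: adj_mult)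
  note * = trace_class_mult_left [OF trace_class_adj(1) [OF assms], of "adj A"]
  show "trace_class (T * A)" unfolding eq by (rule trace_class_adj [OF *(1)])
  have "trace_norm (T * A) \<le> trace_norm (adj A * adj T)" unfolding eq by (rule trace_class_adj [OF *(1)])
  also have "\<dots> \<le> norm A * trace_norm (adj T)" using *(2) by simp
  also have "\<dots> \<le> norm A * trace_norm T" using trace_class_adj [OF assms] by (intro mult_left_mono) auto
  finally show "trace_norm (T * A) \<le> norm A * trace_norm T" .
qed

lemma trace_class_trace:
  fixes T :: "'a::chilbert_space bop"
  assumes "trace_class T"
  shows "((\<lambda>e. cinner e (T e)) has_sum op_trace T) some_onb" "cmod (op_trace T) \<le> trace_norm T"
    "hilbert_schmidt T" "norm (Hs T) \<le> trace_norm T"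
proof -
  obtain C D where CD: "hilbert_schmidt C" "hilbert_schmidt D" "T = adj C * D"
    "(norm (Hs C))\<^sup>2 \<le> trace_norm T" "(norm (Hs D))\<^sup>2 \<le> trace_norm T"
    using trace_class_factor [OF assms] .
  show "((\<lambda>e. cinner e (T e)) has_sum op_trace T) some_onb"
    using hs_trace_has_sum [OF CD(1,2)] by (simp add: CD(3) cinner_adj)
  have "op_trace T = cinner (Hs C) (Hs D)" using CD by (simp add: cinner_Hs)
  then have "cmod (op_trace T) \<le> norm (Hs C) * norm (Hs D)" by (simp add: cmod_cinner_le)
  also have "\<dots> \<le> trace_norm T" using CD by (intro norm_mult_le_square)
  finally show "cmod (op_trace T) \<le> trace_norm T" .
  show "hilbert_schmidt T" unfolding CD(3) by (rule hs_mult_left [OF CD(2)])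
  have "norm (Hs T) \<le> norm (adj C) * norm (Hs D)" unfolding CD(3) by (rule hs_mult_left [OF CD(2)])
  also have "\<dots> \<le> norm (Hs C) * norm (Hs D)"
    using norm_of_hs_le [of "Hs C"] CD(1) by (intro mult_right_mono) (auto simp: Hs_inverse)
  also have "\<dots> \<le> trace_norm T" using CD by (intro norm_mult_le_square)
  finally show "norm (Hs T) \<le> trace_norm T" .
qed

section \<open>Multiplication, adjoint and trace as bounded maps on the trace class\<close>

lift_definition tc_lmult :: "'a::chilbert_space bop \<Rightarrow> 'a tc \<Rightarrow> 'a tc" is "\<lambda>(A :: 'a bop) T. A * T"
  by (rule trace_class_mult_left)

lift_definition tc_rmult :: "'a::chilbert_space tc \<Rightarrow> 'a bop \<Rightarrow> 'a tc" is "\<lambda>(T :: 'a bop) A. T * A"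
  by (rule trace_class_mult_right)

lift_definition tc_adj :: "'a::chilbert_space tc \<Rightarrow> 'a tc" is adj
  by (rule trace_class_adj)

lift_definition tc_trace :: "'a::chilbert_space tc \<Rightarrow> complex" is op_trace .

lift_definition hs_of_tc :: "'a::chilbert_space tc \<Rightarrow> 'a hs" is "\<lambda>T. T"
  by (rule trace_class_trace)

lemma norm_tc_lmult: "norm (tc_lmult A T) \<le> norm A * norm T"
  by transfer (rule trace_class_mult_left)

lemma norm_tc_rmult: "norm (tc_rmult T A) \<le> norm A * norm T"
  by transfer (rule trace_class_mult_right)

lemma norm_tc_adj [simp]: "norm (tc_adj T) = norm T"
proof -
  have "norm (tc_adj T) \<le> norm T" for T :: "'a tc" by transfer (rule trace_class_adj)
  from this [of T] this [of "tc_adj T"] show ?thesis by (simp add: tc_adj_def of_tc_inverse Tc_inverse trace_class_adj(1) of_tc [simplified])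
qed

lemma norm_tc_trace: "cmod (tc_trace T) \<le> norm T"
  by transfer (rule trace_class_trace)

lemma norm_hs_of_tc: "norm (hs_of_tc T) \<le> norm T"
proof -
  have "hs_of_tc T = Hs (of_tc T)" by (metis hs_of_tc.rep_eq of_hs_inverse)
  then show ?thesis using trace_class_trace(4) [of "of_tc T"] of_tc [of T] by (simp add: norm_tc.rep_eq)
qed

lemma norm_of_tc_le: "norm (of_tc T) \<le> norm T"
  by transfer (rule norm_le_trace_norm)

lemma tc_trace_cyclic: "tc_trace (tc_lmult A T) = tc_trace (tc_rmult T A)"
  by transfer (rule trace_class_mult_left)

lemma tc_trace_adj: "tc_trace (tc_adj T) = cnj (tc_trace T)"
proof transfer
  fix T :: "'a bop" assume T: "trace_class T"
  have "((\<lambda>e. cnj (cinner e (T e))) has_sum cnj (op_trace T)) some_onb"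
    using trace_class_trace(1) [OF T] by simp
  moreover have "cnj (cinner e (T e)) = cinner e (adj T e)" for e
    by (metis cinner_adj(1) cinner_commute)
  ultimately show "op_trace (adj T) = cnj (op_trace T)"
    using has_sum_unique [OF trace_class_trace(1) [OF trace_class_adj(1) [OF T]]] by simp
qed

lemma tc_trace_add: "tc_trace (S + T) = tc_trace S + tc_trace T"
proof transfer
  fix S T :: "'a bop" assume T: "trace_class S" "trace_class T"
  show "op_trace (S + T) = op_trace S + op_trace T"
    using has_sum_add [OF T [THEN trace_class_trace(1)]]
      has_sum_unique [OF trace_class_trace(1) [OF trace_class_add(1) [OF T]]]
    by (simp add: cinner_add_right)
qed

lemma tc_trace_scaleC: "tc_trace (c *\<^sub>C T) = c * tc_trace T"
proof transfer
  fix T :: "'a bop" and c assume T: "trace_class T"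
  show "op_trace (c *\<^sub>C T) = c * op_trace T"
    using has_sum_cmult_right [OF T [THEN trace_class_trace(1)]]
      has_sum_unique [OF trace_class_trace(1) [OF trace_class_scaleC(1) [OF T]]]
    by (simp add: cinner_scaleC_right)
qed

lemma bounded_clinearI:
  assumes "\<And>x y. f (x + y) = f x + f y" "\<And>c x. f (c *\<^sub>C x) = c *\<^sub>C f x" "\<And>x. norm (f x) \<le> K * norm x"
  shows "bounded_clinear f"
  unfolding bounded_clinear_def using assms
  by (auto intro!: bounded_linear_intro [where K = K] simp: scaleR_scaleC mult.commute)

lemma bounded_linear_tc_lmult: "bounded_linear (tc_lmult A)"
proof (rule bounded_linear_intro)
  show "norm (tc_lmult A T) \<le> norm T * norm A" for T
    using norm_tc_lmult [of A T] by (simp add: mult.commute)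
qed (transfer; simp add: distrib_left)+

lemma bounded_linear_tc_rmult: "bounded_linear (\<lambda>T. tc_rmult T A)"
proof (rule bounded_linear_intro)
  show "norm (tc_rmult T A) \<le> norm T * norm A" for T
    using norm_tc_rmult [of T A] by (simp add: mult.commute)
qed (transfer; simp add: distrib_right)+

lemma bounded_linear_tc_adj: "bounded_linear tc_adj"
proof (rule bounded_linear_intro)
  show "norm (tc_adj T) \<le> norm T * 1" for T :: "'a tc" by simp
qed (transfer; simp add: adj_add adj_scaleR)+

lemma bounded_linear_hs_of_tc: "bounded_linear hs_of_tc"
proof (rule bounded_linear_intro)
  show "norm (hs_of_tc T) \<le> norm T * 1" for T :: "'a tc" using norm_hs_of_tc by simp
qed (transfer; simp)+

lemma bounded_linear_tc_trace: "bounded_linear tc_trace"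
proof (rule bounded_linear_intro)
  show "cmod (tc_trace T) \<le> norm T * 1" for T :: "'a tc" using norm_tc_trace by simp
  show "tc_trace (r *\<^sub>R T) = r *\<^sub>R tc_trace T" for r and T :: "'a tc"
    by (simp add: scaleR_scaleC tc_trace_scaleC scaleR_conv_of_real)
qed (rule tc_trace_add)

lemma bounded_linear_of_tc_apply: "bounded_linear (\<lambda>T. of_tc T x)"
proof (rule bounded_linear_intro [where K = "norm x"])
  show "norm (of_tc T x) \<le> norm T * norm x" for T :: "'a tc"
    by (rule order_trans [OF norm_bop mult_right_mono [OF norm_of_tc_le]]) simp
qed (simp_all add: plus_tc.rep_eq scaleR_tc.rep_eq)

section \<open>Rank-one operators and their density\<close>

lift_definition rank_one :: "'a::complex_inner \<Rightarrow> 'a \<Rightarrow> 'a bop" is "\<lambda>x v z. cinner v z *\<^sub>C x"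
proof (rule bounded_clinearI)
  fix x v z :: 'a
  show "norm (cinner v z *\<^sub>C x) \<le> (norm v * norm x) * norm z"
    using mult_right_mono [OF cmod_cinner_le [of v z], of "norm x"] by (simp add: norm_scaleC mult_ac)
qed (simp_all add: cinner_add_right cinner_scaleC_right scaleC_add_left scaleC_scaleC)

lemma rank_one_apply [simp]: "rank_one x v z = cinner v z *\<^sub>C x"
  by transfer simp

lemma trace_class_rank_one:
  fixes x v :: "'a::chilbert_space"
  shows "trace_class (rank_one x v)" "trace_norm (rank_one x v) \<le> norm x * norm v"
proof -
  have *: "(\<Sum>e\<in>F. cmod (cinner e ((V * rank_one x v) e))) \<le> norm x * norm v"
    if V: "norm V \<le> 1" and F: "finite F" "F \<subseteq> some_onb" for V F
  proof -
    have L: "L2_set (\<lambda>e. cmod (cinner e y)) F \<le> norm y" for y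
      unfolding L2_set_def using F
      by (intro real_le_lsqrt finite_sum_le_has_sum [OF parseval [OF some_onb]]) auto
    have "(\<Sum>e\<in>F. cmod (cinner e ((V * rank_one x v) e))) = (\<Sum>e\<in>F. cmod (cinner e v) * cmod (cinner e (V x)))"
      by (intro sum.cong refl, simp add: bop_linear cinner_scaleC_right norm_mult) (metis cinner_commute complex_mod_cnj)
    also have "\<dots> \<le> L2_set (\<lambda>e. cmod (cinner e v)) F * L2_set (\<lambda>e. cmod (cinner e (V x))) F"
      using L2_set_mult_ineq [of "\<lambda>e. cmod (cinner e v)" "\<lambda>e. cmod (cinner e (V x))" F] by simp
    also have "\<dots> \<le> norm v * norm (V x)" by (intro mult_mono L) (auto simp: L2_set_nonneg)
    also have "\<dots> \<le> norm v * norm x"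
      using norm_bop [of V x] mult_right_mono [OF V, of "norm x"] by (intro mult_left_mono) auto
    finally show ?thesis by (simp add: mult.commute)
  qed
  show "trace_class (rank_one x v)" "trace_norm (rank_one x v) \<le> norm x * norm v"
    using trace_class_criterion [OF some_onb, of "rank_one x v"] * by blast+
qed

lift_definition tc_rank_one :: "'a::chilbert_space \<Rightarrow> 'a \<Rightarrow> 'a tc" is rank_one
  by (rule trace_class_rank_one)

lemma norm_tc_rank_one: "norm (tc_rank_one x v) \<le> norm x * norm v"
  by transfer (rule trace_class_rank_one)

lemma tc_trace_rank_one [simp]: "tc_trace (tc_rank_one x v) = cinner v x"
proof transfer
  fix x v :: 'a
  have "((\<lambda>e. cinner e x * cinner v e) has_sum cinner v x) some_onb"
    by (rule onb_has_sum_linear [OF some_onb bounded_linear_cinner_right cinner_scaleC_right])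
  then show "op_trace (rank_one x v) = cinner v x"
    unfolding trace_some_onb by (intro infsumI) (simp add: cinner_scaleC_right mult.commute)
qed

lemma tc_lmult_rank_one [simp]: "tc_lmult A (tc_rank_one x v) = tc_rank_one (A x) v"
  by transfer (rule bop_eqI, simp add: bop_linear)

lemma tc_rmult_rank_one [simp]: "tc_rmult (tc_rank_one x v) A = tc_rank_one x (adj A v)"
  by transfer (rule bop_eqI, simp add: cinner_adj)

lemma tc_adj_rank_one [simp]: "tc_adj (tc_rank_one x v) = tc_rank_one v x"
  by transfer (rule bop_cinner_eqI, simp add: cinner_scaleC_left cinner_scaleC_right mult.commute flip: cinner_adj(1) cinner_commute)

lemma tc_rank_one_add: "tc_rank_one (x + y) v = tc_rank_one x v + tc_rank_one y v"
    "tc_rank_one x (v + w) = tc_rank_one x v + tc_rank_one x w"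
  by (transfer; rule bop_eqI; simp add: scaleC_add_right scaleC_add_left cinner_add_left)+

lemma tc_rank_one_scaleC: "tc_rank_one (c *\<^sub>C x) v = c *\<^sub>C tc_rank_one x v"
    "tc_rank_one x (c *\<^sub>C v) = cnj c *\<^sub>C tc_rank_one x v"
  by (transfer; rule bop_eqI; simp add: scaleC_scaleC cinner_scaleC_left mult.commute)+

text \<open>With T = adj C * D, inserting the resolution of the identity between the factors gives
  the sum of the operators |adj C e><adj D e|. Cauchy-Schwarz bounds the sum of the norms by the
  trace norm of T with no extra constant, which later yields the norm bound in
  \<open>tc_kernel\<close>.\<close>

lemma tc_expansion:
  fixes T :: "'a::chilbert_space tc"
  obtains a b :: "'a \<Rightarrow> 'a" where "(\<lambda>e. norm (a e) * norm (b e)) summable_on some_onb"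
    "infsum (\<lambda>e. norm (a e) * norm (b e)) some_onb \<le> norm T"
    "((\<lambda>e. tc_rank_one (a e) (b e)) has_sum T) some_onb"
proof -
  have T: "trace_class (of_tc T)" using of_tc by simp
  obtain C D where CD: "hilbert_schmidt C" "hilbert_schmidt D" "of_tc T = adj C * D"
    "(norm (Hs C))\<^sup>2 \<le> trace_norm (of_tc T)" "(norm (Hs D))\<^sup>2 \<le> trace_norm (of_tc T)"
    using trace_class_factor [OF T] .
  define a b where "a = bop_apply (adj C)" and "b = bop_apply (adj D)"
  have L: "L2_set (\<lambda>e. norm (adj X e)) F \<le> norm (Hs X)"
    if X: "hilbert_schmidt X" and F: "finite F" "F \<subseteq> some_onb" for X :: "'a bop" and F
  proof -
    have "(\<Sum>e\<in>F. (norm (adj X e))\<^sup>2) \<le> (norm (Hs (adj X)))\<^sup>2"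
      using norm_hs_has_sum [of "Hs (adj X)"] hs_adj(1) [OF X] F by (intro finite_sum_le_has_sum) (auto simp: Hs_inverse)
    then show ?thesis unfolding L2_set_def hs_adj(2) [OF X] by (intro real_le_lsqrt) auto
  qed
  have fin: "(\<Sum>e\<in>F. norm (a e) * norm (b e)) \<le> norm T" if F: "finite F" "F \<subseteq> some_onb" for F
  proof -
    have "(\<Sum>e\<in>F. norm (a e) * norm (b e)) \<le> L2_set (\<lambda>e. norm (a e)) F * L2_set (\<lambda>e. norm (b e)) F"
      using L2_set_mult_ineq [of "\<lambda>e. norm (a e)" "\<lambda>e. norm (b e)" F] by simp
    also have "\<dots> \<le> norm (Hs C) * norm (Hs D)"
      unfolding a_def b_def using CD(1,2) F by (intro mult_mono L) (auto simp: L2_set_nonneg)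
    also have "\<dots> \<le> norm T" using CD by (intro norm_mult_le_square) (auto simp: norm_tc.rep_eq)
    finally show ?thesis .
  qed
  have s: "(\<lambda>e. norm (a e) * norm (b e)) summable_on some_onb"
    by (rule nonneg_bdd_above_summable_on) (auto intro!: bdd_aboveI2 fin)
  have "(\<lambda>e. tc_rank_one (a e) (b e)) abs_summable_on some_onb"
    by (rule summable_on_comparison_test [OF s]) (auto intro: norm_tc_rank_one)
  then have S: "((\<lambda>e. tc_rank_one (a e) (b e)) has_sum infsum (\<lambda>e. tc_rank_one (a e) (b e)) some_onb) some_onb"
    by (rule has_sum_infsum [OF abs_summable_summable])
  \<comment> \<open>The series converges absolutely in trace norm to some operator; since evaluation
    at a vector is continuous, its limit can be identified vector by vector.\<close>
  have "of_tc (infsum (\<lambda>e. tc_rank_one (a e) (b e)) some_onb) z = of_tc T z" for z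
  proof (rule has_sum_unique)
    show "((\<lambda>e. cinner e (D z) *\<^sub>C adj C e) has_sum of_tc (infsum (\<lambda>e. tc_rank_one (a e) (b e)) some_onb) z) some_onb"
      using has_sum_bounded_linear [OF bounded_linear_of_tc_apply S, of z]
      by (simp add: tc_rank_one.rep_eq a_def b_def cinner_adj)
    show "((\<lambda>e. cinner e (D z) *\<^sub>C adj C e) has_sum of_tc T z) some_onb"
      using has_sum_bounded_linear [OF bounded_linear_bop_apply [of "adj C"] onb_expand [OF some_onb, of "D z"]]
      by (simp add: CD(3) bop_linear)
  qed
  then have "infsum (\<lambda>e. tc_rank_one (a e) (b e)) some_onb = T"
    by (simp add: of_tc_inject [symmetric] bop_eqI)
  with S have S': "((\<lambda>e. tc_rank_one (a e) (b e)) has_sum T) some_onb" by simp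
  have "infsum (\<lambda>e. norm (a e) * norm (b e)) some_onb \<le> norm T"
    by (rule infsum_le_finite_sums [OF s]) (rule fin)
  from that [OF s this S'] show ?thesis .
qed

text \<open>Density of the finite-rank operators in the shape of an induction rule. The sums are
  indexed by vectors because the expansion runs over an orthonormal basis.\<close>

lemma tc_closed_induct:
  fixes T :: "'a::chilbert_space tc"
  assumes "closed {T. P T}"
    and P: "\<And>F (a :: 'a \<Rightarrow> 'a) b. finite F \<Longrightarrow> P (\<Sum>e\<in>F. tc_rank_one (a e) (b e))"
  shows "P T"
proof -
  obtain a b :: "'a \<Rightarrow> 'a" where "((\<lambda>e. tc_rank_one (a e) (b e)) has_sum T) some_onb"
    by (rule tc_expansion [of T])
  then have "(sum (\<lambda>e. tc_rank_one (a e) (b e)) \<longlongrightarrow> T) (finite_subsets_at_top some_onb)"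
    by (simp add: has_sum_def)
  then have "T \<in> {T. P T}"
    by (rule Lim_in_closed_set [OF assms(1), rotated 2])
      (auto intro!: P eventually_finite_subsets_at_top_weakI)
  then show ?thesis by simp
qed

lemma tc_bounded_linear_eqI:
  fixes f g :: "'a::chilbert_space tc \<Rightarrow> 'b::real_normed_vector"
  assumes f: "bounded_linear f" and g: "bounded_linear g"
    and "\<And>x v. f (tc_rank_one x v) = g (tc_rank_one x v)"
  shows "f T = g T"
proof (rule tc_closed_induct [of "\<lambda>T. f T = g T"])
  show "closed {T. f T = g T}"
    by (intro closed_Collect_eq bounded_linear.continuous_on [OF f] bounded_linear.continuous_on [OF g] continuous_on_id)
qed (simp add: assms linear_sum bounded_linear.linear)

section \<open>Duality between the trace class and the bounded operators\<close>

lemma riesz_representation: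
  fixes f :: "'a::chilbert_space \<Rightarrow> complex"
  assumes f: "bounded_linear f" and fc: "\<And>c x. f (c *\<^sub>C x) = c * f x"
  obtains z where "\<And>x. f x = cinner z x"
proof (cases "\<exists>u::'a. norm u = 1")
  case True
  then obtain u :: 'a where u: "norm u = 1" by blast
  \<comment> \<open>Riesz from adjoints: for a unit vector u the map x \<mapsto> f(x) u is a bounded
    operator, and its adjoint sends u to the representing vector. The zero space has no unit vector
    and is treated apart.\<close>
  have "bounded_clinear (\<lambda>x. f x *\<^sub>C u)"
  proof (rule bounded_clinearI)
    show "norm (f x *\<^sub>C u) \<le> onorm f * norm x" for x using onorm [OF f] u by (simp add: norm_scaleC)
  qed (simp_all add: linear_simps [OF f] fc scaleC_add_left scaleC_scaleC)
  then have A: "Bop (\<lambda>x. f x *\<^sub>C u) x = f x *\<^sub>C u" for x by (simp add: Bop_inverse)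
  have "cinner (adj (Bop (\<lambda>x. f x *\<^sub>C u)) u) x = f x" for x
    unfolding cinner_adj(2) A by (simp add: cinner_scaleC_right cinner_self u)
  then show ?thesis using that by metis
next
  case False
  have "x = 0" for x :: 'a
  proof (rule ccontr)
    assume "x \<noteq> 0" then have "norm ((1 / norm x) *\<^sub>R x) = 1" by simp
    with False show False by blast
  qed
  then have "f x = cinner 0 x" for x using linear_simps(3) [OF f] by (metis cinner_zero_left)
  then show ?thesis using that by blast
qed

lemma bounded_sesquilinear_representation:
  fixes \<beta> :: "'a::chilbert_space \<Rightarrow> 'a \<Rightarrow> complex"
  assumes add: "\<And>v x y. \<beta> v (x + y) = \<beta> v x + \<beta> v y" "\<And>v w x. \<beta> (v + w) x = \<beta> v x + \<beta> w x"
    and sc: "\<And>c v x. \<beta> v (c *\<^sub>C x) = c * \<beta> v x" "\<And>c v x. \<beta> (c *\<^sub>C v) x = cnj c * \<beta> v x"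
    and K: "\<And>v x. cmod (\<beta> v x) \<le> K * norm v * norm x"
  obtains A where "\<And>v x. cinner v (bop_apply A x) = \<beta> v x" "norm A \<le> max 0 K"
proof -
  have "\<exists>z. \<forall>v. cnj (\<beta> v x) = cinner z v" for x
  proof -
    have "bounded_linear (\<lambda>v. cnj (\<beta> v x))"
      by (rule bounded_linear_intro [where K = "K * norm x"])
        (use K in \<open>auto simp: add sc scaleR_scaleC scaleR_conv_of_real mult_ac\<close>)
    then show ?thesis by (rule riesz_representation [of "\<lambda>v. cnj (\<beta> v x)"]) (auto simp: sc)
  qed
  then obtain z where "\<And>x v. cnj (\<beta> v x) = cinner (z x) v" by metis
  then have z: "cinner v (z x) = \<beta> v x" for x v by (metis cinner_commute complex_cnj_cnj)
  have zn: "norm (z x) \<le> K * norm x" for x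
  proof (cases "z x = 0")
    case True
    show ?thesis
    proof (cases "x = 0")
      case False
      have "0 \<le> K * norm x * norm x" using order_trans [OF norm_ge_zero K [of x x]] .
      then have "0 \<le> K * norm x" using False by (simp add: zero_le_mult_iff)
      then show ?thesis using True by simp
    qed (use True in simp)
  next
    case False
    have "norm (z x) * norm (z x) = cmod (\<beta> (z x) x)"
      unfolding z [symmetric] cinner_self by (simp add: norm_mult power2_eq_square)
    also have "\<dots> \<le> norm (z x) * (K * norm x)" using K [of "z x" x] by (simp add: mult_ac)
    finally show ?thesis using False by simp
  qed
  have "bounded_clinear z"
  proof (rule bounded_clinearI [OF _ _ zn])
    show "z (x + y) = z x + z y" for x y by (rule cinner_ext) (simp add: z add cinner_add_right)
    show "z (c *\<^sub>C x) = c *\<^sub>C z x" for c x by (rule cinner_ext) (simp add: z sc cinner_scaleC_right)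
  qed
  then have Bz: "bop_apply (Bop z) = z" by (simp add: Bop_inverse)
  show ?thesis
  proof (rule that [of "Bop z"])
    \<comment> \<open>On the zero space even a negative \<open>K\<close> satisfies the assumed
      bound, hence the maximum.\<close>
    show "norm (Bop z) \<le> max 0 K"
    proof (rule norm_bop_bound)
      show "norm (Bop z x) \<le> max 0 K * norm x" for x
        unfolding Bz by (rule order_trans [OF zn mult_right_mono]) auto
    qed simp
  qed (simp add: Bz z)
qed

text \<open>A bounded functional is determined by its values on rank-one operators; these make up a
  bounded sesquilinear form, which comes from a bounded operator. Both \<open>dual_map\<close> and
  the operator K of a generator are obtained in this way.\<close>

lemma tc_dual_representation:
  fixes f :: "'a::chilbert_space tc \<Rightarrow> complex"
  assumes f: "bounded_linear f" and fc: "\<And>c x. f (c *\<^sub>C x) = c * f x" and K: "\<And>T. cmod (f T) \<le> K * norm T" "0 \<le> K"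
  obtains A where "\<And>T. f T = tc_trace (tc_lmult A T)" "norm A \<le> K"
proof -
  obtain A where A: "\<And>v x. cinner v (bop_apply A x) = f (tc_rank_one x v)" "norm A \<le> max 0 K"
  proof (rule bounded_sesquilinear_representation [of "\<lambda>v x. f (tc_rank_one x v)" K])
    show "cmod (f (tc_rank_one x v)) \<le> K * norm v * norm x" for v x
      using K(1) [of "tc_rank_one x v"] mult_left_mono [OF norm_tc_rank_one [of x v] K(2)] by (simp add: mult_ac)
  qed (auto simp: tc_rank_one_add tc_rank_one_scaleC linear_simps [OF f] fc)
  have "f T = tc_trace (tc_lmult A T)" for T
    by (rule tc_bounded_linear_eqI [OF f bounded_linear_compose [OF bounded_linear_tc_trace bounded_linear_tc_lmult]])
      (simp add: A)
  then show ?thesis using that A K by simp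
qed


section \<open>The sesquilinear form of a bounded map\<close>

lemma bounded_clinear_simps:
  assumes "bounded_clinear f"
  shows "f (x + y) = f x + f y" "f (x - y) = f x - f y" "f (c *\<^sub>C x) = c *\<^sub>C f x" "f 0 = 0"
    "f (r *\<^sub>R x) = r *\<^sub>R f x" "f (- x) = - f x"
  using assms by (simp_all add: bounded_clinear_def linear_simps)

lemma bounded_clinear_bounded_linear: "bounded_clinear f \<Longrightarrow> bounded_linear f"
  by (simp add: bounded_clinear_def)

lemma bounded_clinear_add:
  "bounded_clinear f \<Longrightarrow> bounded_clinear g \<Longrightarrow> bounded_clinear (\<lambda>x. f x + g x)"
  by (auto simp: bounded_clinear_def scaleC_add_right intro: bounded_linear_add)

lemma bounded_clinear_diff:
  "bounded_clinear f \<Longrightarrow> bounded_clinear g \<Longrightarrow> bounded_clinear (\<lambda>x. f x - g x)"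
  by (auto simp: bounded_clinear_def scaleC_diff_right intro: bounded_linear_sub)

lemma bounded_clinear_scaleR:
  "bounded_clinear f \<Longrightarrow> bounded_clinear (\<lambda>x. r *\<^sub>R f x)"
  by (auto simp: bounded_clinear_def scaleR_scaleC scaleC_scaleC mult.commute
      intro: bounded_linear_compose [OF bounded_linear_scaleC_right])

lemma bounded_clinear_id: "bounded_clinear (\<lambda>x. x)"
  by (simp add: bounded_clinear_def)

lemma bounded_clinear_tc_lmult: "bounded_clinear (tc_lmult A)"
  unfolding bounded_clinear_def by (intro conjI allI bounded_linear_tc_lmult) (transfer, rule bop_eqI, simp add: bop_linear)

lemma bounded_clinear_tc_rmult: "bounded_clinear (\<lambda>T. tc_rmult T A)"
  unfolding bounded_clinear_def by (intro conjI allI bounded_linear_tc_rmult) (transfer, rule bop_eqI, simp add: bop_linear)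

lemma tc_adj_scaleC: "tc_adj (c *\<^sub>C T) = cnj c *\<^sub>C tc_adj T"
  by transfer (rule adj_scaleC)

lemma tc_adj_tc_adj [simp]: "tc_adj (tc_adj T) = T"
  by transfer simp

lemma hs_of_tc_scaleC: "hs_of_tc (c *\<^sub>C T) = c *\<^sub>C hs_of_tc T"
  by transfer simp

section \<open>The trace-class operator behind the form\<close>

lemma infsum_norm_bound:
  fixes g :: "'i \<Rightarrow> 'b::banach"
  assumes s: "r summable_on I" "infsum r I \<le> n" and g: "\<And>i. norm (g i) \<le> c * r i" and c: "0 \<le> c"
  shows "g summable_on I" "norm (infsum g I) \<le> c * n"
proof -
  have sc: "(\<lambda>i. c * r i) summable_on I" by (rule summable_on_cmult_right [OF s(1)])
  have a: "g abs_summable_on I"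
    by (rule summable_on_comparison_test [OF sc]) (auto simp: g)
  then show "g summable_on I" by (rule abs_summable_summable)
  have "norm (infsum g I) \<le> infsum (\<lambda>i. norm (g i)) I" by (rule norm_infsum_bound [OF a])
  also have "\<dots> \<le> infsum (\<lambda>i. c * r i) I" by (rule infsum_mono [OF a sc g])
  also have "\<dots> = c * infsum r I" by (rule infsum_cmult_right) (use s in simp)
  also have "\<dots> \<le> c * n" using s c by (intro mult_left_mono)
  finally show "norm (infsum g I) \<le> c * n" .
qed

lemma norm_map_tc_rank_one:
  assumes "bounded_linear \<Psi>"
  shows "norm (\<Psi> (tc_rank_one x y)) \<le> onorm \<Psi> * (norm x * norm y)"
  using onorm [OF assms] mult_left_mono [OF norm_tc_rank_one onorm_pos_le [OF assms]]
  by (rule order_trans)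

lemma cinner_hs_of_tc_rank_one: "cinner (hs_of_tc (tc_rank_one v w)) X = cinner v (of_hs X w)"
proof -
  have "cinner (hs_of_tc (tc_rank_one v w)) X = op_trace (adj (rank_one v w) * of_hs X)"
    by transfer simp
  also have "adj (rank_one v w) * of_hs X = of_tc (tc_rank_one w (adj (of_hs X) v))"
    by (rule bop_cinner_eqI)
      (simp add: tc_rank_one.rep_eq cinner_scaleC_right cinner_scaleC_left cinner_adj flip: cinner_adj(1), metis cinner_commute)
  also have "op_trace \<dots> = tc_trace (tc_rank_one w (adj (of_hs X) v))" by (simp add: tc_trace.rep_eq)
  finally show ?thesis by (simp add: cinner_adj)
qed

text \<open>The product S X (adj T) is bracketed as the trace-class S times the bounded operator
  \<open>of_hs X * of_tc (tc_adj T)\<close>, so that it lies in the trace class by the ideal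
  property. That \<open>Bop\<close> and \<open>Tc\<close> are applied within their domains follows
  from \<open>tc_kernel_exists\<close>.\<close>

definition tc_kernel :: "('a::chilbert_space tc \<Rightarrow> 'a tc) \<Rightarrow> 'a tc \<Rightarrow> 'a tc \<Rightarrow> 'a hs tc" where
  "tc_kernel \<Psi> S T = Tc (Bop (\<lambda>X :: 'a hs. hs_of_tc (\<Psi> (tc_rmult S (of_hs X * of_tc (tc_adj T))))))"

lemma tc_kernel_exists:
  fixes \<Psi> :: "'a::chilbert_space tc \<Rightarrow> 'a tc"
  assumes \<Psi>: "bounded_clinear \<Psi>"
  shows "\<exists>\<Gamma> :: 'a hs tc. norm \<Gamma> \<le> onorm \<Psi> * norm S * norm T \<and>
    (\<forall>X. of_tc \<Gamma> X = hs_of_tc (\<Psi> (tc_rmult S (of_hs X * of_tc (tc_adj T)))))"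
proof -
  define K where "K = onorm \<Psi>"
  note \<Psi>b = bounded_clinear_bounded_linear [OF \<Psi>]
  have K: "0 \<le> K" by (simp add: K_def onorm_pos_le [OF \<Psi>b])
  have \<Psi>r: "norm (\<Psi> (tc_rank_one x y)) \<le> K * (norm x * norm y)" for x y
    unfolding K_def by (rule norm_map_tc_rank_one [OF \<Psi>b])
  \<comment> \<open>Here T is the rank-one operator |y><w|, whose adjoint is
    \<open>rank_one w y\<close>, and only S is expanded. A general T is expanded afterwards, so that
    each series runs over a single basis.\<close>
  have step1: "\<exists>\<Gamma> :: 'a hs tc. norm \<Gamma> \<le> K * norm S * (norm y * norm w) \<and>
    (\<forall>X. of_tc \<Gamma> X = hs_of_tc (\<Psi> (tc_rmult S (of_hs X * rank_one w y))))" for y w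
  proof -
    obtain a b :: "'a \<Rightarrow> 'a" where ab: "(\<lambda>e. norm (a e) * norm (b e)) summable_on some_onb"
      "infsum (\<lambda>e. norm (a e) * norm (b e)) some_onb \<le> norm S"
      "((\<lambda>e. tc_rank_one (a e) (b e)) has_sum S) some_onb"
      by (rule tc_expansion [of S])
    \<comment> \<open>For S = |a><b| the product of S, X and |w><y| is <b, X w> |a><y|. Since <b, X
      w> is the Hilbert-Schmidt product of |b><w| with X, the resulting operator on the
      Hilbert-Schmidt space has rank one.\<close>
    define \<gamma> where "\<gamma> e = tc_rank_one (hs_of_tc (\<Psi> (tc_rank_one (a e) y))) (hs_of_tc (tc_rank_one (b e) w))" for e
    have \<gamma>n: "norm (\<gamma> e) \<le> (K * (norm y * norm w)) * (norm (a e) * norm (b e))" for e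
    proof -
      have "norm (\<gamma> e) \<le> norm (\<Psi> (tc_rank_one (a e) y)) * norm (tc_rank_one (b e) w)"
        unfolding \<gamma>_def by (rule order_trans [OF norm_tc_rank_one mult_mono [OF norm_hs_of_tc norm_hs_of_tc]]) auto
      also have "\<dots> \<le> (K * (norm (a e) * norm y)) * (norm (b e) * norm w)"
        using K by (intro mult_mono \<Psi>r norm_tc_rank_one) auto
      finally show ?thesis by (simp add: mult_ac)
    qed
    have c0: "0 \<le> K * (norm y * norm w)" using K by simp
    note s = infsum_norm_bound [where g = \<gamma>, OF ab(1,2) \<gamma>n c0]
    have \<gamma>X: "of_tc (\<gamma> e) X = hs_of_tc (\<Psi> (tc_rmult (tc_rank_one (a e) (b e)) (of_hs X * rank_one w y)))" for e X
    proof -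
      have "adj (of_hs X * rank_one w y) (b e) = cnj (cinner (b e) (of_hs X w)) *\<^sub>C y"
        by (rule cinner_ext) (simp add: bop_linear cinner_scaleC_left cinner_scaleC_right mult.commute flip: cinner_adj(1) cinner_commute)
      then show ?thesis
        by (simp add: \<gamma>_def tc_rank_one.rep_eq cinner_hs_of_tc_rank_one tc_rank_one_scaleC bounded_clinear_simps [OF \<Psi>] hs_of_tc_scaleC)
    qed
    have "of_tc (infsum \<gamma> some_onb) X = hs_of_tc (\<Psi> (tc_rmult S (of_hs X * rank_one w y)))" for X
    proof (rule has_sum_unique)
      show "((\<lambda>e. of_tc (\<gamma> e) X) has_sum of_tc (infsum \<gamma> some_onb) X) some_onb"
        by (rule has_sum_bounded_linear [OF bounded_linear_of_tc_apply has_sum_infsum [OF s(1)]])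
      show "((\<lambda>e. of_tc (\<gamma> e) X) has_sum hs_of_tc (\<Psi> (tc_rmult S (of_hs X * rank_one w y)))) some_onb"
        unfolding \<gamma>X
        by (rule has_sum_bounded_linear [OF bounded_linear_compose [OF bounded_linear_hs_of_tc
              bounded_linear_compose [OF \<Psi>b bounded_linear_tc_rmult]] ab(3)])
    qed
    then show ?thesis using s(2) by (intro exI [of _ "infsum \<gamma> some_onb"]) (simp add: mult_ac)
  qed
  obtain \<Gamma> :: "'a \<Rightarrow> 'a \<Rightarrow> 'a hs tc" where
    \<Gamma>n: "\<And>y w. norm (\<Gamma> y w) \<le> K * norm S * (norm y * norm w)" and
    \<Gamma>X: "\<And>y w X. of_tc (\<Gamma> y w) X = hs_of_tc (\<Psi> (tc_rmult S (of_hs X * rank_one w y)))"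
    using step1 by metis
  obtain c d :: "'a \<Rightarrow> 'a" where cd: "(\<lambda>e. norm (c e) * norm (d e)) summable_on some_onb"
    "infsum (\<lambda>e. norm (c e) * norm (d e)) some_onb \<le> norm T"
    "((\<lambda>e. tc_rank_one (c e) (d e)) has_sum T) some_onb"
    by (rule tc_expansion [of T])
  have c0: "0 \<le> K * norm S" using K by simp
  note s = infsum_norm_bound [where g = "\<lambda>e. \<Gamma> (c e) (d e)", OF cd(1,2) \<Gamma>n c0]
  define \<Delta> where "\<Delta> = infsum (\<lambda>e. \<Gamma> (c e) (d e)) some_onb"
  have bl: "bounded_linear (\<lambda>R. hs_of_tc (\<Psi> (tc_lmult (of_tc S * of_hs X) (tc_adj R))))" for X
    by (intro bounded_linear_compose [OF bounded_linear_hs_of_tc] bounded_linear_compose [OF \<Psi>b]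
        bounded_linear_compose [OF bounded_linear_tc_lmult] bounded_linear_tc_adj)
  have eq: "tc_lmult (of_tc S * of_hs X) (tc_adj R) = tc_rmult S (of_hs X * of_tc (tc_adj R))" for X R
    by (simp add: of_tc_inject [symmetric] tc_lmult.rep_eq tc_rmult.rep_eq mult.assoc)
  have "of_tc \<Delta> X = hs_of_tc (\<Psi> (tc_rmult S (of_hs X * of_tc (tc_adj T))))" for X
  proof (rule has_sum_unique)
    show "((\<lambda>e. of_tc (\<Gamma> (c e) (d e)) X) has_sum of_tc \<Delta> X) some_onb"
      unfolding \<Delta>_def
      by (rule has_sum_bounded_linear [OF bounded_linear_of_tc_apply has_sum_infsum [OF s(1)]])
    show "((\<lambda>e. of_tc (\<Gamma> (c e) (d e)) X) has_sum hs_of_tc (\<Psi> (tc_rmult S (of_hs X * of_tc (tc_adj T))))) some_onb"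
      using has_sum_bounded_linear [OF bl [of X] cd(3), unfolded eq] by (simp add: \<Gamma>X tc_rank_one.rep_eq)
  qed
  then show ?thesis using s(2) unfolding K_def \<Delta>_def by blast
qed

lemma tc_kernel:
  fixes \<Psi> :: "'a::chilbert_space tc \<Rightarrow> 'a tc"
  assumes \<Psi>: "bounded_clinear \<Psi>"
  shows "of_tc (tc_kernel \<Psi> S T) X = hs_of_tc (\<Psi> (tc_rmult S (of_hs X * of_tc (tc_adj T))))"
    "norm (tc_kernel \<Psi> S T) \<le> onorm \<Psi> * norm S * norm T"
proof -
  obtain \<Gamma> :: "'a hs tc" where \<Gamma>: "norm \<Gamma> \<le> onorm \<Psi> * norm S * norm T"
    "\<And>X. of_tc \<Gamma> X = hs_of_tc (\<Psi> (tc_rmult S (of_hs X * of_tc (tc_adj T))))"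
    using tc_kernel_exists [OF \<Psi>, of S T] by blast
  have "tc_kernel \<Psi> S T = \<Gamma>"
    unfolding tc_kernel_def \<Gamma>(2) [symmetric] by (simp add: bop_apply_inverse of_tc_inverse)
  with \<Gamma> show "of_tc (tc_kernel \<Psi> S T) X = hs_of_tc (\<Psi> (tc_rmult S (of_hs X * of_tc (tc_adj T))))"
    "norm (tc_kernel \<Psi> S T) \<le> onorm \<Psi> * norm S * norm T" by simp_all
qed

lemma tc_eqI: "(\<And>x. of_tc S x = of_tc T x) \<Longrightarrow> S = T"
  by (simp add: of_tc_inject [symmetric] bop_eqI)

definition choi_form :: "('a::chilbert_space tc \<Rightarrow> 'a tc) \<Rightarrow> 'a tc \<Rightarrow> 'a tc \<Rightarrow> complex" where
  "choi_form \<Psi> S T = tc_trace (tc_kernel \<Psi> S T)"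

lemma choi_form_add:
  fixes \<Psi> :: "'a::chilbert_space tc \<Rightarrow> 'a tc"
  assumes "bounded_clinear \<Psi>"
  shows "choi_form \<Psi> (S + S') T = choi_form \<Psi> S T + choi_form \<Psi> S' T"
    "choi_form \<Psi> S (T + T') = choi_form \<Psi> S T + choi_form \<Psi> S T'"
    "choi_form \<Psi> (S - S') T = choi_form \<Psi> S T - choi_form \<Psi> S' T"
    "choi_form \<Psi> S (T - T') = choi_form \<Psi> S T - choi_form \<Psi> S T'"
    "choi_form \<Psi> (c *\<^sub>C S) T = c * choi_form \<Psi> S T"
    "choi_form \<Psi> S (c *\<^sub>C T) = cnj c * choi_form \<Psi> S T"
proof -
  note r = tc_kernel(1) [OF assms] plus_tc.rep_eq [where 'a = "'a hs"] minus_tc.rep_eq [where 'a = "'a hs"]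
    scaleC_tc.rep_eq [where 'a = "'a hs"] bounded_clinear_simps [OF assms] bounded_clinear_simps [OF bounded_clinear_tc_rmult]
    linear_simps [OF bounded_linear_hs_of_tc] hs_of_tc_scaleC
  have eq: "tc_rmult S (of_hs X * of_tc R) = tc_lmult (of_tc S * of_hs X) R" for X and S R :: "'a tc"
    by (simp add: of_tc_inject [symmetric] tc_lmult.rep_eq tc_rmult.rep_eq mult.assoc)
  note r' = eq bounded_clinear_simps [OF bounded_clinear_tc_lmult] linear_simps [OF bounded_linear_tc_adj] tc_adj_scaleC
  have "tc_kernel \<Psi> (S + S') T = tc_kernel \<Psi> S T + tc_kernel \<Psi> S' T"
    "tc_kernel \<Psi> (S - S') T = tc_kernel \<Psi> S T - tc_kernel \<Psi> S' T"
    "tc_kernel \<Psi> (c *\<^sub>C S) T = c *\<^sub>C tc_kernel \<Psi> S T"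
    by (rule tc_eqI; simp add: r)+
  then show "choi_form \<Psi> (S + S') T = choi_form \<Psi> S T + choi_form \<Psi> S' T"
    "choi_form \<Psi> (S - S') T = choi_form \<Psi> S T - choi_form \<Psi> S' T"
    "choi_form \<Psi> (c *\<^sub>C S) T = c * choi_form \<Psi> S T"
    by (simp_all add: choi_form_def tc_trace_scaleC linear_simps [OF bounded_linear_tc_trace])
  have "tc_kernel \<Psi> S (T + T') = tc_kernel \<Psi> S T + tc_kernel \<Psi> S T'"
    "tc_kernel \<Psi> S (T - T') = tc_kernel \<Psi> S T - tc_kernel \<Psi> S T'"
    "tc_kernel \<Psi> S (c *\<^sub>C T) = cnj c *\<^sub>C tc_kernel \<Psi> S T"
    by (rule tc_eqI; simp add: r r')+
  then show "choi_form \<Psi> S (T + T') = choi_form \<Psi> S T + choi_form \<Psi> S T'"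
    "choi_form \<Psi> S (T - T') = choi_form \<Psi> S T - choi_form \<Psi> S T'"
    "choi_form \<Psi> S (c *\<^sub>C T) = cnj c * choi_form \<Psi> S T"
    by (simp_all add: choi_form_def tc_trace_scaleC linear_simps [OF bounded_linear_tc_trace])
qed

lemma norm_choi_form:
  "bounded_clinear \<Psi> \<Longrightarrow> cmod (choi_form \<Psi> S T) \<le> onorm \<Psi> * norm S * norm T"
  unfolding choi_form_def by (rule order_trans [OF norm_tc_trace tc_kernel(2)])

lemma bounded_linear_choi_form:
  assumes "bounded_clinear \<Psi>"
  shows "bounded_linear (\<lambda>S. choi_form \<Psi> S T)" "bounded_linear (choi_form \<Psi> S)"
proof -
  show "bounded_linear (\<lambda>S. choi_form \<Psi> S T)"
    by (rule bounded_linear_intro [where K = "onorm \<Psi> * norm T"])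
      (use norm_choi_form [OF assms, of _ T] in \<open>simp_all add: choi_form_add [OF assms] scaleR_scaleC scaleR_conv_of_real mult_ac\<close>)
  show "bounded_linear (choi_form \<Psi> S)"
    by (rule bounded_linear_intro [where K = "onorm \<Psi> * norm S"])
      (use norm_choi_form [OF assms, of S] in \<open>simp_all add: choi_form_add [OF assms] scaleR_scaleC scaleR_conv_of_real mult_ac\<close>)
qed

lemma choi_form_rank_one:
  assumes \<Psi>: "bounded_clinear \<Psi>"
  shows "choi_form \<Psi> (tc_rank_one x v) (tc_rank_one y w) = cinner v (of_tc (\<Psi> (tc_rank_one x y)) w)"
proof -
  have a: "adj (of_hs X * rank_one w y) v = cnj (cinner v (of_hs X w)) *\<^sub>C y" for X
    by (rule cinner_ext) (simp add: bop_linear cinner_scaleC_left cinner_scaleC_right mult.commute flip: cinner_adj(1) cinner_commute)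
  have "tc_kernel \<Psi> (tc_rank_one x v) (tc_rank_one y w) = tc_rank_one (hs_of_tc (\<Psi> (tc_rank_one x y))) (hs_of_tc (tc_rank_one v w))"
    by (rule tc_eqI) (simp add: tc_kernel(1) [OF \<Psi>] tc_rank_one.rep_eq a tc_rank_one_scaleC
        cinner_hs_of_tc_rank_one bounded_clinear_simps [OF \<Psi>] hs_of_tc_scaleC)
  then show ?thesis
    by (simp add: choi_form_def cinner_hs_of_tc_rank_one hs_of_tc.rep_eq)
qed

section \<open>Forms of elementary maps\<close>

lemma tc_sesquilinear_eqI:
  fixes f g :: "'a::chilbert_space tc \<Rightarrow> 'a tc \<Rightarrow> complex"
  assumes f: "\<And>T. bounded_linear (\<lambda>S. f S T)" "\<And>S. bounded_linear (f S)"
    and g: "\<And>T. bounded_linear (\<lambda>S. g S T)" "\<And>S. bounded_linear (g S)"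
    and eq: "\<And>x v y w. f (tc_rank_one x v) (tc_rank_one y w) = g (tc_rank_one x v) (tc_rank_one y w)"
  shows "f S T = g S T"
proof (rule tc_bounded_linear_eqI [OF f(1) g(1)])
  fix x v show "f (tc_rank_one x v) T = g (tc_rank_one x v) T"
    by (rule tc_bounded_linear_eqI [OF f(2) g(2) eq])
qed

lemma bounded_linear_cnj_tc_trace: "bounded_linear (\<lambda>T. cnj (tc_trace T))"
  by (rule bounded_linear_compose [OF bounded_linear_cnj bounded_linear_tc_trace])

text \<open>The identity has a rank-one form built from the trace alone, and each of the next two
  forms keeps one plain trace as a factor. All three vanish on traceless operators, which therefore
  see only the completely positive part of a generator.\<close>

lemma choi_form_id: "choi_form (\<lambda>X. X) S T = tc_trace S * cnj (tc_trace T)"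
proof (rule tc_sesquilinear_eqI [of "choi_form (\<lambda>X. X)" "\<lambda>S T. tc_trace S * cnj (tc_trace T)"])
  show "choi_form (\<lambda>X. X) (tc_rank_one x v) (tc_rank_one y w) = tc_trace (tc_rank_one x v) * cnj (tc_trace (tc_rank_one y w))" for x v y w :: 'a
    by (simp add: choi_form_rank_one bounded_clinear_id tc_rank_one.rep_eq cinner_scaleC_right mult.commute flip: cinner_commute)
qed (intro bounded_linear_choi_form bounded_clinear_id bounded_linear_mult_const bounded_linear_const_mult
    bounded_linear_tc_trace bounded_linear_cnj_tc_trace)+

lemma choi_form_tc_lmult:
  fixes S T :: "'a::chilbert_space tc"
  shows "choi_form (tc_lmult K) S T = tc_trace (tc_lmult K S) * cnj (tc_trace T)"
proof (rule tc_sesquilinear_eqI [of "choi_form (tc_lmult K)" "\<lambda>S T. tc_trace (tc_lmult K S) * cnj (tc_trace T)"])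
  show "choi_form (tc_lmult K) (tc_rank_one x v) (tc_rank_one y w) =
    tc_trace (tc_lmult K (tc_rank_one x v)) * cnj (tc_trace (tc_rank_one y w))" for x v y w :: 'a
    by (simp add: choi_form_rank_one bounded_clinear_tc_lmult tc_rank_one.rep_eq cinner_scaleC_right mult.commute flip: cinner_commute)
qed (intro bounded_linear_choi_form bounded_clinear_tc_lmult bounded_linear_mult_const bounded_linear_const_mult
    bounded_linear_compose [OF bounded_linear_tc_trace] bounded_linear_tc_lmult bounded_linear_cnj_tc_trace bounded_linear_tc_trace)+

lemma choi_form_tc_rmult:
  fixes S T :: "'a::chilbert_space tc"
  shows "choi_form (\<lambda>X. tc_rmult X (adj K)) S T = tc_trace S * cnj (tc_trace (tc_lmult K T))"
proof (rule tc_sesquilinear_eqI [of "choi_form (\<lambda>X. tc_rmult X (adj K))" "\<lambda>S T. tc_trace S * cnj (tc_trace (tc_lmult K T))"])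
  show "choi_form (\<lambda>X. tc_rmult X (adj K)) (tc_rank_one x v) (tc_rank_one y w) =
    tc_trace (tc_rank_one x v) * cnj (tc_trace (tc_lmult K (tc_rank_one y w)))" for x v y w :: 'a
    by (simp add: choi_form_rank_one bounded_clinear_tc_rmult tc_rank_one.rep_eq cinner_scaleC_right mult.commute flip: cinner_commute)
qed (intro bounded_linear_choi_form bounded_clinear_tc_rmult bounded_linear_mult_const bounded_linear_const_mult
    bounded_linear_compose [OF bounded_linear_cnj_tc_trace] bounded_linear_tc_lmult bounded_linear_tc_trace)+

lemma choi_form_map_add:
  assumes "bounded_clinear \<Psi>" "bounded_clinear \<Theta>"
  shows "choi_form (\<lambda>X. \<Psi> X + \<Theta> X) S T = choi_form \<Psi> S T + choi_form \<Theta> S T"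
    "choi_form (\<lambda>X. \<Psi> X - \<Theta> X) S T = choi_form \<Psi> S T - choi_form \<Theta> S T"
proof -
  note r = tc_kernel(1) [OF assms(1)] tc_kernel(1) [OF assms(2)] tc_kernel(1) [OF bounded_clinear_add [OF assms]]
     tc_kernel(1) [OF bounded_clinear_diff [OF assms]]
     plus_tc.rep_eq minus_tc.rep_eq linear_simps [OF bounded_linear_hs_of_tc]
  have "tc_kernel (\<lambda>X. \<Psi> X + \<Theta> X) S T = tc_kernel \<Psi> S T + tc_kernel \<Theta> S T"
    "tc_kernel (\<lambda>X. \<Psi> X - \<Theta> X) S T = tc_kernel \<Psi> S T - tc_kernel \<Theta> S T"
    by (rule tc_eqI; simp add: r)+
  then show "choi_form (\<lambda>X. \<Psi> X + \<Theta> X) S T = choi_form \<Psi> S T + choi_form \<Theta> S T"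
    "choi_form (\<lambda>X. \<Psi> X - \<Theta> X) S T = choi_form \<Psi> S T - choi_form \<Theta> S T"
    by (simp_all add: choi_form_def linear_simps [OF bounded_linear_tc_trace])
qed

lemma choi_form_map_scaleR:
  assumes "bounded_clinear \<Psi>"
  shows "choi_form (\<lambda>X. r *\<^sub>R \<Psi> X) S T = r * choi_form \<Psi> S T"
proof -
  have "tc_kernel (\<lambda>X. r *\<^sub>R \<Psi> X) S T = r *\<^sub>R tc_kernel \<Psi> S T"
    by (rule tc_eqI) (simp add: tc_kernel(1) [OF assms] tc_kernel(1) [OF bounded_clinear_scaleR [OF assms]]
        scaleR_tc.rep_eq linear_simps [OF bounded_linear_hs_of_tc])
  then show ?thesis
    by (simp add: choi_form_def linear_simps [OF bounded_linear_tc_trace] scaleR_conv_of_real)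
qed

lemma choi_form_eqD:
  assumes \<Psi>: "bounded_clinear \<Psi>" and \<Theta>: "bounded_clinear \<Theta>" and eq: "\<And>S T. choi_form \<Psi> S T = choi_form \<Theta> S T"
  shows "\<Psi> = \<Theta>"
proof
  fix T
  show "\<Psi> T = \<Theta> T"
  proof (rule tc_bounded_linear_eqI [OF \<Psi> [THEN bounded_clinear_bounded_linear] \<Theta> [THEN bounded_clinear_bounded_linear]])
    fix x y
    show "\<Psi> (tc_rank_one x y) = \<Theta> (tc_rank_one x y)"
      by (rule tc_eqI, rule cinner_ext) (simp add: eq flip: choi_form_rank_one [OF \<Psi>] choi_form_rank_one [OF \<Theta>])
  qed
qed

lemma CP_restricted_iff:
  "\<Phi> \<in> CP_restricted B \<longleftrightarrow> \<Phi> \<in> CP \<and> op_trace (Bop (\<lambda>X. hs_of_tc (\<Phi> (tc_rmult (tc_adj B) (of_hs X * of_tc B))))) = 0"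
proof -
  have 1: "Hs (of_tc T) = hs_of_tc T" for T :: "'a tc"
    by (metis hs_of_tc.rep_eq of_hs_inverse)
  have 2: "Tc (adj (of_tc B) * of_hs X * of_tc B) = tc_rmult (tc_adj B) (of_hs X * of_tc B)" for X
    by (metis mult.assoc of_tc_inverse tc_adj.rep_eq tc_rmult.rep_eq)
  show ?thesis by (simp add: CP_restricted_def 1 2)
qed

text \<open>With \<open>tc_adj B\<close> in both slots, the product S X (adj T) becomes (adj B) X
  B.\<close>

lemma CP_restricted_choi_form:
  assumes "bounded_clinear \<Phi>"
  shows "\<Phi> \<in> CP_restricted B \<longleftrightarrow> \<Phi> \<in> CP \<and> choi_form \<Phi> (tc_adj B) (tc_adj B) = 0"
proof -
  have "bop_apply (of_tc (tc_kernel \<Phi> (tc_adj B) (tc_adj B))) = (\<lambda>X. hs_of_tc (\<Phi> (tc_rmult (tc_adj B) (of_hs X * of_tc B))))"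
    by (rule ext) (simp add: tc_kernel(1) [OF assms])
  then have "Bop (\<lambda>X. hs_of_tc (\<Phi> (tc_rmult (tc_adj B) (of_hs X * of_tc B)))) = of_tc (tc_kernel \<Phi> (tc_adj B) (tc_adj B))"
    by (metis bop_apply_inverse)
  then show ?thesis by (simp add: CP_restricted_iff choi_form_def tc_trace.rep_eq)
qed


section \<open>Completely positive maps are bounded\<close>

lemma cnj_mult_self_nonneg: "cnj z * z \<in> \<real>\<^sub>\<ge>\<^sub>0"
  by (simp add: complex_nonneg_Reals_iff)

definition positive_kernel :: "'i set \<Rightarrow> ('i \<Rightarrow> 'i \<Rightarrow> complex) \<Rightarrow> bool" where
  "positive_kernel I A \<longleftrightarrow> (\<forall>c. (\<Sum>a\<in>I. \<Sum>b\<in>I. cnj (c a) * A a b * c b) \<in> \<real>\<^sub>\<ge>\<^sub>0)"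

lemma positive_kernel_subset:
  assumes A: "positive_kernel I A" and J: "J \<subseteq> I" "finite I"
  shows "positive_kernel J A"
  unfolding positive_kernel_def
proof
  fix c
  define c' where "c' a = (if a \<in> J then c a else (0::complex))" for a
  have "(\<Sum>a\<in>I. \<Sum>b\<in>I. cnj (c' a) * A a b * c' b) = (\<Sum>a\<in>J. \<Sum>b\<in>I. cnj (c' a) * A a b * c' b)"
    using J by (intro sum.mono_neutral_right) (auto simp: c'_def)
  also have "\<dots> = (\<Sum>a\<in>J. \<Sum>b\<in>J. cnj (c' a) * A a b * c' b)"
    using J by (intro sum.cong refl sum.mono_neutral_right) (auto simp: c'_def)
  also have "\<dots> = (\<Sum>a\<in>J. \<Sum>b\<in>J. cnj (c a) * A a b * c b)"
    by (intro sum.cong refl) (auto simp: c'_def)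
  finally have eq: "(\<Sum>a\<in>I. \<Sum>b\<in>I. cnj (c' a) * A a b * c' b) = (\<Sum>a\<in>J. \<Sum>b\<in>J. cnj (c a) * A a b * c b)" .
  show "(\<Sum>a\<in>J. \<Sum>b\<in>J. cnj (c a) * A a b * c b) \<in> \<real>\<^sub>\<ge>\<^sub>0"
    unfolding eq [symmetric] using A unfolding positive_kernel_def by (rule spec)
qed

lemma positive_kernel_diag:
  assumes A: "positive_kernel I A" and I: "finite I" "s \<in> I"
  shows "A s s \<in> \<real>\<^sub>\<ge>\<^sub>0"
proof -
  have "positive_kernel {s} A" using A I by (intro positive_kernel_subset [OF A]) auto
  then show ?thesis unfolding positive_kernel_def by (auto dest: spec [of _ "\<lambda>_. 1"])
qed

lemma positive_kernel_pair:
  assumes A: "positive_kernel I A" and I: "finite I" "s \<in> I" "b \<in> I" "s \<noteq> b"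
  shows "cnj p * A s s * p + cnj p * A s b * q + (cnj q * A b s * p + cnj q * A b b * q) \<in> \<real>\<^sub>\<ge>\<^sub>0"
proof -
  have "positive_kernel {s, b} A" using A I by (intro positive_kernel_subset [OF A]) auto
  then have "(\<Sum>a\<in>{s,b}. \<Sum>b'\<in>{s,b}. cnj ((\<lambda>x. if x = s then p else q) a) * A a b' * (\<lambda>x. if x = s then p else q) b') \<in> \<real>\<^sub>\<ge>\<^sub>0"
    unfolding positive_kernel_def by (rule spec)
  then show ?thesis using I(4) by simp
qed

lemma positive_kernel_hermitian:
  assumes A: "positive_kernel I A" and I: "finite I" "s \<in> I" "b \<in> I"
  shows "A b s = cnj (A s b)"
proof (cases "s = b")
  case True
  then show ?thesis using positive_kernel_diag [OF A I(1,2)] by (auto simp: complex_nonneg_Reals_iff complex_eq_iff)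
next
  case False
  have d: "Im (A s s) = 0" "Im (A b b) = 0"
    using positive_kernel_diag [OF A I(1)] I by (auto simp: complex_nonneg_Reals_iff)
  \<comment> \<open>The coefficients (1, 1) yield the imaginary part of the claim, the coefficients
    (1, i) the real part.\<close>
  show ?thesis
    using positive_kernel_pair [OF A I False, of 1 1] positive_kernel_pair [OF A I False, of 1 \<i>] d
    by (auto simp: complex_nonneg_Reals_iff complex_eq_iff)
qed

text \<open>The vector with entries -t A(s,b) at s and 1 at b gives the value A(b,b) - 2t
  |A(s,b)|^2, which stays nonnegative for all real t only if A(s,b) = 0. This degenerate case of
  Cauchy-Schwarz also drives \<open>choi_form_null\<close>.\<close>

lemma positive_kernel_null:
  assumes A: "positive_kernel I A" and I: "finite I" "s \<in> I" "b \<in> I" and 0: "A s s = 0"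
  shows "A s b = 0"
proof (cases "s = b")
  case False
  have h: "A b s = cnj (A s b)" by (rule positive_kernel_hermitian [OF A I])
  define m where "m = (cmod (A s b))\<^sup>2"
  have le: "2 * t * m \<le> Re (A b b)" for t :: real
  proof -
    show ?thesis
      using positive_kernel_pair [OF A I False, of "- t * A s b" 1] 0
      by (simp add: complex_nonneg_Reals_iff h m_def cmod_power2 [unfolded power2_eq_square] algebra_simps power2_eq_square)
  qed
  have "m = 0"
  proof (rule ccontr)
    assume m: "m \<noteq> 0"
    have "2 * ((Re (A b b) + 1) / (2 * m)) * m = Re (A b b) + 1" using m by simp
    then show False using le [of "(Re (A b b) + 1) / (2 * m)"] by simp
  qed
  then show ?thesis by (simp add: m_def)
qed (use 0 in simp)

text \<open>The induction splits off one index by a Schur complement.\<close>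

lemma positive_kernel_schur:
  assumes "finite I" "positive_kernel I A" "positive_kernel I B"
  shows "(\<Sum>a\<in>I. \<Sum>b\<in>I. A a b * B a b) \<in> \<real>\<^sub>\<ge>\<^sub>0"
  using assms
proof (induction I arbitrary: A rule: finite_induct)
  case (insert s J)
  let ?I = "insert s J"
  have fin: "finite ?I" using insert by simp
  have BJ: "positive_kernel J B" by (rule positive_kernel_subset [OF insert.prems(2)]) (use insert in auto)
  have split: "(\<Sum>a\<in>?I. \<Sum>b\<in>?I. f a b) = f s s + (\<Sum>b\<in>J. f s b) + (\<Sum>a\<in>J. f a s) + (\<Sum>a\<in>J. \<Sum>b\<in>J. f a b)"
    for f :: "'a \<Rightarrow> 'a \<Rightarrow> complex"
    using insert(1,2) by (simp add: sum.distrib add.assoc)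
  note herm = positive_kernel_hermitian [OF insert.prems(1) fin]
  show ?case
  proof (cases "A s s = 0")
    case True
    have 0: "A s b = 0" "A b s = 0" if "b \<in> ?I" for b
      using positive_kernel_null [OF insert.prems(1) fin _ that True] herm [OF _ that, of s] by simp_all
    have "(\<Sum>a\<in>J. \<Sum>b\<in>J. A a b * B a b) \<in> \<real>\<^sub>\<ge>\<^sub>0"
      by (rule insert.IH [OF _ BJ]) (rule positive_kernel_subset [OF insert.prems(1)], use insert in auto)
    moreover have "(\<Sum>a\<in>?I. \<Sum>b\<in>?I. A a b * B a b) = (\<Sum>a\<in>J. \<Sum>b\<in>J. A a b * B a b)"
      unfolding split using 0 by simp
    ultimately show ?thesis by simp
  next
    case False
    define \<alpha> where "\<alpha> = A s s"
    have \<alpha>: "\<alpha> \<noteq> 0" "\<alpha> \<in> \<real>\<^sub>\<ge>\<^sub>0" using False positive_kernel_diag [OF insert.prems(1) fin, of s] by (auto simp: \<alpha>_def)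
    \<comment> \<open>Subtracting the rank-one matrix that matches row and column s of A leaves a
      matrix supported on J. Against B, the rank-one part contributes a value of the form of B
      divided by \<open>\<alpha>\<close>, and the remainder is covered by the induction
      hypothesis.\<close>
    define A' where "A' a b = A a b - A a s * A s b / \<alpha>" for a b
    have A'0: "A' s b = 0" "A' b s = 0" for b using \<alpha> by (auto simp: A'_def \<alpha>_def)
    have A'J: "positive_kernel J A'"
      unfolding positive_kernel_def
    proof
      fix c
      define u where "u = (\<Sum>b\<in>J. A s b * c b)"
      \<comment> \<open>The entry at s minimizes the form of A when the other entries are fixed;
        completing the square leaves exactly the form of \<open>A'\<close>.\<close>
      define c' where "c' a = (if a = s then - u / \<alpha> else c a)" for a
      have c': "c' s = - u / \<alpha>" "\<And>a. a \<in> J \<Longrightarrow> c' a = c a" using insert(2) by (auto simp: c'_def)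
      have \<alpha>c: "cnj \<alpha> = \<alpha>" using \<alpha>(2) by (auto simp: complex_nonneg_Reals_iff complex_eq_iff)
      have uc: "cnj u = (\<Sum>a\<in>J. cnj (c a) * A a s)"
        unfolding u_def cnj_sum by (intro sum.cong refl) (simp add: herm [of s] mult.commute)
      have "(\<Sum>a\<in>?I. \<Sum>b\<in>?I. cnj (c' a) * A a b * c' b) =
          cnj (c' s) * A s s * c' s + (\<Sum>b\<in>J. cnj (c' s) * A s b * c b) + (\<Sum>a\<in>J. cnj (c a) * A a s * c' s)
          + (\<Sum>a\<in>J. \<Sum>b\<in>J. cnj (c a) * A a b * c b)"
        unfolding split by (simp add: c' cong: sum.cong)
      also have "(\<Sum>b\<in>J. cnj (c' s) * A s b * c b) = cnj (c' s) * u"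
        by (simp add: u_def sum_distrib_left mult.assoc)
      also have "(\<Sum>a\<in>J. cnj (c a) * A a s * c' s) = cnj u * c' s"
        by (simp add: uc sum_distrib_right)
      also have "cnj (c' s) * A s s * c' s + cnj (c' s) * u + cnj u * c' s = - (cnj u * u / \<alpha>)"
        using \<alpha> by (simp add: c' \<alpha>c field_simps flip: \<alpha>_def)
      also have "cnj u * u / \<alpha> = (\<Sum>a\<in>J. \<Sum>b\<in>J. cnj (c a) * (A a s * A s b / \<alpha>) * c b)"
        unfolding uc by (simp add: u_def sum_product sum_divide_distrib mult_ac, rule sum.swap)
      also have "- \<dots> + (\<Sum>a\<in>J. \<Sum>b\<in>J. cnj (c a) * A a b * c b) = (\<Sum>a\<in>J. \<Sum>b\<in>J. cnj (c a) * A' a b * c b)"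
        by (simp add: A'_def algebra_simps sum_subtractf)
      finally show "(\<Sum>a\<in>J. \<Sum>b\<in>J. cnj (c a) * A' a b * c b) \<in> \<real>\<^sub>\<ge>\<^sub>0"
        using spec [OF insert.prems(1) [unfolded positive_kernel_def], of c'] by simp
    qed
    have "(\<Sum>a\<in>?I. \<Sum>b\<in>?I. A a b * B a b) =
        (\<Sum>a\<in>?I. \<Sum>b\<in>?I. (A a s * A s b / \<alpha>) * B a b) + (\<Sum>a\<in>?I. \<Sum>b\<in>?I. A' a b * B a b)"
      unfolding sum.distrib [symmetric] by (intro sum.cong refl) (simp add: A'_def algebra_simps)
    also have "(\<Sum>a\<in>?I. \<Sum>b\<in>?I. A' a b * B a b) = (\<Sum>a\<in>J. \<Sum>b\<in>J. A' a b * B a b)"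
      unfolding split by (simp add: A'0)
    also have "(\<Sum>a\<in>?I. \<Sum>b\<in>?I. (A a s * A s b / \<alpha>) * B a b) = (\<Sum>a\<in>?I. \<Sum>b\<in>?I. cnj (A s a) * B a b * A s b) / \<alpha>"
      unfolding sum_divide_distrib by (intro sum.cong refl) (simp add: herm [of s] mult_ac)
    finally have eq: "(\<Sum>a\<in>?I. \<Sum>b\<in>?I. A a b * B a b) =
        (\<Sum>a\<in>?I. \<Sum>b\<in>?I. cnj (A s a) * B a b * A s b) / \<alpha> + (\<Sum>a\<in>J. \<Sum>b\<in>J. A' a b * B a b)" .
    have "(\<Sum>a\<in>?I. \<Sum>b\<in>?I. cnj (A s a) * B a b * A s b) \<in> \<real>\<^sub>\<ge>\<^sub>0"
      using insert.prems(2) unfolding positive_kernel_def by (rule spec)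
    then show ?thesis unfolding eq by (intro nonneg_Reals_add_I nonneg_Reals_divide_I \<alpha> insert.IH [OF A'J BJ])
  qed
qed simp

section \<open>Positive trace-class operators and automatic boundedness\<close>

lemma closed_positive_tc: "closed {T :: 'a::chilbert_space tc. positive_op (of_tc T)}"
proof -
  have "{T :: 'a tc. positive_op (of_tc T)} = (\<Inter>x. (\<lambda>T. cinner x (of_tc T x)) -` \<real>\<^sub>\<ge>\<^sub>0)"
    by (auto simp: positive_op_def)
  moreover have "closed ((\<lambda>T :: 'a tc. cinner x (of_tc T x)) -` \<real>\<^sub>\<ge>\<^sub>0)" for x
    by (rule closed_vimage [OF closed_nonneg_Reals_complex])
      (rule bounded_linear.continuous_on [OF bounded_linear_compose [OF bounded_linear_cinner_right bounded_linear_of_tc_apply] continuous_on_id])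
  ultimately show ?thesis by auto
qed

lemma positive_tc_norm:
  assumes "positive_op (of_tc T)"
  shows "norm T = Re (tc_trace T)"
  using abs_op_positive [OF assms] by (simp add: norm_tc.rep_eq trace_norm_def tc_trace.rep_eq)

text \<open>Polarization of T = adj C * D over the fourth roots of unity c, with the positive
  operators adj R * R for R = C + c D. The factor 4 arises because the squares of the two
  Hilbert-Schmidt norms, and hence also their product, are at most the trace norm of T.\<close>

lemma tc_positive_decomposition:
  fixes T :: "'a::chilbert_space tc"
  obtains X Y Z W where "positive_op (of_tc X)" "positive_op (of_tc Y)" "positive_op (of_tc Z)" "positive_op (of_tc W)"
    "norm X \<le> 4 * norm T" "norm Y \<le> 4 * norm T" "norm Z \<le> 4 * norm T" "norm W \<le> 4 * norm T"
    "T = (1/4) *\<^sub>C (X - Y) - (\<i>/4) *\<^sub>C (Z - W)"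
proof -
  have T: "trace_class (of_tc T)" using of_tc by simp
  obtain C D where CD: "hilbert_schmidt C" "hilbert_schmidt D" "of_tc T = adj C * D"
    "(norm (Hs C))\<^sup>2 \<le> trace_norm (of_tc T)" "(norm (Hs D))\<^sup>2 \<le> trace_norm (of_tc T)"
    using trace_class_factor [OF T] .
  define R where "R c = C + c *\<^sub>C D" for c
  define P where "P c = Tc (adj (R c) * R c)" for c
  have R: "hilbert_schmidt (R c)" "norm (Hs (R c)) \<le> norm (Hs C) + cmod c * norm (Hs D)" for c
  proof -
    show "hilbert_schmidt (R c)" unfolding R_def by (intro hs_add hs_scaleC CD)
    have "Hs (R c) = Hs C + c *\<^sub>C Hs D"
      using CD \<open>hilbert_schmidt (R c)\<close>
      by (simp add: of_hs_inject [symmetric] plus_hs.rep_eq scaleC_hs.rep_eq Hs_inverse R_def)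
    then show "norm (Hs (R c)) \<le> norm (Hs C) + cmod c * norm (Hs D)"
      using norm_triangle_ineq [of "Hs C" "c *\<^sub>C Hs D"] by (simp add: norm_scaleC)
  qed
  have P: "of_tc (P c) = adj (R c) * R c" for c
    unfolding P_def using trace_class_hs_mult(1) [OF R(1) R(1)] by (simp add: Tc_inverse)
  have Pp: "positive_op (of_tc (P c))" for c unfolding P by (rule positive_adj_mult)
  have Pn: "norm (P c) \<le> 4 * norm T" if "cmod c = 1" for c
  proof -
    have "norm (P c) \<le> norm (Hs (R c)) * norm (Hs (R c))"
      unfolding norm_tc.rep_eq P by (rule trace_class_hs_mult(2) [OF R(1) R(1)])
    also have "\<dots> \<le> (norm (Hs C) + norm (Hs D)) * (norm (Hs C) + norm (Hs D))"
      using R(2) [of c] that by (intro mult_mono) auto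
    also have "\<dots> \<le> 4 * norm T"
      using CD(4,5) norm_mult_le_square [OF CD(4,5)] by (simp add: norm_tc.rep_eq algebra_simps power2_eq_square)
    finally show ?thesis .
  qed
  show ?thesis
  proof (rule that [of "P 1" "P (-1)" "P \<i>" "P (-\<i>)"])
    have "of_tc T = (1/4) *\<^sub>C (of_tc (P 1) - of_tc (P (-1))) - (\<i>/4) *\<^sub>C (of_tc (P \<i>) - of_tc (P (-\<i>)))"
      unfolding P CD(3)
      by (rule bop_cinner_eqI) (simp add: cinner_diff_right cinner_scaleC_right R_def cinner_add_left cinner_add_right
          cinner_scaleC_left bop_linear algebra_simps flip: cinner_adj(1))
    then show "T = (1/4) *\<^sub>C (P 1 - P (-1)) - (\<i>/4) *\<^sub>C (P \<i> - P (-\<i>))"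
      by (simp add: of_tc_inject [symmetric] minus_tc.rep_eq scaleC_tc.rep_eq)
  qed (auto intro: Pp Pn)
qed

lemma CP_clinear:
  assumes "\<Phi> \<in> CP"
  shows "\<Phi> (x + y) = \<Phi> x + \<Phi> y" "\<Phi> (c *\<^sub>C x) = c *\<^sub>C \<Phi> x" "\<Phi> 0 = 0" "\<Phi> (x - y) = \<Phi> x - \<Phi> y" "\<Phi> (r *\<^sub>R x) = r *\<^sub>R \<Phi> x"
proof -
  show a: "\<Phi> (x + y) = \<Phi> x + \<Phi> y" and c: "\<Phi> (c *\<^sub>C x) = c *\<^sub>C \<Phi> x" for x y c
    using assms by (auto simp: CP_def clinear_def)
  show 0: "\<Phi> 0 = 0" using a [of 0 0] by simp
  show "\<Phi> (x - y) = \<Phi> x - \<Phi> y" using a [of "x - y" y] by simp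
  show "\<Phi> (r *\<^sub>R x) = r *\<^sub>R \<Phi> x" by (simp add: scaleR_scaleC c)
qed

lemma CP_positive:
  assumes \<Phi>: "\<Phi> \<in> CP" and X: "positive_op (of_tc X)"
  shows "positive_op (of_tc (\<Phi> X))"
proof -
  have "block_positive 1 (\<lambda>i j. X)" using X by (simp add: block_positive_def positive_op_def)
  then have "block_positive 1 (\<lambda>i j. \<Phi> X)"
    using \<Phi> by (auto simp: CP_def dest: spec [of _ "1::nat"] spec [of _ "\<lambda>i j. X"])
  then have "cinner ((\<lambda>_. x) (0::nat)) (of_tc (\<Phi> X) x) \<in> \<real>\<^sub>\<ge>\<^sub>0" for x
    unfolding block_positive_def by (auto dest: spec [of _ "\<lambda>_. x"])
  then show ?thesis by (simp add: positive_op_def)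
qed

text \<open>If \<open>\<Phi>\<close> were unbounded on positive operators, a series of positive operators with rapidly growing images
  would have a sum whose image has infinite trace.\<close>

lemma CP_bounded_positive:
  fixes \<Phi> :: "'a::chilbert_space tc \<Rightarrow> 'a tc"
  assumes \<Phi>: "\<Phi> \<in> CP"
  shows "\<exists>c\<ge>0. \<forall>X. positive_op (of_tc X) \<longrightarrow> norm (\<Phi> X) \<le> c * norm X"
proof (rule ccontr)
  note lin = CP_clinear [OF \<Phi>]
  assume neg: "\<not> ?thesis"
  \<comment> \<open>A violation of the bound with constant 4^n, rescaled to norm 2^(-n), still has
    an image of norm above 2^n: the operators are summable while their images grow.\<close>
  have "\<exists>Y. positive_op (of_tc Y) \<and> norm Y = (1/2)^n \<and> norm (\<Phi> Y) > 2 ^ n" for n :: nat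
  proof -
    obtain X where X: "positive_op (of_tc X)" "norm (\<Phi> X) > 4 ^ n * norm X"
      using neg by (meson not_le zero_le_numeral zero_le_power)
    have X0: "norm X > 0" using X(2) lin(3) by (cases "X = 0") auto
    define r where "r = (1/2)^n / norm X"
    have r: "0 < r" using X0 by (simp add: r_def)
    have "positive_op (of_tc (r *\<^sub>R X))"
      using X(1) r by (simp add: positive_op_iff scaleR_tc.rep_eq adj_scaleR)
    moreover have "norm (r *\<^sub>R X) = (1/2)^n" using X0 by (simp add: r_def)
    moreover have "norm (\<Phi> (r *\<^sub>R X)) > 2 ^ n"
    proof -
      have "(2::real) ^ n = r * (4 ^ n * norm X)"
        using X0 by (simp add: r_def power_divide flip: power_mult_distrib) (simp add: field_simps flip: power_mult_distrib)
      also have "\<dots> < r * norm (\<Phi> X)" using X(2) r by simp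
      finally show ?thesis using r by (simp add: lin)
    qed
    ultimately show ?thesis by blast
  qed
  then obtain Y where Y: "\<And>n. positive_op (of_tc (Y n))" "\<And>n. norm (Y n) = (1/2)^n" "\<And>n. norm (\<Phi> (Y n)) > 2 ^ n"
    by metis
  have "summable (\<lambda>n. norm (Y n))" unfolding Y(2) by (rule summable_geometric) simp
  then have "summable Y" by (rule summable_norm_cancel)
  then have sums: "(\<lambda>N. \<Sum>n<N. Y n) \<longlonglongrightarrow> suminf Y" by (rule summable_LIMSEQ)
  \<comment> \<open>All remaining terms are positive, so the full sum dominates each
    \<open>Y n\<close>. Since \<Phi> preserves positivity, the trace of the image of the sum then
    exceeds every 2^n.\<close>
  have pos: "positive_op (of_tc (suminf Y - Y n))" for n
  proof -
    have "(\<lambda>N. (\<Sum>n<N. Y n) - Y n) \<longlonglongrightarrow> suminf Y - Y n" by (intro tendsto_intros sums)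
    moreover have "\<forall>\<^sub>F N in sequentially. (\<Sum>n<N. Y n) - Y n \<in> {T. positive_op (of_tc T)}"
      unfolding eventually_sequentially
    proof (intro exI allI impI)
      fix N assume "Suc n \<le> N"
      then have "(\<Sum>n<N. Y n) - Y n = (\<Sum>m\<in>{..<N} - {n}. Y m)" by (simp add: sum_diff1)
      moreover have "positive_op (of_tc (\<Sum>m\<in>M. Y m))" for M
        by (induction M rule: infinite_finite_induct)
          (use Y(1) in \<open>auto simp: zero_tc.rep_eq plus_tc.rep_eq positive_op_def cinner_add_right\<close>)
      ultimately show "(\<Sum>n<N. Y n) - Y n \<in> {T. positive_op (of_tc T)}" by simp
    qed
    ultimately have "suminf Y - Y n \<in> {T. positive_op (of_tc T)}"
      by (intro Lim_in_closed_set [OF closed_positive_tc]) auto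
    then show ?thesis by simp
  qed
  have ge: "2 ^ n < Re (tc_trace (\<Phi> (suminf Y)))" for n :: nat
  proof -
    have "0 \<le> norm (\<Phi> (suminf Y - Y n))" by simp
    also have "\<dots> = Re (tc_trace (\<Phi> (suminf Y - Y n)))"
      by (rule positive_tc_norm [OF CP_positive [OF \<Phi> pos]])
    also have "\<dots> = Re (tc_trace (\<Phi> (suminf Y))) - Re (tc_trace (\<Phi> (Y n)))"
      by (simp add: lin linear_simps [OF bounded_linear_tc_trace])
    also have "Re (tc_trace (\<Phi> (Y n))) = norm (\<Phi> (Y n))"
      by (rule positive_tc_norm [OF CP_positive [OF \<Phi> Y(1)], symmetric])
    finally show ?thesis using Y(3) [of n] by linarith
  qed
  obtain n :: nat where "Re (tc_trace (\<Phi> (suminf Y))) < 2 ^ n"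
    using real_arch_pow [of 2] by auto
  with ge [of n] show False by simp
qed

lemma CP_bounded_clinear:
  fixes \<Phi> :: "'a::chilbert_space tc \<Rightarrow> 'a tc"
  assumes \<Phi>: "\<Phi> \<in> CP"
  shows "bounded_clinear \<Phi>"
proof -
  note lin = CP_clinear [OF \<Phi>]
  obtain c where c: "c \<ge> 0" "\<And>X. positive_op (of_tc X) \<Longrightarrow> norm (\<Phi> X) \<le> c * norm X"
    using CP_bounded_positive [OF \<Phi>] by blast
  show ?thesis
  proof (rule bounded_clinearI [OF lin(1,2)])
    fix T :: "'a tc"
    obtain X Y Z W where p: "positive_op (of_tc X)" "positive_op (of_tc Y)" "positive_op (of_tc Z)" "positive_op (of_tc W)"
      and n: "norm X \<le> 4 * norm T" "norm Y \<le> 4 * norm T" "norm Z \<le> 4 * norm T" "norm W \<le> 4 * norm T"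
      and T: "T = (1/4) *\<^sub>C (X - Y) - (\<i>/4) *\<^sub>C (Z - W)"
      by (rule tc_positive_decomposition [of T])
    have b: "norm (\<Phi> V) \<le> 4 * (c * norm T)" if "positive_op (of_tc V)" "norm V \<le> 4 * norm T" for V
      using c(2) [OF that(1)] mult_left_mono [OF that(2) c(1)] by simp
    have "\<Phi> T = (1/4) *\<^sub>C (\<Phi> X - \<Phi> Y) - (\<i>/4) *\<^sub>C (\<Phi> Z - \<Phi> W)"
      by (subst T) (simp add: lin)
    then have "norm (\<Phi> T) \<le> norm ((1/4) *\<^sub>C (\<Phi> X - \<Phi> Y)) + norm ((\<i>/4) *\<^sub>C (\<Phi> Z - \<Phi> W))"
      by (simp only: norm_triangle_ineq4)
    also have "\<dots> = norm (\<Phi> X - \<Phi> Y) / 4 + norm (\<Phi> Z - \<Phi> W) / 4"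
      by (simp add: norm_scaleC norm_divide)
    also have "\<dots> \<le> (4 * c) * norm T"
      using norm_triangle_ineq4 [of "\<Phi> X" "\<Phi> Y"] norm_triangle_ineq4 [of "\<Phi> Z" "\<Phi> W"]
        b [OF p(1) n(1)] b [OF p(2) n(2)] b [OF p(3) n(3)] b [OF p(4) n(4)] by simp
    finally show "norm (\<Phi> T) \<le> (4 * c) * norm T" .
  qed
qed


section \<open>Complete positivity and the sesquilinear form\<close>

lemma bounded_bilinear_choi_form:
  assumes "bounded_clinear \<Psi>"
  shows "bounded_bilinear (choi_form \<Psi>)"
proof
  show "\<exists>K. \<forall>S T. norm (choi_form \<Psi> S T) \<le> norm S * norm T * K"
    using norm_choi_form [OF assms] by (intro exI [of _ "onorm \<Psi>"]) (simp add: mult_ac)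
qed (simp_all add: linear_simps [OF bounded_linear_choi_form(1) [OF assms]] linear_simps [OF bounded_linear_choi_form(2) [OF assms]])

lemma choi_form_finite_sum:
  assumes "bounded_clinear \<Psi>"
  shows "choi_form \<Psi> (\<Sum>i\<in>I. tc_rank_one (x i) (v i)) (\<Sum>i\<in>I. tc_rank_one (x i) (v i)) =
    (\<Sum>i\<in>I. \<Sum>j\<in>I. cinner (v i) (of_tc (\<Psi> (tc_rank_one (x i) (x j))) (v j)))"
  by (simp add: linear_sum [OF bounded_linear.linear [OF bounded_linear_choi_form(1) [OF assms]]]
      linear_sum [OF bounded_linear.linear [OF bounded_linear_choi_form(2) [OF assms]]] choi_form_rank_one [OF assms], rule sum.swap)

text \<open>If S is a finite sum of operators |a e><b e|, the blocks |a e><a f| form a positive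
  block operator, and the form at S is the quadratic form of its image at the vectors b e. Density
  and continuity of the form give the general case. The bijection \<open>h\<close> only renumbers,
  since blocks are indexed by naturals.\<close>

lemma CP_choi_form:
  fixes \<Phi> :: "'a::chilbert_space tc \<Rightarrow> 'a tc"
  assumes \<Phi>: "\<Phi> \<in> CP"
  shows "choi_form \<Phi> S S \<in> \<real>\<^sub>\<ge>\<^sub>0"
proof (rule tc_closed_induct [of "\<lambda>S. choi_form \<Phi> S S \<in> \<real>\<^sub>\<ge>\<^sub>0"])
  note bc = CP_bounded_clinear [OF \<Phi>]
  have "continuous_on UNIV (\<lambda>S. choi_form \<Phi> S S)"
    by (intro bounded_bilinear.continuous_on [OF bounded_bilinear_choi_form [OF bc]] continuous_on_id)
  then show "closed {S. choi_form \<Phi> S S \<in> \<real>\<^sub>\<ge>\<^sub>0}"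
    using closed_vimage [OF closed_nonneg_Reals_complex] by (simp add: vimage_def)
  fix F :: "'a set" and a b :: "'a \<Rightarrow> 'a"
  assume "finite F"
  then obtain h where h: "bij_betw h {..<card F} F"
    using ex_bij_betw_nat_finite atLeast0LessThan by metis
  have "block_positive (card F) (\<lambda>i j. tc_rank_one (a (h i)) (a (h j)))"
    unfolding block_positive_def
  proof
    fix v :: "nat \<Rightarrow> 'a"
    define z where "z = (\<Sum>j<card F. cinner (a (h j)) (v j))"
    have "cinner (v i) (of_tc (tc_rank_one (a (h i)) (a (h j))) (v j)) = cnj (cinner (a (h i)) (v i)) * cinner (a (h j)) (v j)" for i j
      by (simp add: tc_rank_one.rep_eq cinner_scaleC_right mult.commute flip: cinner_commute)
    then have "(\<Sum>i<card F. \<Sum>j<card F. cinner (v i) (of_tc (tc_rank_one (a (h i)) (a (h j))) (v j))) = cnj z * z"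
      by (simp add: z_def sum_product)
    then show "(\<Sum>i<card F. \<Sum>j<card F. cinner (v i) (of_tc (tc_rank_one (a (h i)) (a (h j))) (v j))) \<in> \<real>\<^sub>\<ge>\<^sub>0"
      by (simp only: cnj_mult_self_nonneg)
  qed
  then have "block_positive (card F) (\<lambda>i j. \<Phi> (tc_rank_one (a (h i)) (a (h j))))"
    using \<Phi> unfolding CP_def mem_Collect_eq by (elim conjE allE impE) assumption+
  then have "(\<Sum>i<card F. \<Sum>j<card F. cinner (b (h i)) (of_tc (\<Phi> (tc_rank_one (a (h i)) (a (h j)))) (b (h j)))) \<in> \<real>\<^sub>\<ge>\<^sub>0"
    unfolding block_positive_def by (rule spec)
  also have "(\<Sum>i<card F. \<Sum>j<card F. cinner (b (h i)) (of_tc (\<Phi> (tc_rank_one (a (h i)) (a (h j)))) (b (h j)))) =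
      (\<Sum>e\<in>F. \<Sum>f\<in>F. cinner (b e) (of_tc (\<Phi> (tc_rank_one (a e) (a f))) (b f)))"
    by (subst sum.reindex_bij_betw [OF h, symmetric], intro sum.cong refl, subst sum.reindex_bij_betw [OF h, symmetric], rule refl)
  finally show "choi_form \<Phi> (\<Sum>e\<in>F. tc_rank_one (a e) (b e)) (\<Sum>e\<in>F. tc_rank_one (a e) (b e)) \<in> \<real>\<^sub>\<ge>\<^sub>0"
    by (simp only: choi_form_finite_sum [OF bc])
qed

section \<open>Finite compressions\<close>

definition compression :: "'a set \<Rightarrow> 'a::chilbert_space tc \<Rightarrow> 'a tc" where
  "compression F S = (\<Sum>e\<in>F. \<Sum>f\<in>F. cinner e (of_tc S f) *\<^sub>C tc_rank_one e f)"

definition span_projection :: "'a set \<Rightarrow> 'a::chilbert_space bop" where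
  "span_projection F = (\<Sum>e\<in>F. rank_one e e)"

lemma bop_sum_apply: "bop_apply (\<Sum>i\<in>I. A i) x = (\<Sum>i\<in>I. bop_apply (A i) x)"
  by (induction I rule: infinite_finite_induct) auto

lemma span_projection_apply: "span_projection F x = (\<Sum>e\<in>F. cinner e x *\<^sub>C e)"
  by (simp add: span_projection_def bop_sum_apply)

lemma adj_span_projection: "adj (span_projection F) = span_projection F"
  by (rule bop_cinner_eqI)
    (simp add: span_projection_apply cinner_sum_left cinner_sum_right cinner_scaleC_left cinner_scaleC_right mult.commute
      flip: cinner_adj(1) cinner_commute)

lemma norm_span_projection:
  fixes F :: "'a::chilbert_space set"
  assumes "finite F" "F \<subseteq> some_onb"
  shows "norm (span_projection F) \<le> 1"
proof (rule norm_bop_bound)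
  fix x
  have "(norm (span_projection F x))\<^sup>2 = (\<Sum>e\<in>F. (cmod (cinner e x))\<^sup>2)"
    unfolding span_projection_apply
    using some_onb [where 'a = 'a] by (intro norm_orthonormal_sum [OF _ assms]) (simp add: is_onb_def)
  also have "\<dots> \<le> (norm x)\<^sup>2"
    using assms by (intro finite_sum_le_has_sum [OF parseval [OF some_onb]]) auto
  finally show "norm (span_projection F x) \<le> 1 * norm x" unfolding mult_1 by (rule power2_le_imp_le) simp
qed simp

lemma scaleC_sum_left: "(\<Sum>i\<in>I. c i) *\<^sub>C x = (\<Sum>i\<in>I. c i *\<^sub>C (x :: 'a::complex_vector))"
  by (induction I rule: infinite_finite_induct) (auto simp: scaleC_add_left)

lemma compression_eq:
  fixes S :: "'a::chilbert_space tc"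
  shows "compression F S = tc_lmult (span_projection F) (tc_rmult S (span_projection F))"
proof (rule tc_eqI)
  fix x :: 'a
  have s: "of_tc (\<Sum>i\<in>I. T i) x = (\<Sum>i\<in>I. of_tc (T i) x)" for I :: "'a set" and T
    by (rule linear_sum [OF bounded_linear.linear [OF bounded_linear_of_tc_apply]])
  show "of_tc (compression F S) x = of_tc (tc_lmult (span_projection F) (tc_rmult S (span_projection F))) x"
    by (simp add: compression_def s tc_lmult.rep_eq tc_rmult.rep_eq span_projection_apply bop_sum bop_linear
        scaleC_tc.rep_eq tc_rank_one.rep_eq scaleC_scaleC cinner_sum_right scaleC_sum_right cinner_scaleC_right)
      (subst sum.swap, simp add: scaleC_sum_left mult.commute)
qed

lemma norm_compression:
  assumes "finite F" "F \<subseteq> some_onb"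
  shows "norm (compression F S) \<le> norm S"
proof -
  have "norm (compression F S) \<le> norm (span_projection F) * (norm (span_projection F) * norm S)"
    unfolding compression_eq by (intro order_trans [OF norm_tc_lmult] mult_left_mono norm_tc_rmult) auto
  also have "\<dots> \<le> 1 * (1 * norm S)"
    using norm_span_projection [OF assms] by (intro mult_mono) auto
  finally show ?thesis by simp
qed

lemma bounded_linear_compression: "bounded_linear (compression F)"
  unfolding compression_eq [abs_def]
  by (rule bounded_linear_compose [OF bounded_linear_tc_lmult bounded_linear_tc_rmult])

lemma bounded_bilinear_tc_rank_one: "bounded_bilinear (tc_rank_one :: 'a::chilbert_space \<Rightarrow> 'a \<Rightarrow> 'a tc)"
proof
  show "\<exists>K. \<forall>a b :: 'a. norm (tc_rank_one a b) \<le> norm a * norm b * K"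
    using norm_tc_rank_one [where 'a = 'a] by (intro exI [of _ 1]) simp
qed (simp_all add: tc_rank_one_add scaleR_scaleC tc_rank_one_scaleC)

text \<open>Compressions are trace-norm contractions uniformly in F, so the operators on which they
  converge form a closed set. On rank-one operators the convergence is that of the projections
  applied to the two vectors; strong convergence of projections thus becomes convergence in trace
  norm.\<close>

lemma tendsto_compression:
  fixes S :: "'a::chilbert_space tc"
  shows "((\<lambda>F. compression F S) \<longlongrightarrow> S) (finite_subsets_at_top some_onb)"
proof (rule tc_closed_induct [of "\<lambda>S. ((\<lambda>F. compression F S) \<longlongrightarrow> S) (finite_subsets_at_top some_onb)"])
  show "closed {S :: 'a tc. ((\<lambda>F. compression F S) \<longlongrightarrow> S) (finite_subsets_at_top some_onb)}"
    unfolding closed_sequential_limits mem_Collect_eq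
  proof (intro allI impI, elim conjE)
    fix X :: "nat \<Rightarrow> 'a tc" and S
    assume X: "\<forall>n. ((\<lambda>F. compression F (X n)) \<longlongrightarrow> X n) (finite_subsets_at_top some_onb)" and S: "X \<longlonglongrightarrow> S"
    show "((\<lambda>F. compression F S) \<longlongrightarrow> S) (finite_subsets_at_top some_onb)"
    proof (rule tendstoI)
      fix e :: real assume e: "e > 0"
      then have "\<forall>\<^sub>F n in sequentially. dist (X n) S < e / 3" using S by (intro tendstoD) auto
      then obtain n where n: "dist (X n) S < e / 3" using eventually_happens trivial_limit_sequentially by blast
      have "\<forall>\<^sub>F F in finite_subsets_at_top some_onb. dist (compression F (X n)) (X n) < e / 3"
        using X e by (intro tendstoD) auto
      moreover have "\<forall>\<^sub>F F in finite_subsets_at_top (some_onb :: 'a set). finite F \<and> F \<subseteq> some_onb"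
        by (rule eventually_finite_subsets_at_top_weakI) simp
      ultimately show "\<forall>\<^sub>F F in finite_subsets_at_top some_onb. dist (compression F S) S < e"
      proof eventually_elim
        case (elim F)
        have "dist (compression F S) (compression F (X n)) \<le> dist S (X n)"
          using norm_compression [of F "S - X n"] elim by (simp add: dist_norm linear_simps [OF bounded_linear_compression])
        then show ?case
          using elim n dist_triangle [of "compression F S" S "compression F (X n)"]
            dist_triangle [of "compression F (X n)" S "X n"] by (simp add: dist_commute)
      qed
    qed
  qed
  fix G :: "'a set" and a b :: "'a \<Rightarrow> 'a"
  have p: "((\<lambda>F. span_projection F x) \<longlongrightarrow> x) (finite_subsets_at_top some_onb)" for x :: 'a
    using onb_expand [OF some_onb, of x] by (simp add: has_sum_def span_projection_apply)
  have c: "compression F (\<Sum>e\<in>G. tc_rank_one (a e) (b e)) =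
      (\<Sum>e\<in>G. tc_rank_one (span_projection F (a e)) (span_projection F (b e)))" for F
    by (simp add: linear_sum [OF bounded_linear.linear [OF bounded_linear_compression]])
      (simp add: compression_eq adj_span_projection)
  show "((\<lambda>F. compression F (\<Sum>e\<in>G. tc_rank_one (a e) (b e))) \<longlongrightarrow> (\<Sum>e\<in>G. tc_rank_one (a e) (b e)))
      (finite_subsets_at_top some_onb)"
    unfolding c by (intro tendsto_sum bounded_bilinear.tendsto [OF bounded_bilinear_tc_rank_one] p)
qed

text \<open>After compression to F, the quadratic form of the array \<Phi>(X i j) is the sum of all
  entries of an entrywise product of two matrices indexed by pairs (i, e): one holds the
  coefficients of X, the other the form of \<Phi>. Both are positive semidefinite, so
  \<open>positive_kernel_schur\<close> applies, and the limit over F removes the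
  compression.\<close>

lemma CP_if_choi_form_nonneg:
  fixes \<Phi> :: "'a::chilbert_space tc \<Rightarrow> 'a tc"
  assumes bc: "bounded_clinear \<Phi>" and q: "\<And>S. choi_form \<Phi> S S \<in> \<real>\<^sub>\<ge>\<^sub>0"
  shows "\<Phi> \<in> CP"
  unfolding CP_def
proof (intro CollectI conjI allI impI)
  note simps = bounded_clinear_simps [OF bc]
  show "clinear \<Phi>" by (simp add: clinear_def simps)
  fix n :: nat and X :: "nat \<Rightarrow> nat \<Rightarrow> 'a tc"
  assume X: "block_positive n X"
  show "block_positive n (\<lambda>i j. \<Phi> (X i j))"
    unfolding block_positive_def
  proof
    fix v :: "nat \<Rightarrow> 'a"
    define g where "g i j T = cinner (v i) (of_tc (\<Phi> T) (v j))" for i j T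
    have gb: "bounded_linear (g i j)" for i j
      unfolding g_def by (intro bounded_linear_compose [OF bounded_linear_cinner_right]
          bounded_linear_compose [OF bounded_linear_of_tc_apply bounded_clinear_bounded_linear [OF bc]])
    have gc: "g i j (c *\<^sub>C T) = c * g i j T" for i j c T
      by (simp add: g_def simps scaleC_tc.rep_eq cinner_scaleC_right)
    have pos: "(\<Sum>i<n. \<Sum>j<n. g i j (compression F (X i j))) \<in> \<real>\<^sub>\<ge>\<^sub>0" if F: "finite F" for F
    proof -
      define A where "A a b = cinner (snd a) (of_tc (X (fst a) (fst b)) (snd b))" for a b :: "nat \<times> 'a"
      define B where "B a b = g (fst a) (fst b) (tc_rank_one (snd a) (snd b))" for a b :: "nat \<times> 'a"
      let ?I = "{..<n} \<times> F"
      have "positive_kernel ?I A"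
        unfolding positive_kernel_def
      proof
        fix c :: "nat \<times> 'a \<Rightarrow> complex"
        define w where "w i = (\<Sum>e\<in>F. c (i, e) *\<^sub>C e)" for i
        have "(\<Sum>a\<in>?I. \<Sum>b\<in>?I. cnj (c a) * A a b * c b) =
            (\<Sum>i<n. \<Sum>e\<in>F. \<Sum>j<n. \<Sum>f\<in>F. cnj (c (i, e)) * cinner e (of_tc (X i j) f) * c (j, f))"
          by (simp add: sum.cartesian_product' A_def)
        also have "\<dots> = (\<Sum>i<n. \<Sum>j<n. \<Sum>e\<in>F. \<Sum>f\<in>F. cnj (c (i, e)) * cinner e (of_tc (X i j) f) * c (j, f))"
          by (intro sum.cong refl sum.swap)
        also have "\<dots> = (\<Sum>i<n. \<Sum>j<n. cinner (w i) (of_tc (X i j) (w j)))"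
          by (intro sum.cong refl) (simp add: w_def cinner_sum_left cinner_sum_right bop_sum bop_linear
              cinner_scaleC_left cinner_scaleC_right sum_distrib_left mult_ac, rule sum.swap)
        also have "\<dots> \<in> \<real>\<^sub>\<ge>\<^sub>0" using X unfolding block_positive_def by (rule spec)
        finally show "(\<Sum>a\<in>?I. \<Sum>b\<in>?I. cnj (c a) * A a b * c b) \<in> \<real>\<^sub>\<ge>\<^sub>0" .
      qed
      moreover have "positive_kernel ?I B"
        unfolding positive_kernel_def
      proof
        fix c :: "nat \<times> 'a \<Rightarrow> complex"
        \<comment> \<open>The coefficients enter conjugated because \<open>choi_form\<close> is
          linear in its first argument, whereas \<open>positive_kernel\<close> conjugates the
          coefficient of the first index.\<close>
        have "(\<Sum>a\<in>?I. \<Sum>b\<in>?I. cnj (c a) * B a b * c b) =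
          choi_form \<Phi> (\<Sum>a\<in>?I. tc_rank_one (cnj (c a) *\<^sub>C snd a) (v (fst a))) (\<Sum>a\<in>?I. tc_rank_one (cnj (c a) *\<^sub>C snd a) (v (fst a)))"
          unfolding choi_form_finite_sum [OF bc]
          by (intro sum.cong refl) (simp add: B_def g_def tc_rank_one_scaleC simps scaleC_tc.rep_eq cinner_scaleC_right mult_ac)
        then show "(\<Sum>a\<in>?I. \<Sum>b\<in>?I. cnj (c a) * B a b * c b) \<in> \<real>\<^sub>\<ge>\<^sub>0" by (simp only: q)
      qed
      ultimately have "(\<Sum>a\<in>?I. \<Sum>b\<in>?I. A a b * B a b) \<in> \<real>\<^sub>\<ge>\<^sub>0"
        using F by (intro positive_kernel_schur) auto
      also have "(\<Sum>a\<in>?I. \<Sum>b\<in>?I. A a b * B a b) = (\<Sum>i<n. \<Sum>e\<in>F. \<Sum>j<n. \<Sum>f\<in>F. cinner e (of_tc (X i j) f) * g i j (tc_rank_one e f))"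
        by (simp add: sum.cartesian_product' A_def B_def)
      also have "\<dots> = (\<Sum>i<n. \<Sum>j<n. \<Sum>e\<in>F. \<Sum>f\<in>F. cinner e (of_tc (X i j) f) * g i j (tc_rank_one e f))"
        by (intro sum.cong refl sum.swap)
      also have "\<dots> = (\<Sum>i<n. \<Sum>j<n. g i j (compression F (X i j)))"
        by (simp add: compression_def linear_sum [OF bounded_linear.linear [OF gb]] gc)
      finally show ?thesis .
    qed
    have lim: "((\<lambda>F. \<Sum>i<n. \<Sum>j<n. g i j (compression F (X i j))) \<longlongrightarrow> (\<Sum>i<n. \<Sum>j<n. g i j (X i j))) (finite_subsets_at_top some_onb)"
      by (intro tendsto_sum bounded_linear.tendsto [OF gb] tendsto_compression)
    have "(\<Sum>i<n. \<Sum>j<n. g i j (X i j)) \<in> \<real>\<^sub>\<ge>\<^sub>0"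
      by (rule Lim_in_closed_set [OF closed_nonneg_Reals_complex _ _ lim])
        (auto intro!: eventually_finite_subsets_at_top_weakI pos)
    then show "(\<Sum>i<n. \<Sum>j<n. cinner (v i) (of_tc (\<Phi> (X i j)) (v j))) \<in> \<real>\<^sub>\<ge>\<^sub>0" by (simp add: g_def)
  qed
qed

section \<open>The dual map\<close>

lemma dual_map_exists:
  fixes \<Phi> :: "'a::chilbert_space tc \<Rightarrow> 'a tc"
  assumes bc: "bounded_clinear \<Phi>"
  shows "bounded_clinear (dual_map \<Phi>) \<and>
    (\<forall>A C. op_trace (of_tc (\<Phi> A) * C) = op_trace (of_tc A * dual_map \<Phi> C))"
proof -
  note bl = bounded_clinear_bounded_linear [OF bc] and simps = bounded_clinear_simps [OF bc]
  \<comment> \<open>Rank-one operators separate the bounded operators; this gives the uniqueness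
    behind \<open>dual_map\<close> and also the linearity of the chosen \<open>Y\<close>.\<close>
  have uniq: "Y = Z" if "\<And>A :: 'a tc. tc_trace (tc_rmult A Y) = tc_trace (tc_rmult A Z)" for Y Z
    by (rule bop_cinner_eqI) (use that [of "tc_rank_one _ _"] in \<open>simp add: cinner_adj\<close>)
  have tr: "op_trace (of_tc A * C) = tc_trace (tc_rmult A C)" for A :: "'a tc" and C
    by (simp add: tc_trace.rep_eq tc_rmult.rep_eq)
  have "\<exists>Y. (\<forall>A. tc_trace (tc_rmult (\<Phi> A) C) = tc_trace (tc_rmult A Y)) \<and> norm Y \<le> norm C * onorm \<Phi>" for C
  proof -
    have "bounded_linear (\<lambda>A. tc_trace (tc_rmult (\<Phi> A) C))"
      by (intro bounded_linear_compose [OF bounded_linear_tc_trace] bounded_linear_compose [OF bounded_linear_tc_rmult] bl)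
    moreover have "tc_trace (tc_rmult (\<Phi> (c *\<^sub>C x)) C) = c * tc_trace (tc_rmult (\<Phi> x) C)" for c x
      by (simp add: simps bounded_clinear_simps [OF bounded_clinear_tc_rmult] tc_trace_scaleC)
    moreover have "cmod (tc_trace (tc_rmult (\<Phi> T) C)) \<le> norm C * onorm \<Phi> * norm T" for T
    proof -
      have "cmod (tc_trace (tc_rmult (\<Phi> T) C)) \<le> norm C * norm (\<Phi> T)"
        by (rule order_trans [OF norm_tc_trace norm_tc_rmult])
      also have "\<dots> \<le> norm C * (onorm \<Phi> * norm T)" by (intro mult_left_mono onorm [OF bl]) auto
      finally show ?thesis by simp
    qed
    moreover have "0 \<le> norm C * onorm \<Phi>" using onorm_pos_le [OF bl] by simp
    ultimately obtain Y where "\<And>A. tc_trace (tc_rmult (\<Phi> A) C) = tc_trace (tc_lmult Y A)" "norm Y \<le> norm C * onorm \<Phi>"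
      by (rule tc_dual_representation [of "\<lambda>A. tc_trace (tc_rmult (\<Phi> A) C)"]) blast
    then show ?thesis by (auto simp: tc_trace_cyclic)
  qed
  then obtain Y where Y: "\<And>A C. tc_trace (tc_rmult (\<Phi> A) C) = tc_trace (tc_rmult A (Y C))" "\<And>C. norm (Y C) \<le> norm C * onorm \<Phi>"
    by metis
  have ra: "tc_rmult A (C + D) = tc_rmult A C + tc_rmult A D" "tc_rmult A (c *\<^sub>C C) = c *\<^sub>C tc_rmult A C" for A :: "'a tc" and C D c
    by (rule tc_eqI; simp add: tc_rmult.rep_eq plus_tc.rep_eq scaleC_tc.rep_eq bop_linear)+
  have Yb: "bounded_clinear Y"
  proof (rule bounded_clinearI [where K = "onorm \<Phi>"])
    show "Y (C + D) = Y C + Y D" for C D by (rule uniq) (simp add: ra tc_trace_add flip: Y(1))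
    show "Y (c *\<^sub>C C) = c *\<^sub>C Y C" for c C by (rule uniq) (simp add: ra tc_trace_scaleC flip: Y(1))
  qed (use Y(2) in \<open>simp add: mult.commute\<close>)
  have "\<exists>!\<Psi>. bounded_clinear \<Psi> \<and> (\<forall>A C. op_trace (of_tc (\<Phi> A) * C) = op_trace (of_tc A * \<Psi> C))"
    unfolding tr
  proof (rule ex1I [of _ Y])
    show "bounded_clinear Y \<and> (\<forall>A C. tc_trace (tc_rmult (\<Phi> A) C) = tc_trace (tc_rmult A (Y C)))"
      using Yb Y(1) by simp
    show "\<Psi> = Y" if "bounded_clinear \<Psi> \<and> (\<forall>A C. tc_trace (tc_rmult (\<Phi> A) C) = tc_trace (tc_rmult A (\<Psi> C)))" for \<Psi>
      using that Y(1) by (intro ext uniq) metis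
  qed
  from theI' [OF this] show ?thesis unfolding dual_map_def .
qed

lemma dual_map_one:
  assumes "bounded_clinear \<Phi>"
  shows "tc_trace (\<Phi> A) = tc_trace (tc_rmult A (dual_map \<Phi> 1))"
  using dual_map_exists [OF assms] by (metis mult_1_right tc_trace.rep_eq tc_rmult.rep_eq)

text \<open>The quadratic form of \<open>dual_map \<Phi> 1\<close> at x is the trace of
  \<Phi>(|x><x|), a positive operator.\<close>

lemma dual_map_one_self_adj:
  fixes \<Phi> :: "'a::chilbert_space tc \<Rightarrow> 'a tc"
  assumes \<Phi>: "\<Phi> \<in> CP"
  shows "adj (dual_map \<Phi> 1) = dual_map \<Phi> 1"
proof (rule positive_op_self_adj)
  show "positive_op (dual_map \<Phi> 1)"
    unfolding positive_op_def
  proof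
    fix x :: 'a
    have "positive_op (of_tc (tc_rank_one x x))"
      by (simp add: positive_op_def tc_rank_one.rep_eq cinner_scaleC_right)
        (metis cinner_commute cnj_mult_self_nonneg mult.commute)
    then have p: "positive_op (of_tc (\<Phi> (tc_rank_one x x)))" by (rule CP_positive [OF \<Phi>])
    have "tc_trace (\<Phi> (tc_rank_one x x)) = cnj (tc_trace (\<Phi> (tc_rank_one x x)))"
      using positive_op_self_adj [OF p] tc_trace_adj by (metis of_tc_inject tc_adj.rep_eq)
    moreover have "Re (tc_trace (\<Phi> (tc_rank_one x x))) \<ge> 0"
      using positive_tc_norm [OF p] by (metis norm_ge_zero)
    ultimately have "tc_trace (\<Phi> (tc_rank_one x x)) \<in> \<real>\<^sub>\<ge>\<^sub>0"
      by (simp add: complex_nonneg_Reals_iff complex_eq_iff)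
    then show "cinner x (dual_map \<Phi> 1 x) \<in> \<real>\<^sub>\<ge>\<^sub>0"
      by (simp add: dual_map_one [OF CP_bounded_clinear [OF \<Phi>]] cinner_adj)
  qed
qed


section \<open>The exponential as a limit of Euler steps\<close>

lemma norm_funpow_le:
  fixes L :: "'a::real_normed_vector \<Rightarrow> 'a"
  assumes "\<And>x. norm (L x) \<le> K * norm x" "0 \<le> K"
  shows "norm ((L ^^ n) x) \<le> K ^ n * norm x"
proof (induction n)
  case (Suc n)
  have "norm ((L ^^ Suc n) x) \<le> K * norm ((L ^^ n) x)" using assms(1) by simp
  also have "\<dots> \<le> K * (K ^ n * norm x)" using Suc assms(2) by (rule mult_left_mono)
  finally show ?case by (simp add: mult.assoc)
qed simp

lemma funpow_scaleR:
  fixes L :: "'a::real_vector \<Rightarrow> 'a"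
  assumes "linear L"
  shows "((\<lambda>x. t *\<^sub>R L x) ^^ n) x = t ^ n *\<^sub>R (L ^^ n) x"
  by (induction n) (simp_all add: linear_scale [OF assms])

lemma exp_sums:
  fixes L :: "'a::banach \<Rightarrow> 'a"
  assumes L: "bounded_linear L"
  shows "(\<lambda>n. (t ^ n / fact n) *\<^sub>R (L ^^ n) x) sums blinfun_apply (blinfun_exp (t *\<^sub>R Blinfun L)) x"
proof -
  define B where "B = t *\<^sub>R Blinfun L"
  define P where "P n = (((o\<^sub>L) B) ^^ n) id_blinfun" for n
  have B: "blinfun_apply B = (\<lambda>x. t *\<^sub>R L x)"
    by (rule ext) (simp add: B_def scaleR_blinfun.rep_eq bounded_linear_Blinfun_apply [OF L])
  have Pn: "norm (P n) \<le> norm B ^ n" for n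
  proof (induction n)
    case 0
    show ?case by (simp add: P_def norm_blinfun_id_le)
  next
    case (Suc n)
    have "norm (P (Suc n)) \<le> norm B * norm (P n)" by (simp add: P_def norm_blinfun_compose)
    also have "\<dots> \<le> norm B * norm B ^ n" by (rule mult_left_mono [OF Suc]) simp
    finally show ?case by simp
  qed
  have Px: "blinfun_apply (P n) x = t ^ n *\<^sub>R (L ^^ n) x" for n x
  proof -
    have "blinfun_apply (P n) x = (blinfun_apply B ^^ n) x"
      by (induction n) (simp_all add: P_def)
    then show ?thesis by (simp add: B funpow_scaleR bounded_linear.linear [OF L])
  qed
  have "summable (\<lambda>n. (1 / fact n) *\<^sub>R P n)"
  proof (rule summable_comparison_test')
    show "summable (\<lambda>n. inverse (fact n) * norm B ^ n)" by (rule summable_exp)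
    show "norm ((1 / fact n) *\<^sub>R P n) \<le> inverse (fact n) * norm B ^ n" for n
      using Pn [of n] by (simp add: divide_simps)
  qed
  then have "(\<lambda>n. (1 / fact n) *\<^sub>R P n) sums blinfun_exp B"
    unfolding blinfun_exp_def P_def by (rule summable_sums)
  then have "(\<lambda>n. blinfun_apply ((1 / fact n) *\<^sub>R P n) x) sums blinfun_apply (blinfun_exp B) x"
    by (rule bounded_linear.sums [OF blinfun.bounded_linear_left])
  then show ?thesis by (simp add: scaleR_blinfun.rep_eq Px B_def)
qed

lemma exp_first_order:
  fixes L :: "'a::banach \<Rightarrow> 'a"
  assumes L: "bounded_linear L"
  obtains C where "0 \<le> C" "\<And>t x. 0 \<le> t \<Longrightarrow> t \<le> 1 \<Longrightarrow>
    norm (blinfun_apply (blinfun_exp (t *\<^sub>R Blinfun L)) x - x - t *\<^sub>R L x) \<le> C * t\<^sup>2 * norm x"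
proof -
  define K where "K = onorm L"
  have K: "0 \<le> K" "\<And>x. norm (L x) \<le> K * norm x" by (simp_all add: K_def onorm_pos_le [OF L] onorm [OF L])
  \<comment> \<open>The scalar exponential series without its terms of order 0 and 1. For t between
    0 and 1, a factor t^2 can be taken out of every remaining term, so the sum of h serves as the
    constant.\<close>
  define h where "h n = K ^ (n + 2) / fact (n + 2)" for n
  have hs: "summable h"
    using summable_ignore_initial_segment [OF summable_exp [of K], of 2] by (simp add: h_def [abs_def] divide_inverse mult.commute)
  have h0: "0 \<le> h n" for n using K by (simp add: h_def)
  show ?thesis
  proof (rule that [of "suminf h"])
    show "0 \<le> suminf h" by (rule suminf_nonneg [OF hs h0])
    fix t :: real and x assume t: "0 \<le> t" "t \<le> 1"
    define a where "a n = (t ^ n / fact n) *\<^sub>R (L ^^ n) x" for n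
    have "a sums blinfun_apply (blinfun_exp (t *\<^sub>R Blinfun L)) x"
      unfolding a_def by (rule exp_sums [OF L])
    then have s: "(\<lambda>n. a (n + 2)) sums (blinfun_apply (blinfun_exp (t *\<^sub>R Blinfun L)) x - (\<Sum>i<2. a i))"
      by (rule sums_split_initial_segment)
    have eq: "blinfun_apply (blinfun_exp (t *\<^sub>R Blinfun L)) x - x - t *\<^sub>R L x = (\<Sum>n. a (n + 2))"
      using sums_unique [OF s] by (simp add: a_def numeral_2_eq_2 algebra_simps)
    have le: "norm (a (n + 2)) \<le> h n * (t\<^sup>2 * norm x)" for n
    proof -
      have "t ^ (n + 2) \<le> t\<^sup>2" using power_le_one [OF t, of n] mult_right_mono [of "t ^ n" 1 "t\<^sup>2"] t by (simp only: power_add mult_1) simp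
      have "norm (a (n + 2)) = t ^ (n + 2) / fact (n + 2) * norm ((L ^^ (n + 2)) x)"
        unfolding a_def norm_scaleR using t by simp
      also have "\<dots> \<le> t\<^sup>2 / fact (n + 2) * (K ^ (n + 2) * norm x)"
        by (intro mult_mono divide_right_mono \<open>t ^ (n + 2) \<le> t\<^sup>2\<close> norm_funpow_le K) auto
      finally show ?thesis by (simp add: h_def mult_ac)
    qed
    have "norm (\<Sum>n. a (n + 2)) \<le> (\<Sum>n. h n * (t\<^sup>2 * norm x))"
      by (rule norm_suminf_le [OF le summable_mult2 [OF hs]])
    also have "\<dots> = suminf h * t\<^sup>2 * norm x" using suminf_mult2 [OF hs, of "t\<^sup>2 * norm x"] by (simp only: mult.assoc)
    finally show "norm (blinfun_apply (blinfun_exp (t *\<^sub>R Blinfun L)) x - x - t *\<^sub>R L x) \<le> suminf h * t\<^sup>2 * norm x"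
      unfolding eq .
  qed
qed

lemma funpow_binomial:
  fixes A :: "'a::real_vector \<Rightarrow> 'a"
  assumes A: "linear A"
  shows "((\<lambda>x. x + r *\<^sub>R A x) ^^ n) x = (\<Sum>k\<le>n. (real (n choose k) * r ^ k) *\<^sub>R (A ^^ k) x)"
proof (induction n)
  case (Suc n)
  define c where "c n k = (real (n choose k) * r ^ k) *\<^sub>R (A ^^ k) x" for n k
  have "(\<Sum>k\<le>n. c n k) + r *\<^sub>R A (\<Sum>k\<le>n. c n k) = (\<Sum>k\<le>Suc n. c n k) + (\<Sum>k\<le>n. r *\<^sub>R A (c n k))"
    by (simp add: c_def linear_sum [OF A] scaleR_sum_right)
  also have "\<dots> = c n 0 + (\<Sum>k\<le>n. c n (Suc k) + r *\<^sub>R A (c n k))"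
    by (simp only: sum.atMost_Suc_shift sum.distrib add.assoc)
  also have "\<dots> = c (Suc n) 0 + (\<Sum>k\<le>n. c (Suc n) (Suc k))"
    by (simp add: c_def linear_scale [OF A] algebra_simps)
  also have "\<dots> = (\<Sum>k\<le>Suc n. c (Suc n) k)" by (simp only: sum.atMost_Suc_shift)
  finally show ?case using Suc by (simp add: c_def)
qed simp

lemma choose_over_power_tendsto: "(\<lambda>n. real (n choose k) / real n ^ k) \<longlonglongrightarrow> 1 / fact k"
proof -
  have e: "real (n choose k) / real n ^ k = (\<Prod>i=0..<k. 1 - real i * inverse (real n)) / fact k" if "n > 0" for n
  proof -
    have "real (n choose k) = (\<Prod>i=0..<k. real n - real i) / fact k"
      by (simp add: binomial_gbinomial gbinomial_prod_rev)
    then have "real (n choose k) / real n ^ k = (\<Prod>i=0..<k. (real n - real i) / real n) / fact k"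
      by (simp add: prod_dividef)
    also have "(\<Prod>i=0..<k. (real n - real i) / real n) = (\<Prod>i=0..<k. 1 - real i * inverse (real n))"
      using that by (intro prod.cong refl) (simp add: field_simps)
    finally show ?thesis .
  qed
  have "(\<lambda>n. (\<Prod>i=0..<k. 1 - real i * inverse (real n)) / fact k) \<longlonglongrightarrow> (\<Prod>i=0..<k. 1 - real i * 0) / fact k"
    by (intro tendsto_intros lim_inverse_n) simp
  then have "(\<lambda>n. (\<Prod>i=0..<k. 1 - real i * inverse (real n)) / fact k) \<longlonglongrightarrow> 1 / fact k" by simp
  then show ?thesis
    by (rule Lim_transform_eventually) (use e in \<open>auto simp: eventually_sequentially intro!: exI [of _ 1]\<close>)
qed

text \<open>The second-order term R leaves room for steps that are completely positive, which agree
  with 1 + (t/n) L only to first order. A step has the shape 1 + (1/n) A with A = tL + (t^2/n) R,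
  and its n-th power expands binomially. Each term converges and the k-th is dominated by c^k / k!
  times the norm of x, so the limit may be taken termwise.\<close>

lemma euler_limit:
  fixes L R :: "'a::banach \<Rightarrow> 'a"
  assumes L: "bounded_linear L" and R: "bounded_linear R"
  shows "(\<lambda>n. ((\<lambda>x. x + (t / real n) *\<^sub>R L x + (t / real n)\<^sup>2 *\<^sub>R R x) ^^ n) x)
    \<longlonglongrightarrow> blinfun_apply (blinfun_exp (t *\<^sub>R Blinfun L)) x"
proof -
  define A where "A n x = t *\<^sub>R L x + (t\<^sup>2 * inverse (real n)) *\<^sub>R R x" for n x
  have Al: "linear (A n)" for n
    unfolding A_def by (intro bounded_linear.linear bounded_linear_add bounded_linear_compose [OF bounded_linear_scaleR_right] L R)
  have step: "(\<lambda>x. x + (t / real n) *\<^sub>R L x + (t / real n)\<^sup>2 *\<^sub>R R x) = (\<lambda>x. x + (1 / real n) *\<^sub>R A n x)" for n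
    by (rule ext) (simp add: A_def algebra_simps divide_inverse power2_eq_square)
  define c where "c = \<bar>t\<bar> * onorm L + t\<^sup>2 * onorm R"
  have c: "0 \<le> c" using onorm_pos_le [OF L] onorm_pos_le [OF R] by (simp add: c_def)
  have An: "norm (A n x) \<le> c * norm x" for n x
  proof -
    have i: "inverse (real n) \<le> 1" by (cases n) (simp_all add: inverse_le_1_iff)
    have "norm (A n x) \<le> \<bar>t\<bar> * norm (L x) + t\<^sup>2 * inverse (real n) * norm (R x)"
      unfolding A_def by (rule order_trans [OF norm_triangle_ineq]) (simp add: abs_mult)
    also have "\<dots> \<le> \<bar>t\<bar> * (onorm L * norm x) + t\<^sup>2 * 1 * (onorm R * norm x)"
      using i by (intro add_mono mult_mono onorm [OF L] onorm [OF R]) auto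
    finally show ?thesis by (simp add: c_def algebra_simps)
  qed
  have Alim: "(\<lambda>n. (A n ^^ k) x) \<longlonglongrightarrow> t ^ k *\<^sub>R (L ^^ k) x" for k
  proof (induction k)
    case (Suc k)
    have "(\<lambda>n. A n ((A n ^^ k) x)) \<longlonglongrightarrow> t *\<^sub>R L (t ^ k *\<^sub>R (L ^^ k) x) + (t\<^sup>2 * 0) *\<^sub>R R (t ^ k *\<^sub>R (L ^^ k) x)"
      unfolding A_def [of _ "(A _ ^^ k) x"]
      by (intro tendsto_intros lim_inverse_n bounded_linear.tendsto [OF L] bounded_linear.tendsto [OF R] Suc)
    then show ?case by (simp add: linear_scale [OF bounded_linear.linear [OF L]])
  qed simp
  define f where "f k n = (real (n choose k) / real n ^ k) *\<^sub>R (A n ^^ k) x" for k n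
  have pw: "((\<lambda>x. x + (1 / real n) *\<^sub>R A n x) ^^ n) x = (\<Sum>k. f k n)" for n
  proof -
    have "(\<Sum>k. f k n) = (\<Sum>k\<le>n. f k n)" by (rule suminf_finite) (auto simp: f_def)
    then show ?thesis by (simp add: funpow_binomial [OF Al] f_def power_divide)
  qed
  define h where "h k = inverse (fact k) * c ^ k * norm x" for k
  have hs: "summable h" unfolding h_def by (intro summable_mult2 summable_exp)
  have fb: "norm (f k n) \<le> h k" for k n
  proof -
    have "real ((n choose k) * fact k) \<le> real (n ^ k)" by (simp only: of_nat_le_iff binomial_fact_pow)
    moreover have "a / d \<le> inverse f" if "a * f \<le> d" "0 \<le> d" "0 < f" for a d f :: real
      using that by (cases "d = 0") (auto simp: field_simps)
    ultimately have b: "real (n choose k) / real n ^ k \<le> inverse (fact k)" by simp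
    have "norm (f k n) = (real (n choose k) / real n ^ k) * norm ((A n ^^ k) x)" by (simp add: f_def)
    also have "\<dots> \<le> inverse (fact k) * (c ^ k * norm x)"
      by (intro mult_mono b norm_funpow_le An c) auto
    finally show ?thesis by (simp add: h_def mult.assoc)
  qed
  have fl: "(\<lambda>n. f k n) \<longlonglongrightarrow> (t ^ k / fact k) *\<^sub>R (L ^^ k) x" for k
    using tendsto_scaleR [OF choose_over_power_tendsto Alim, of k k] by (simp add: f_def)
  define b where "b k = (t ^ k / fact k) *\<^sub>R (L ^^ k) x" for k
  have bb: "norm (b k) \<le> h k" for k
    by (rule LIMSEQ_le_const2 [OF tendsto_norm [OF fl [of k, folded b_def]]]) (use fb in blast)
  have sums: "summable (\<lambda>k. f k n)" "summable b" for n
    by (rule summable_comparison_test' [OF hs fb], rule summable_comparison_test' [OF hs bb])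
  have le: "norm (f k n - b k) \<le> 2 * h k" for k n
    using norm_triangle_ineq4 [of "f k n" "b k"] fb [of k n] bb [of k] by simp
  \<comment> \<open>Tannery's theorem is applied to the real series of norms, which bounds the
    difference of the two vector-valued series.\<close>
  have "(\<lambda>n. \<Sum>k. norm (f k n - b k)) \<longlonglongrightarrow> (\<Sum>k::nat. 0)"
  proof (rule tannerys_theorem [where M = "\<lambda>k. 2 * h k", THEN conjunct2, THEN conjunct2])
    show "(\<lambda>n. norm (f k n - b k)) \<longlonglongrightarrow> 0" for k
      using fl [of k, folded b_def] by (simp add: LIM_zero tendsto_norm_zero)
    show "\<forall>\<^sub>F (k, n) in at_top \<times>\<^sub>F sequentially. norm (norm (f k n - b k)) \<le> 2 * h k"
      using le by (intro always_eventually) auto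
  qed (use hs in \<open>auto intro: summable_mult\<close>)
  then have "(\<lambda>n. \<Sum>k. norm (f k n - b k)) \<longlonglongrightarrow> 0" by simp
  then have "(\<lambda>n. (\<Sum>k. f k n) - suminf b) \<longlonglongrightarrow> 0"
  proof (rule Lim_null_comparison [rotated])
    have "norm ((\<Sum>k. f k n) - suminf b) \<le> (\<Sum>k. norm (f k n - b k))" for n
    proof -
      have "summable (\<lambda>k. norm (f k n - b k))"
        by (rule summable_comparison_test' [OF summable_mult [OF hs, of 2]]) (use le in simp)
      then show ?thesis using summable_norm [of "\<lambda>k. f k n - b k"] by (simp add: suminf_diff [OF sums, symmetric])
    qed
    then show "\<forall>\<^sub>F n in sequentially. norm ((\<Sum>k. f k n) - suminf b) \<le> (\<Sum>k. norm (f k n - b k))" by simp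
  qed
  then have "(\<lambda>n. \<Sum>k. f k n) \<longlonglongrightarrow> (\<Sum>k. (t ^ k / fact k) *\<^sub>R (L ^^ k) x)"
    unfolding b_def by (simp add: LIM_zero_iff)
  also have "(\<Sum>k. (t ^ k / fact k) *\<^sub>R (L ^^ k) x) = blinfun_apply (blinfun_exp (t *\<^sub>R Blinfun L)) x"
    by (rule sums_unique [OF exp_sums [OF L], symmetric])
  finally show ?thesis unfolding step pw .
qed


section \<open>Generators\<close>

lemma block_positive_add:
  assumes "block_positive n X" "block_positive n Y"
  shows "block_positive n (\<lambda>i j. X i j + Y i j)"
  using assms by (simp add: block_positive_def plus_tc.rep_eq cinner_add_right sum.distrib)

lemma block_positive_scaleR:
  assumes "block_positive n X" "0 \<le> r"
  shows "block_positive n (\<lambda>i j. r *\<^sub>R X i j)"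
  using assms by (auto simp: block_positive_def scaleR_tc.rep_eq cinner_scaleR_right complex_nonneg_Reals_iff
      simp flip: sum_distrib_left)

lemma CP_I:
  assumes "clinear \<Phi>" "\<And>n X. block_positive n X \<Longrightarrow> block_positive n (\<lambda>i j. \<Phi> (X i j))"
  shows "\<Phi> \<in> CP"
  using assms by (auto simp: CP_def)

lemma CP_D: "\<Phi> \<in> CP \<Longrightarrow> block_positive n X \<Longrightarrow> block_positive n (\<lambda>i j. \<Phi> (X i j))"
  by (auto simp: CP_def)

lemma CP_id: "(\<lambda>X. X) \<in> CP"
  by (simp add: CP_def clinear_def)

lemma CP_add:
  assumes \<Phi>: "\<Phi> \<in> CP" and \<Psi>: "\<Psi> \<in> CP"
  shows "(\<lambda>X. \<Phi> X + \<Psi> X) \<in> CP"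
  by (rule CP_I, simp add: clinear_def CP_clinear [OF \<Phi>] CP_clinear [OF \<Psi>] scaleC_add_right)
    (intro block_positive_add CP_D [OF \<Phi>] CP_D [OF \<Psi>])

lemma CP_scaleR:
  assumes \<Phi>: "\<Phi> \<in> CP" and r: "0 \<le> r"
  shows "(\<lambda>X. r *\<^sub>R \<Phi> X) \<in> CP"
  by (rule CP_I, simp add: clinear_def CP_clinear [OF \<Phi>] scaleR_add_right, simp add: scaleR_scaleC scaleC_scaleC mult.commute)
    (intro block_positive_scaleR CP_D [OF \<Phi>] r)

lemma CP_compose:
  assumes \<Phi>: "\<Phi> \<in> CP" and \<Psi>: "\<Psi> \<in> CP"
  shows "(\<lambda>X. \<Phi> (\<Psi> X)) \<in> CP"
  by (rule CP_I, simp add: clinear_def CP_clinear [OF \<Phi>] CP_clinear [OF \<Psi>])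
    (intro CP_D [OF \<Phi>] CP_D [OF \<Psi>])

lemma CP_funpow: "\<Phi> \<in> CP \<Longrightarrow> (\<Phi> ^^ n) \<in> CP"
proof (induction n)
  case 0
  then show ?case using CP_id by (simp add: id_def)
next
  case (Suc n)
  then show ?case using CP_compose [of \<Phi> "\<Phi> ^^ n"] by (simp add: comp_def)
qed

lemma CP_conjugation: "(\<lambda>X. tc_lmult V (tc_rmult X (adj V))) \<in> CP"
proof (rule CP_I)
  show "clinear (\<lambda>X. tc_lmult V (tc_rmult X (adj V)))"
    by (simp add: clinear_def bounded_clinear_simps [OF bounded_clinear_tc_lmult] bounded_clinear_simps [OF bounded_clinear_tc_rmult])
  fix n and X :: "nat \<Rightarrow> nat \<Rightarrow> 'a tc"
  assume X: "block_positive n X"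
  show "block_positive n (\<lambda>i j. tc_lmult V (tc_rmult (X i j) (adj V)))"
    unfolding block_positive_def
  proof
    fix v :: "nat \<Rightarrow> 'a"
    have "(\<Sum>i<n. \<Sum>j<n. cinner (adj V (v i)) (of_tc (X i j) (adj V (v j)))) \<in> \<real>\<^sub>\<ge>\<^sub>0"
      using X unfolding block_positive_def by (rule spec [of _ "\<lambda>i. adj V (v i)"])
    then show "(\<Sum>i<n. \<Sum>j<n. cinner (v i) (of_tc (tc_lmult V (tc_rmult (X i j) (adj V))) (v j))) \<in> \<real>\<^sub>\<ge>\<^sub>0"
      by (simp add: tc_lmult.rep_eq tc_rmult.rep_eq cinner_adj)
  qed
qed

lemma CP_limit:
  fixes \<Psi> :: "'a::chilbert_space tc \<Rightarrow> 'a tc"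
  assumes \<Phi>: "\<And>n. \<Phi> n \<in> CP" and lim: "\<And>X. (\<lambda>n. \<Phi> n X) \<longlonglongrightarrow> \<Psi> X"
  shows "\<Psi> \<in> CP"
proof (rule CP_I)
  show "clinear \<Psi>"
    unfolding clinear_def
  proof (intro conjI allI)
    fix X Y :: "'a tc" and c
    show "\<Psi> (X + Y) = \<Psi> X + \<Psi> Y"
      using LIMSEQ_unique [OF lim [of "X + Y"]] tendsto_add [OF lim [of X] lim [of Y]] by (simp add: CP_clinear [OF \<Phi>])
    show "\<Psi> (c *\<^sub>C X) = c *\<^sub>C \<Psi> X"
      using LIMSEQ_unique [OF lim [of "c *\<^sub>C X"]] bounded_linear.tendsto [OF bounded_linear_scaleC_right lim [of X], of c]
      by (simp add: CP_clinear [OF \<Phi>])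
  qed
  fix n and X :: "nat \<Rightarrow> nat \<Rightarrow> 'a tc"
  assume X: "block_positive n X"
  show "block_positive n (\<lambda>i j. \<Psi> (X i j))"
    unfolding block_positive_def
  proof
    fix v :: "nat \<Rightarrow> 'a"
    have l: "(\<lambda>m. \<Sum>i<n. \<Sum>j<n. cinner (v i) (of_tc (\<Phi> m (X i j)) (v j))) \<longlonglongrightarrow>
        (\<Sum>i<n. \<Sum>j<n. cinner (v i) (of_tc (\<Psi> (X i j)) (v j)))"
      by (intro tendsto_sum bounded_linear.tendsto [OF bounded_linear_cinner_right]
          bounded_linear.tendsto [OF bounded_linear_of_tc_apply] lim)
    have "(\<Sum>i<n. \<Sum>j<n. cinner (v i) (of_tc (\<Phi> m (X i j)) (v j))) \<in> \<real>\<^sub>\<ge>\<^sub>0" for m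
      using CP_D [OF \<Phi> X] unfolding block_positive_def by (rule spec)
    then show "(\<Sum>i<n. \<Sum>j<n. cinner (v i) (of_tc (\<Psi> (X i j)) (v j))) \<in> \<real>\<^sub>\<ge>\<^sub>0"
      using closed_sequentially [OF closed_nonneg_Reals_complex _ l] by blast
  qed
qed

text \<open>The Hamiltonian and anticommutator parts of \<open>Xi\<close> merge into the single
  operator K = -iH - (1/2) \<open>dual_map \<Phi> 1\<close>. Complete positivity of the exponential
  comes from this shape alone; trace preservation is kept apart as the equation K + adj K +
  \<open>dual_map \<Phi> 1\<close> = 0.\<close>

definition lindblad_map :: "'a::chilbert_space bop \<Rightarrow> ('a tc \<Rightarrow> 'a tc) \<Rightarrow> 'a tc \<Rightarrow> 'a tc" where
  "lindblad_map K \<Phi> = (\<lambda>X. tc_lmult K X + tc_rmult X (adj K) + \<Phi> X)"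

lemma bounded_clinear_lindblad_map: "bounded_clinear \<Phi> \<Longrightarrow> bounded_clinear (lindblad_map K \<Phi>)"
  unfolding lindblad_map_def by (intro bounded_clinear_add bounded_clinear_tc_lmult bounded_clinear_tc_rmult)

text \<open>The Euler steps \<open>X \<mapsto> (1 + \<epsilon>K) X (1 + \<epsilon>K)\<^sup>* + \<epsilon> \<Phi>(X)\<close> are completely positive and
  differ from \<open>1 + \<epsilon>L\<close> only in second order.\<close>

lemma CP_exp_lindblad_map:
  fixes \<Phi> :: "'a::chilbert_space tc \<Rightarrow> 'a tc"
  assumes \<Phi>: "\<Phi> \<in> CP" and t: "0 \<le> t"
  shows "blinfun_apply (blinfun_exp (t *\<^sub>R Blinfun (lindblad_map K \<Phi>))) \<in> CP"
proof (rule CP_limit)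
  define R where "R X = tc_lmult K (tc_rmult X (adj K))" for X
  have R: "bounded_linear R"
    unfolding R_def by (rule bounded_linear_compose [OF bounded_linear_tc_lmult bounded_linear_tc_rmult])
  have L: "bounded_linear (lindblad_map K \<Phi>)"
    by (intro bounded_clinear_bounded_linear bounded_clinear_lindblad_map CP_bounded_clinear \<Phi>)
  show "(\<lambda>n. ((\<lambda>X. X + (t / real n) *\<^sub>R lindblad_map K \<Phi> X + (t / real n)\<^sup>2 *\<^sub>R R X) ^^ n) X)
    \<longlonglongrightarrow> blinfun_apply (blinfun_exp (t *\<^sub>R Blinfun (lindblad_map K \<Phi>))) X" for X
    by (rule euler_limit [OF L R])
  fix n
  define \<epsilon> where "\<epsilon> = t / real n"
  define V where "V = 1 + \<epsilon> *\<^sub>R K"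
  have \<epsilon>: "0 \<le> \<epsilon>" using t by (simp add: \<epsilon>_def)
  have "(\<lambda>X. X + \<epsilon> *\<^sub>R lindblad_map K \<Phi> X + \<epsilon>\<^sup>2 *\<^sub>R R X) = (\<lambda>X. tc_lmult V (tc_rmult X (adj V)) + \<epsilon> *\<^sub>R \<Phi> X)"
  proof
    fix X
    have "tc_lmult V (tc_rmult X (adj V)) = X + \<epsilon> *\<^sub>R tc_lmult K X + \<epsilon> *\<^sub>R tc_rmult X (adj K) + \<epsilon>\<^sup>2 *\<^sub>R R X"
      by (rule tc_eqI) (simp add: V_def R_def adj_add adj_scaleR tc_lmult.rep_eq tc_rmult.rep_eq plus_tc.rep_eq
          scaleR_tc.rep_eq bop_linear power2_eq_square algebra_simps)
    then show "X + \<epsilon> *\<^sub>R lindblad_map K \<Phi> X + \<epsilon>\<^sup>2 *\<^sub>R R X = tc_lmult V (tc_rmult X (adj V)) + \<epsilon> *\<^sub>R \<Phi> X"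
      by (simp add: lindblad_map_def algebra_simps)
  qed
  then show "((\<lambda>X. X + (t / real n) *\<^sub>R lindblad_map K \<Phi> X + (t / real n)\<^sup>2 *\<^sub>R R X) ^^ n) \<in> CP"
    unfolding \<epsilon>_def [symmetric] by (simp only:) (intro CP_funpow CP_add CP_conjugation CP_scaleR \<Phi> \<epsilon>)
qed

lemma trace_exp:
  fixes L :: "'a::chilbert_space tc \<Rightarrow> 'a tc"
  assumes L: "bounded_linear L" and tr: "\<And>X. tc_trace (L X) = 0"
  shows "tc_trace (blinfun_apply (blinfun_exp (t *\<^sub>R Blinfun L)) X) = tc_trace X"
proof -
  have "(\<lambda>n. tc_trace ((t ^ n / fact n) *\<^sub>R (L ^^ n) X)) sums tc_trace (blinfun_apply (blinfun_exp (t *\<^sub>R Blinfun L)) X)"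
    by (rule bounded_linear.sums [OF bounded_linear_tc_trace exp_sums [OF L]])
  moreover have "tc_trace ((t ^ n / fact n) *\<^sub>R (L ^^ n) X) = (if n = 0 then tc_trace X else 0)" for n
    using tr by (cases n) (simp_all add: linear_simps [OF bounded_linear_tc_trace])
  ultimately show ?thesis using sums_unique2 [OF _ sums_single [of 0 "\<lambda>_. tc_trace X"]] by simp
qed

lemma lindblad_map_generator:
  assumes \<Phi>: "\<Phi> \<in> CP" and tr: "\<And>X. tc_trace (lindblad_map K \<Phi> X) = 0"
  shows "lindblad_map K \<Phi> \<in> CPTP_generators"
proof -
  have L: "bounded_clinear (lindblad_map K \<Phi>)" by (intro bounded_clinear_lindblad_map CP_bounded_clinear \<Phi>)
  show ?thesis
    using L CP_exp_lindblad_map [OF \<Phi>] trace_exp [OF bounded_clinear_bounded_linear [OF L] tr]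
    by (simp add: CPTP_generators_def CPTP_def tc_trace.rep_eq)
qed

lemma scaleC_minus_left: "(- a) *\<^sub>C x = - (a *\<^sub>C (x :: 'a::complex_vector))"
  using scaleC_add_left [of "- a" a x] by (simp add: eq_neg_iff_add_eq_0)

lemma Xi_eq_lindblad_map:
  assumes H: "H \<in> self_adjoint_ops" and \<Phi>: "\<Phi> \<in> CP"
  shows "Xi H \<Phi> = lindblad_map (- \<i> *\<^sub>C H - (1/2) *\<^sub>C dual_map \<Phi> 1) \<Phi>"
proof
  fix X
  define G where "G = dual_map \<Phi> 1"
  have Ga: "adj G = G" unfolding G_def by (rule dual_map_one_self_adj [OF \<Phi>])
  have Ha: "adj H = H" using H by (simp add: self_adjoint_ops_def)
  have 1: "Tc (- \<i> *\<^sub>C commutator H (of_tc X)) = (- \<i>) *\<^sub>C (tc_lmult H X - tc_rmult X H)"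
    by (simp add: commutator_def of_tc_inverse flip: tc_lmult.rep_eq tc_rmult.rep_eq minus_tc.rep_eq scaleC_tc.rep_eq)
  have 2: "Tc (anticommutator ((1/2) *\<^sub>C G) (of_tc X)) = tc_lmult ((1/2) *\<^sub>C G) X + tc_rmult X ((1/2) *\<^sub>C G)"
    by (simp add: anticommutator_def of_tc_inverse flip: tc_lmult.rep_eq tc_rmult.rep_eq plus_tc.rep_eq)
  show "Xi H \<Phi> X = lindblad_map (- \<i> *\<^sub>C H - (1/2) *\<^sub>C dual_map \<Phi> 1) \<Phi> X"
    unfolding Xi_def lindblad_map_def G_def [symmetric] 1 2
    by (rule tc_eqI) (simp add: adj_diff adj_scaleC Ga Ha tc_lmult.rep_eq tc_rmult.rep_eq plus_tc.rep_eq minus_tc.rep_eq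
          scaleC_tc.rep_eq bop_linear scaleC_diff_right, simp add: scaleC_minus_left)
qed

text \<open>By cyclicity the trace pairs X with one bounded operator. For \<open>Xi\<close> that
  operator is zero; conversely, if all traces vanish, testing on rank-one X forces it to be zero,
  which expresses \<open>dual_map \<Phi> 1\<close> through K.\<close>

lemma tc_trace_lindblad_map:
  assumes "bounded_clinear \<Phi>"
  shows "tc_trace (lindblad_map K \<Phi> X) = tc_trace (tc_rmult X (K + adj K + dual_map \<Phi> 1))"
proof -
  have "tc_rmult X (K + adj K + dual_map \<Phi> 1) = tc_rmult X K + tc_rmult X (adj K) + tc_rmult X (dual_map \<Phi> 1)"
    by (rule tc_eqI) (simp add: tc_rmult.rep_eq plus_tc.rep_eq bop_linear)
  then show ?thesis
    by (simp add: lindblad_map_def tc_trace_add tc_trace_cyclic dual_map_one [OF assms])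
qed

lemma tc_rmult_zero: "tc_rmult X 0 = 0"
  by (rule tc_eqI) (simp add: tc_rmult.rep_eq zero_tc.rep_eq bop_linear)

lemma tc_trace_zero [simp]: "tc_trace 0 = 0"
  by (rule linear_simps(3) [OF bounded_linear_tc_trace])

lemma Xi_generator:
  assumes H: "H \<in> self_adjoint_ops" and \<Phi>: "\<Phi> \<in> CP"
  shows "Xi H \<Phi> \<in> CPTP_generators"
  unfolding Xi_eq_lindblad_map [OF assms]
proof (rule lindblad_map_generator [OF \<Phi>])
  fix X
  define K where "K = - \<i> *\<^sub>C H - (1/2) *\<^sub>C dual_map \<Phi> 1"
  have Ha: "adj H = H" using H by (simp add: self_adjoint_ops_def)
  have "K + adj K + dual_map \<Phi> 1 = 0"
    by (rule bop_cinner_eqI) (simp add: K_def adj_diff adj_scaleC Ha dual_map_one_self_adj [OF \<Phi>]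
        cinner_add_right cinner_diff_right cinner_scaleC_right)
  then show "tc_trace (lindblad_map (- \<i> *\<^sub>C H - (1/2) *\<^sub>C dual_map \<Phi> 1) \<Phi> X) = 0"
    unfolding K_def [symmetric] tc_trace_lindblad_map [OF CP_bounded_clinear [OF \<Phi>]]
    by (simp add: tc_rmult_zero)
qed

section \<open>Forms of generators\<close>

lemma choi_form_lindblad_map:
  assumes "bounded_clinear \<Phi>"
  shows "choi_form (lindblad_map K \<Phi>) S T = tc_trace (tc_lmult K S) * cnj (tc_trace T)
    + tc_trace S * cnj (tc_trace (tc_lmult K T)) + choi_form \<Phi> S T"
  unfolding lindblad_map_def
  by (simp add: choi_form_map_add assms bounded_clinear_add bounded_clinear_tc_lmult bounded_clinear_tc_rmult
      choi_form_tc_lmult choi_form_tc_rmult)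

text \<open>The difference quotient \<open>D n\<close> has at (S, S) the form of the exponential
  minus |tr S|^2, divided by the time step, since the identity contributes |tr S|^2. This value is
  real, and nonnegative once tr S = 0. The quotients converge to L in operator norm, so
  \<open>norm_choi_form\<close> carries both facts to the limit.\<close>

lemma generator_props:
  fixes L :: "'a::chilbert_space tc \<Rightarrow> 'a tc"
  assumes L: "L \<in> CPTP_generators"
  shows "bounded_clinear L" "tc_trace (L X) = 0" "Im (choi_form L S S) = 0"
    "tc_trace S = 0 \<Longrightarrow> choi_form L S S \<in> \<real>\<^sub>\<ge>\<^sub>0"
proof -
  show bc: "bounded_clinear L" using L by (simp add: CPTP_generators_def)
  note bl = bounded_clinear_bounded_linear [OF bc]
  define E where "E t = blinfun_apply (blinfun_exp (t *\<^sub>R Blinfun L))" for t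
  have E: "E t \<in> CP" "tc_trace (E t X) = tc_trace X" if "0 \<le> t" for t X
    using L that by (simp_all add: CPTP_generators_def CPTP_def E_def tc_trace.rep_eq)
  obtain C where C: "0 \<le> C" "\<And>t x. 0 \<le> t \<Longrightarrow> t \<le> 1 \<Longrightarrow> norm (E t x - x - t *\<^sub>R L x) \<le> C * t\<^sup>2 * norm x"
    unfolding E_def using exp_first_order [OF bl] by metis
  define \<tau> where "\<tau> n = inverse (real (Suc n))" for n
  have \<tau>: "0 < \<tau> n" "\<tau> n \<le> 1" for n by (simp_all add: \<tau>_def inverse_le_1_iff)
  have \<tau>0: "\<tau> \<longlonglongrightarrow> 0" unfolding \<tau>_def by (rule LIMSEQ_inverse_real_of_nat)
  define D where "D n = (\<lambda>X. (1 / \<tau> n) *\<^sub>R (E (\<tau> n) X - X))" for n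
  have Ebc: "bounded_clinear (E (\<tau> n))" for n
    by (rule CP_bounded_clinear [OF E(1)]) (use \<tau> [of n] in simp)
  have Dbc: "bounded_clinear (D n)" for n
    unfolding D_def by (intro bounded_clinear_scaleR bounded_clinear_diff Ebc bounded_clinear_id)
  have DL: "norm (D n X - L X) \<le> C * \<tau> n * norm X" for n X
  proof -
    have "D n X - L X = (1 / \<tau> n) *\<^sub>R (E (\<tau> n) X - X - \<tau> n *\<^sub>R L X)"
      using \<tau>(1) [of n] by (simp add: D_def scaleR_diff_right)
    then have "norm (D n X - L X) = (1 / \<tau> n) * norm (E (\<tau> n) X - X - \<tau> n *\<^sub>R L X)"
      using \<tau>(1) [of n] by simp
    also have "\<dots> \<le> (1 / \<tau> n) * (C * (\<tau> n)\<^sup>2 * norm X)"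
      using \<tau> [of n] by (intro mult_left_mono C(2)) auto
    finally show ?thesis using \<tau>(1) [of n] by (simp add: power2_eq_square)
  qed
  have Dlim: "(\<lambda>n. D n X) \<longlonglongrightarrow> L X" for X
  proof -
    have "(\<lambda>n. C * \<tau> n * norm X) \<longlonglongrightarrow> C * 0 * norm X" by (intro tendsto_intros \<tau>0)
    then have "(\<lambda>n. C * \<tau> n * norm X) \<longlonglongrightarrow> 0" by simp
    then have "(\<lambda>n. D n X - L X) \<longlonglongrightarrow> 0"
      by (rule Lim_null_comparison [rotated]) (simp add: DL)
    then show ?thesis by (simp add: LIM_zero_iff)
  qed
  have "(\<lambda>n. tc_trace (D n X)) \<longlonglongrightarrow> tc_trace (L X)"
    by (rule bounded_linear.tendsto [OF bounded_linear_tc_trace Dlim])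
  moreover have "tc_trace (D n X) = 0" for n
    using E(2) [of "\<tau> n"] \<tau>(1) [of n] by (simp add: D_def linear_simps [OF bounded_linear_tc_trace])
  ultimately show "tc_trace (L X) = 0" by (simp add: LIMSEQ_const_iff)
  have qlim: "(\<lambda>n. choi_form (D n) S S) \<longlonglongrightarrow> choi_form L S S" for S
  proof -
    have "norm (choi_form (D n) S S - choi_form L S S) \<le> C * \<tau> n * norm S * norm S" for n
    proof -
      have "norm (choi_form (D n) S S - choi_form L S S) \<le> onorm (\<lambda>X. D n X - L X) * norm S * norm S"
        using norm_choi_form [OF bounded_clinear_diff [OF Dbc bc], of n S S] by (simp add: choi_form_map_add Dbc bc)
      also have "\<dots> \<le> (C * \<tau> n) * norm S * norm S"
        using DL C(1) \<tau>(1) [of n] by (intro mult_right_mono onorm_bound) (auto intro: mult_nonneg_nonneg)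
      finally show ?thesis .
    qed
    note le = this
    have "(\<lambda>n. C * \<tau> n * norm S * norm S) \<longlonglongrightarrow> C * 0 * norm S * norm S" by (intro tendsto_intros \<tau>0)
    then have "(\<lambda>n. C * \<tau> n * norm S * norm S) \<longlonglongrightarrow> 0" by simp
    then have "(\<lambda>n. choi_form (D n) S S - choi_form L S S) \<longlonglongrightarrow> 0"
      by (rule Lim_null_comparison [rotated]) (simp add: le)
    then show ?thesis by (simp add: LIM_zero_iff)
  qed
  have qD: "choi_form (D n) S S = complex_of_real (1 / \<tau> n) * (choi_form (E (\<tau> n)) S S - tc_trace S * cnj (tc_trace S))" for n S
    unfolding D_def
    by (simp add: choi_form_map_scaleR bounded_clinear_diff Ebc bounded_clinear_id choi_form_map_add choi_form_id)
  have qE: "choi_form (E (\<tau> n)) S S \<in> \<real>\<^sub>\<ge>\<^sub>0" for n S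
    by (rule CP_choi_form [OF E(1)]) (use \<tau> [of n] in simp)
  have "Im (choi_form (D n) S S) = 0" for n
    using qE [of n S] unfolding qD complex_nonneg_Reals_iff by simp
  then show "Im (choi_form L S S) = 0" using tendsto_Im [OF qlim [of S]] by (simp add: LIMSEQ_const_iff)
  assume "tc_trace S = 0"
  then have "choi_form (D n) S S \<in> \<real>\<^sub>\<ge>\<^sub>0" for n
    using qE [of n S] \<tau>(1) [of n] unfolding qD by (simp add: complex_nonneg_Reals_iff)
  then show "choi_form L S S \<in> \<real>\<^sub>\<ge>\<^sub>0"
    using closed_sequentially [OF closed_nonneg_Reals_complex _ qlim] by blast
qed

lemma choi_form_hermitian:
  assumes bc: "bounded_clinear L" and real: "\<And>S. Im (choi_form L S S) = 0"
  shows "choi_form L T S = cnj (choi_form L S T)"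
  using real [of "S + T"] real [of "S + \<i> *\<^sub>C T"] real [of S] real [of T]
  by (simp add: choi_form_add [OF bc] complex_eq_iff)

lemma choi_form_null:
  assumes \<Phi>: "\<Phi> \<in> CP" and 0: "choi_form \<Phi> T T = 0"
  shows "choi_form \<Phi> S T = 0" "choi_form \<Phi> T S = 0"
proof -
  note bc = CP_bounded_clinear [OF \<Phi>]
  \<comment> \<open>The arguments are exchanged so that the conjugated coefficient meets the
    conjugate-linear slot of the form.\<close>
  have "positive_kernel {S, T} (\<lambda>a b. choi_form \<Phi> b a)"
    unfolding positive_kernel_def
  proof
    fix c
    have "(\<Sum>a\<in>{S,T}. \<Sum>b\<in>{S,T}. cnj (c a) * choi_form \<Phi> b a * c b) =
        choi_form \<Phi> (\<Sum>a\<in>{S,T}. c a *\<^sub>C a) (\<Sum>a\<in>{S,T}. c a *\<^sub>C a)"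
      by (cases "S = T") (simp_all add: choi_form_add [OF bc] algebra_simps)
    then show "(\<Sum>a\<in>{S,T}. \<Sum>b\<in>{S,T}. cnj (c a) * choi_form \<Phi> b a * c b) \<in> \<real>\<^sub>\<ge>\<^sub>0"
      by (simp only: CP_choi_form [OF \<Phi>])
  qed
  from positive_kernel_null [OF this, of T S] 0 show 1: "choi_form \<Phi> S T = 0" by simp
  show "choi_form \<Phi> T S = 0"
    using choi_form_hermitian [OF bc, of T S] CP_choi_form [OF \<Phi>] 1 by (simp add: complex_nonneg_Reals_iff)
qed


section \<open>Existence and uniqueness of the decomposition\<close>

text \<open>On traceless arguments the forms of \<open>L\<close> and of \<open>\<Phi>\<close> agree, and \<open>B\<^sup>*\<close> is a null vector of the latter.\<close>

lemma choi_form_of_generator: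
  fixes B :: "'a::chilbert_space tc"
  assumes \<Phi>: "\<Phi> \<in> CP_restricted B" and B: "tc_trace (tc_adj B) \<noteq> 0"
  defines "p \<equiv> \<lambda>S. S - (tc_trace S / tc_trace (tc_adj B)) *\<^sub>C tc_adj B"
  shows "choi_form \<Phi> S T = choi_form (lindblad_map K \<Phi>) (p S) (p T)"
proof -
  have CP: "\<Phi> \<in> CP" using \<Phi> by (simp add: CP_restricted_def)
  note bc = CP_bounded_clinear [OF CP]
  have "choi_form \<Phi> (tc_adj B) (tc_adj B) = 0" using \<Phi> by (simp add: CP_restricted_choi_form [OF bc])
  note null = choi_form_null [OF CP this]
  have p0: "tc_trace (p S) = 0" for S
    using B by (simp add: p_def tc_trace_scaleC linear_simps [OF bounded_linear_tc_trace])
  have "choi_form (lindblad_map K \<Phi>) (p S) (p T) = choi_form \<Phi> (p S) (p T)"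
    by (simp add: choi_form_lindblad_map [OF bc] p0)
  also have "\<dots> = choi_form \<Phi> S T"
    by (simp add: p_def choi_form_add [OF bc] null)
  finally show ?thesis ..
qed

lemma Xi_inj_CP:
  fixes B :: "'a::chilbert_space tc"
  assumes H: "H \<in> self_adjoint_ops" "H' \<in> self_adjoint_ops"
    and \<Phi>: "\<Phi> \<in> CP_restricted B" "\<Phi>' \<in> CP_restricted B"
    and B: "tc_trace B \<noteq> 0" and eq: "Xi H \<Phi> = Xi H' \<Phi>'"
  shows "\<Phi> = \<Phi>'"
proof -
  have CP: "\<Phi> \<in> CP" "\<Phi>' \<in> CP" using \<Phi> by (simp_all add: CP_restricted_def)
  have B': "tc_trace (tc_adj B) \<noteq> 0" using B by (simp add: tc_trace_adj)
  show ?thesis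
  proof (rule choi_form_eqD [OF CP [THEN CP_bounded_clinear]])
    fix S T
    show "choi_form \<Phi> S T = choi_form \<Phi>' S T"
      unfolding choi_form_of_generator [OF \<Phi>(1) B', of _ _ "- \<i> *\<^sub>C H - (1/2) *\<^sub>C dual_map \<Phi> 1"]
        choi_form_of_generator [OF \<Phi>(2) B', of _ _ "- \<i> *\<^sub>C H' - (1/2) *\<^sub>C dual_map \<Phi>' 1"]
        Xi_eq_lindblad_map [OF H(1) CP(1), symmetric] Xi_eq_lindblad_map [OF H(2) CP(2), symmetric] eq ..
  qed
qed

text \<open>Commuting with |x><v| and evaluating at v gives |v|^2 D x = <D v, v> x. Hence D is the
  scalar given by the Rayleigh quotient at one fixed nonzero v, and this is real because D is
  self-adjoint.\<close>

lemma self_adjoint_central: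
  fixes D :: "'a::chilbert_space bop"
  assumes D: "adj D = D" and central: "\<And>X. tc_lmult D X = tc_rmult X D"
  obtains r :: real where "D = r *\<^sub>R 1"
proof (cases "\<exists>v::'a. v \<noteq> 0")
  case True
  then obtain v :: 'a where v: "v \<noteq> 0" by blast
  define r where "r = inner (D v) v / (norm v)\<^sup>2"
  have Im: "Im (cinner (D v) v) = 0"
    by (metis D cinner_adj(1) cinner_commute cnj.simps(2) equal_neg_zero)
  have "D x = r *\<^sub>R x" for x
  proof -
    have "of_tc (tc_lmult D (tc_rank_one x v)) v = of_tc (tc_rmult (tc_rank_one x v) D) v"
      by (simp only: central)
    then have "cinner v v *\<^sub>C D x = cinner (D v) v *\<^sub>C x"
      by (simp add: tc_rank_one.rep_eq D)
    moreover have "cinner (D v) v = complex_of_real (inner (D v) v)"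
      using Im by (simp add: inner_eq_Re_cinner complex_eq_iff)
    ultimately have "(norm v)\<^sup>2 *\<^sub>R D x = inner (D v) v *\<^sub>R x"
      by (simp only: cinner_self scaleR_scaleC)
    then have "(1 / (norm v)\<^sup>2) *\<^sub>R ((norm v)\<^sup>2 *\<^sub>R D x) = (1 / (norm v)\<^sup>2) *\<^sub>R (inner (D v) v *\<^sub>R x)" by simp
    then show ?thesis using v by (simp add: r_def)
  qed
  then show ?thesis using that [of r] by (simp add: bop_eqI)
next
  case False
  then have "D = 0 *\<^sub>R 1" by (intro bop_eqI) simp
  then show ?thesis by (rule that)
qed

lemma Xi_eq_imp_scalar:
  fixes H H' :: "'a::chilbert_space bop"
  assumes H: "H \<in> self_adjoint_ops" "H' \<in> self_adjoint_ops" and \<Phi>: "\<Phi> \<in> CP" and eq: "Xi H \<Phi> = Xi H' \<Phi>"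
  obtains r :: real where "H = H' + r *\<^sub>R 1"
proof -
  have central: "tc_lmult (H - H') X = tc_rmult X (H - H')" for X
  proof -
    have 1: "Tc (- \<i> *\<^sub>C commutator G (of_tc X)) = (- \<i>) *\<^sub>C (tc_lmult G X - tc_rmult X G)" for G
      by (simp add: commutator_def of_tc_inverse flip: tc_lmult.rep_eq tc_rmult.rep_eq minus_tc.rep_eq scaleC_tc.rep_eq)
    have "Xi H \<Phi> X = Xi H' \<Phi> X" by (simp add: eq)
    then have "(- \<i>) *\<^sub>C (tc_lmult H X - tc_rmult X H) = (- \<i>) *\<^sub>C (tc_lmult H' X - tc_rmult X H')"
      unfolding Xi_def 1 by simp
    then have "\<i> *\<^sub>C (- \<i>) *\<^sub>C (tc_lmult H X - tc_rmult X H) = \<i> *\<^sub>C (- \<i>) *\<^sub>C (tc_lmult H' X - tc_rmult X H')"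
      by simp
    then have "tc_lmult H X - tc_rmult X H = tc_lmult H' X - tc_rmult X H'"
      by (simp only: scaleC_scaleC) simp
    moreover have "tc_lmult (H - H') X - tc_rmult X (H - H') = (tc_lmult H X - tc_rmult X H) - (tc_lmult H' X - tc_rmult X H')"
      by (rule tc_eqI) (simp add: tc_lmult.rep_eq tc_rmult.rep_eq minus_tc.rep_eq bop_linear)
    ultimately show ?thesis by simp
  qed
  have "adj (H - H') = H - H'" using H by (simp add: self_adjoint_ops_def adj_diff)
  then obtain r :: real where "H - H' = r *\<^sub>R 1" using self_adjoint_central [OF _ central] by metis
  then show ?thesis using that [of r] by (simp add: algebra_simps)
qed

lemma generator_decomposition:
  fixes B :: "'a::chilbert_space tc"
  assumes L: "L \<in> CPTP_generators" and B: "tc_trace B \<noteq> 0"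
  obtains K \<Phi> where "\<Phi> \<in> CP_restricted B" "L = lindblad_map K \<Phi>"
proof -
  note Lp = generator_props [OF L]
  note bc = Lp(1) and herm = choi_form_hermitian [OF Lp(1) Lp(3)]
  define T0 where "T0 = tc_adj B"
  define \<beta> where "\<beta> = tc_trace T0"
  have \<beta>: "\<beta> \<noteq> 0" using B by (simp add: \<beta>_def T0_def tc_trace_adj)
  define a where "a = choi_form L T0 T0"
  have a: "cnj a = a" using Lp(3) [of T0] by (simp add: a_def complex_eq_iff)
  \<comment> \<open>With s = tr S and z = \<open>choi_form L S T0\<close>, removing the trace in
    both slots subtracts z cnj (s/\<beta>) and its conjugate from the form of L and adds a
    |s/\<beta>|^2. The terms of K contribute f(S) cnj s and its conjugate, so f carries one half of
    the last term, with opposite sign.\<close>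
  define f where "f S = choi_form L S T0 / cnj \<beta> - a / (2 * \<beta> * cnj \<beta>) * tc_trace S" for S
  have fb: "bounded_linear f"
    unfolding f_def by (intro bounded_linear_sub bounded_linear_const_mult bounded_linear_tc_trace
        bounded_linear_compose [OF bounded_linear_divide] bounded_linear_choi_form(1) [OF bc])
  have fc: "f (c *\<^sub>C S) = c * f S" for c S
    by (simp add: f_def choi_form_add [OF bc] tc_trace_scaleC algebra_simps)
  obtain K where K: "\<And>S. f S = tc_trace (tc_lmult K S)"
    using tc_dual_representation [OF fb fc onorm [OF fb] onorm_pos_le [OF fb]] by metis
  define \<Phi> where "\<Phi> = (\<lambda>X. L X - (tc_lmult K X + tc_rmult X (adj K)))"
  have \<Phi>bc: "bounded_clinear \<Phi>"
    unfolding \<Phi>_def by (intro bounded_clinear_diff bounded_clinear_add bc bounded_clinear_tc_lmult bounded_clinear_tc_rmult)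
  have L\<Phi>: "L = lindblad_map K \<Phi>" by (simp add: lindblad_map_def \<Phi>_def)
  define p where "p S = S - (tc_trace S / \<beta>) *\<^sub>C T0" for S
  have p0: "tc_trace (p S) = 0" for S
    using \<beta> by (simp add: p_def tc_trace_scaleC linear_simps [OF bounded_linear_tc_trace] flip: \<beta>_def)
  have q: "choi_form \<Phi> S S = choi_form L (p S) (p S)" for S
  proof -
    define s where "s = tc_trace S"
    define z where "z = choi_form L S T0"
    have z': "choi_form L T0 S = cnj z" unfolding z_def by (rule herm)
    have "choi_form L S S = f S * cnj s + s * cnj (f S) + choi_form \<Phi> S S"
      unfolding s_def K by (subst L\<Phi>, rule choi_form_lindblad_map [OF \<Phi>bc])
    then have "choi_form \<Phi> S S = choi_form L S S - f S * cnj s - s * cnj (f S)" by simp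
    also have "\<dots> = choi_form L S S - cnj (s / \<beta>) * z - (s / \<beta>) * cnj z + (s / \<beta>) * cnj (s / \<beta>) * a"
      using \<beta> by (simp add: f_def a flip: s_def z_def) (simp add: field_simps)
    also have "\<dots> = choi_form L (p S) (p S)"
      by (simp add: p_def choi_form_add [OF bc] z' algebra_simps flip: s_def z_def a_def)
    finally show ?thesis .
  qed
  have CP: "\<Phi> \<in> CP"
    by (rule CP_if_choi_form_nonneg [OF \<Phi>bc]) (simp add: q Lp(4) p0)
  have "p T0 = 0" using \<beta> by (simp add: p_def flip: \<beta>_def)
  then have "choi_form \<Phi> T0 T0 = 0"
    using linear_simps(3) [OF bounded_linear_choi_form(2) [OF bc]] by (simp add: q)
  then have "\<Phi> \<in> CP_restricted B"
    unfolding CP_restricted_choi_form [OF \<Phi>bc] T0_def [symmetric] using CP by simp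
  then show ?thesis using that L\<Phi> by blast
qed

section \<open>Gauge freedom of the Hamiltonian\<close>

lemma cinner_minus_right: "cinner x (- y) = - cinner x (y :: 'a::complex_inner)"
  using cinner_diff_right [of x 0 y] by simp

text \<open>The trace condition turns -(1/2) \<open>dual_map \<Phi> 1\<close> into (K + adj K)/2,
  and H = (i/2)(K - adj K) makes -iH equal to (K - adj K)/2; together they give K. A real shift of H
  adds an imaginary multiple of 1 to K, which cancels in K X + X adj K. All shifts are offered at
  once so that the normalization can be chosen afterwards.\<close>

lemma generator_eq_Xi:
  fixes K :: "'a::chilbert_space bop"
  assumes \<Phi>: "\<Phi> \<in> CP" and tr: "\<And>X. tc_trace (lindblad_map K \<Phi> X) = 0"
  obtains H where "\<And>r::real. H - r *\<^sub>R 1 \<in> self_adjoint_ops" "\<And>r::real. lindblad_map K \<Phi> = Xi (H - r *\<^sub>R 1) \<Phi>"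
proof -
  note bc = CP_bounded_clinear [OF \<Phi>]
  have "K + adj K + dual_map \<Phi> 1 = 0"
    by (rule bop_cinner_eqI)
      (use tr [of "tc_rank_one _ _"] in \<open>simp add: tc_trace_lindblad_map [OF bc] cinner_adj\<close>)
  then have G: "dual_map \<Phi> 1 = - (K + adj K)" by (simp only: add_eq_0_iff)
  define H where "H = (\<i>/2) *\<^sub>C (K - adj K)"
  have Hs: "H - r *\<^sub>R 1 \<in> self_adjoint_ops" for r :: real
    unfolding self_adjoint_ops_def mem_Collect_eq H_def
    by (rule bop_cinner_eqI) (simp add: adj_diff adj_scaleC adj_scaleR cinner_diff_right cinner_scaleC_right algebra_simps)
  have "lindblad_map K \<Phi> = Xi (H - r *\<^sub>R 1) \<Phi>" for r :: real
  proof -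
    have K': "- \<i> *\<^sub>C (H - r *\<^sub>R 1) - (1/2) *\<^sub>C dual_map \<Phi> 1 = K + (\<i> * r) *\<^sub>C 1"
      by (rule bop_cinner_eqI) (simp add: G H_def cinner_add_right cinner_diff_right cinner_scaleC_right
          cinner_scaleR_right cinner_minus_right algebra_simps)
    have "lindblad_map K \<Phi> X = lindblad_map (K + (\<i> * r) *\<^sub>C 1) \<Phi> X" for X
    proof -
      have "tc_lmult K X + tc_rmult X (adj K) = tc_lmult (K + (\<i> * r) *\<^sub>C 1) X + tc_rmult X (adj (K + (\<i> * r) *\<^sub>C 1))"
        by (rule tc_eqI) (simp add: adj_add adj_scaleC tc_lmult.rep_eq tc_rmult.rep_eq plus_tc.rep_eq bop_linear scaleC_minus_left)
      then show ?thesis by (simp add: lindblad_map_def)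
    qed
    then show ?thesis unfolding Xi_eq_lindblad_map [OF Hs \<Phi>] K' by (rule ext)
  qed
  with Hs show ?thesis using that by blast
qed

section \<open>Bijectivity, in general and for self-adjoint B\<close>

lemma Xi_bij_betw:
  fixes B :: "'a::chilbert_space tc"
  assumes B: "Re (tc_trace B) \<noteq> 0"
  shows "bij_betw (\<lambda>(H, \<Phi>). Xi H \<Phi>)
    {(H, \<Phi>). H \<in> self_adjoint_ops \<and> \<Phi> \<in> CP_restricted B \<and>
      Im (tc_trace (\<Phi> B)) = 2 * Re (tc_trace (tc_rmult (tc_adj B) H))} CPTP_generators"
    (is "bij_betw ?f ?D _")
proof (rule bij_betw_imageI)
  have B0: "tc_trace B \<noteq> 0" using B by auto
  have gauge: "Re (tc_trace (tc_rmult (tc_adj B) (H + r *\<^sub>R 1))) = Re (tc_trace (tc_rmult (tc_adj B) H)) + r * Re (tc_trace B)" for H r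
  proof -
    have "tc_rmult (tc_adj B) (H + r *\<^sub>R 1) = tc_rmult (tc_adj B) H + r *\<^sub>R tc_adj B"
      by (rule tc_eqI) (simp add: tc_rmult.rep_eq plus_tc.rep_eq scaleR_tc.rep_eq bop_linear)
    then show ?thesis by (simp add: linear_simps [OF bounded_linear_tc_trace] tc_trace_adj)
  qed
  show "inj_on ?f ?D"
  proof (rule inj_onI, clarify)
    fix H \<Phi> H' \<Phi>'
    assume H: "H \<in> self_adjoint_ops" "H' \<in> self_adjoint_ops" and \<Phi>: "\<Phi> \<in> CP_restricted B" "\<Phi>' \<in> CP_restricted B"
      and c: "Im (tc_trace (\<Phi> B)) = 2 * Re (tc_trace (tc_rmult (tc_adj B) H))"
        "Im (tc_trace (\<Phi>' B)) = 2 * Re (tc_trace (tc_rmult (tc_adj B) H'))"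
      and eq: "Xi H \<Phi> = Xi H' \<Phi>'"
    have \<Phi>\<Phi>: "\<Phi> = \<Phi>'" by (rule Xi_inj_CP [OF H \<Phi> B0 eq])
    have "\<Phi> \<in> CP" using \<Phi> by (simp add: CP_restricted_def)
    then obtain r :: real where r: "H = H' + r *\<^sub>R 1"
      using Xi_eq_imp_scalar [OF H] eq \<Phi>\<Phi> by metis
    then have "r * Re (tc_trace B) = 0" using c gauge [of H' r] by (simp add: \<Phi>\<Phi>)
    then show "H = H' \<and> \<Phi> = \<Phi>'" using r \<Phi>\<Phi> B by simp
  qed
  show "?f ` ?D = CPTP_generators"
  proof (intro equalityI subsetI)
    fix L assume "L \<in> ?f ` ?D"
    then show "L \<in> CPTP_generators" by (auto simp: CP_restricted_def intro!: Xi_generator)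
  next
    fix L :: "'a tc \<Rightarrow> 'a tc" assume L: "L \<in> CPTP_generators"
    obtain K \<Phi> where \<Phi>: "\<Phi> \<in> CP_restricted B" and LK: "L = lindblad_map K \<Phi>"
      by (rule generator_decomposition [OF L B0])
    have CP: "\<Phi> \<in> CP" using \<Phi> by (simp add: CP_restricted_def)
    obtain H where H: "\<And>r::real. H - r *\<^sub>R 1 \<in> self_adjoint_ops" "\<And>r::real. lindblad_map K \<Phi> = Xi (H - r *\<^sub>R 1) \<Phi>"
      by (rule generator_eq_Xi [OF CP generator_props(2) [OF L, unfolded LK]]) blast
    \<comment> \<open>The trace condition for H - r is a linear equation in r by
      \<open>gauge\<close>, and this is its solution.\<close>
    define r where "r = (2 * Re (tc_trace (tc_rmult (tc_adj B) H)) - Im (tc_trace (\<Phi> B))) / (2 * Re (tc_trace B))"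
    have "Im (tc_trace (\<Phi> B)) = 2 * Re (tc_trace (tc_rmult (tc_adj B) (H - r *\<^sub>R 1)))"
      using gauge [of H "- r"] B by (simp add: r_def field_simps)
    then have "(H - r *\<^sub>R 1, \<Phi>) \<in> ?D" using H(1) \<Phi> by simp
    then show "L \<in> ?f ` ?D" by (rule rev_image_eqI) (simp add: LK H(2) [of r])
  qed
qed

text \<open>The trace of a product of two self-adjoint operators, one of them trace class, equals
  its own conjugate by cyclicity. So tr (B H) is real, and so is tr \<Phi>(B), being the trace of B
  times \<open>dual_map \<Phi> 1\<close>. The condition then no longer couples H to \<Phi>, and the
  domain becomes a product.\<close>

lemma restricted_domain_self_adjoint:
  fixes B :: "'a::chilbert_space tc"
  assumes B: "tc_adj B = B"
  shows "{(H, \<Phi>). H \<in> self_adjoint_ops \<and> \<Phi> \<in> CP_restricted B \<and>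
      Im (tc_trace (\<Phi> B)) = 2 * Re (tc_trace (tc_rmult (tc_adj B) H))} =
    {H \<in> self_adjoint_ops. tc_trace (tc_rmult B H) = 0} \<times> CP_restricted B"
proof -
  have "Im (tc_trace (\<Phi> B)) = 0" if "\<Phi> \<in> CP_restricted B" for \<Phi>
  proof -
    have CP: "\<Phi> \<in> CP" using that by (simp add: CP_restricted_def)
    note bc = CP_bounded_clinear [OF CP]
    have "tc_adj (tc_rmult B (dual_map \<Phi> 1)) = tc_lmult (dual_map \<Phi> 1) B"
      by (simp add: of_tc_inject [symmetric] tc_adj.rep_eq tc_rmult.rep_eq tc_lmult.rep_eq adj_mult dual_map_one_self_adj [OF CP])
        (metis B tc_adj.rep_eq)
    then have "cnj (tc_trace (\<Phi> B)) = tc_trace (\<Phi> B)"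
      by (simp add: dual_map_one [OF bc] tc_trace_cyclic flip: tc_trace_adj)
    then show ?thesis by (simp add: complex_eq_iff)
  qed
  moreover have "Im (tc_trace (tc_rmult B H)) = 0" if "H \<in> self_adjoint_ops" for H
  proof -
    have "tc_adj (tc_rmult B H) = tc_lmult H B"
      using that by (simp add: of_tc_inject [symmetric] tc_adj.rep_eq tc_rmult.rep_eq tc_lmult.rep_eq adj_mult self_adjoint_ops_def)
        (metis B tc_adj.rep_eq)
    then have "cnj (tc_trace (tc_rmult B H)) = tc_trace (tc_rmult B H)"
      by (simp add: tc_trace_cyclic flip: tc_trace_adj)
    then show ?thesis by (simp add: complex_eq_iff)
  qed
  ultimately show ?thesis by (auto simp: B complex_eq_iff)
qed

theorem corollary5p1:
  fixes B :: "'h::chilbert_space tc"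
  assumes "separable_space (euclidean :: 'h topology)"
  shows "(Re (op_trace (of_tc B)) \<noteq> 0 \<longrightarrow>
      bij_betw (\<lambda>(H, \<Phi>). Xi H \<Phi>)
        {(H, \<Phi>). H \<in> self_adjoint_ops \<and> \<Phi> \<in> CP_restricted B \<and>
          Im (op_trace (of_tc (\<Phi> B))) = 2 * Re (op_trace (adj (of_tc B) * H))}
        CPTP_generators) \<and>
    (adj (of_tc B) = of_tc B \<and> op_trace (of_tc B) \<noteq> 0 \<longrightarrow>
      bij_betw (\<lambda>(H, \<Phi>). Xi H \<Phi>)
        ({H \<in> self_adjoint_ops. op_trace (of_tc B * H) = 0} \<times> CP_restricted B)
        CPTP_generators)"
proof (intro conjI impI)
  have tr: "op_trace (adj (of_tc B) * H) = tc_trace (tc_rmult (tc_adj B) H)"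
    "op_trace (of_tc B * H) = tc_trace (tc_rmult B H)" for H
    by (simp_all add: tc_trace.rep_eq tc_rmult.rep_eq tc_adj.rep_eq)
  show 1: "bij_betw (\<lambda>(H, \<Phi>). Xi H \<Phi>)
      {(H, \<Phi>). H \<in> self_adjoint_ops \<and> \<Phi> \<in> CP_restricted B \<and>
        Im (op_trace (of_tc (\<Phi> B))) = 2 * Re (op_trace (adj (of_tc B) * H))}
      CPTP_generators" if "Re (op_trace (of_tc B)) \<noteq> 0"
    using Xi_bij_betw [of B, unfolded tc_trace.rep_eq, OF that] by (simp only: tr tc_trace.rep_eq)
  assume B: "adj (of_tc B) = of_tc B \<and> op_trace (of_tc B) \<noteq> 0"
  then have Bs: "tc_adj B = B" by (simp add: of_tc_inject [symmetric] tc_adj.rep_eq)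
  \<comment> \<open>A self-adjoint operator has real trace, so a nonzero trace has nonzero real part
    and the first claim applies.\<close>
  then have "Im (tc_trace B) = 0" using tc_trace_adj [of B] by (simp add: complex_eq_iff)
  then have "Re (op_trace (of_tc B)) \<noteq> 0" using B by (simp add: tc_trace.rep_eq complex_eq_iff)
  from 1 [OF this] show "bij_betw (\<lambda>(H, \<Phi>). Xi H \<Phi>)
      ({H \<in> self_adjoint_ops. op_trace (of_tc B * H) = 0} \<times> CP_restricted B) CPTP_generators"
    using restricted_domain_self_adjoint [OF Bs] by (simp add: tr tc_trace.rep_eq)
qed

end
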